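(* Let $n\ge 1$ and consider a deck of $2n$ cards, with $L, R$ the left and right (un)shuffles and $I, O$ the in and out (perfect) shuffles, regarded as permutations of $\{0,1,\dots,2n-1\}$. Then: (a) If $2n=12$, then $\langle L,R\rangle=\langle I,O\rangle$, and this group is isomorphic to a semi-direct product $\mathbb{Z}_2^6\rtimes S_5$, where $S_5$ is the symmetric group on $5$ elements. (b) If $2n=24$, then $\langle L,R\rangle=\langle I,O\rangle$, and this group is isomorphic to a semi-direct product $\mathbb{Z}_2^{11}\rtimes M_{12}$, where $M_{12}$ is the Mathieu group of degree $12$; the group has order $2^{11}\cdot 95040$. (c) If $2n=2^k$ for a positive integer $k$, then $\langle L,R\rangle=\langle I,O\rangle$, and this group is isomorphic to a semi-direct product $\mathbb{Z}_2^k\rtimes\mathbb{Z}_k$. (d) If $n\equiv 0\pmod 4$, $n>12$, and $n$ is not a power of $2$, then $\langle L,R\rangle=\langle I,O\rangle$, and this group is the intersection of the kernels of $\mathrm{sgn}$ and $\overline{\mathrm{sgn}}$ and has order $n!\,2^{n-2}$. (e) If $n\equiv 1\pmod 4$ and $n>1$, then $\langle L,R\rangle=\langle I,O\rangle$, and this group is the kernel of $\overline{\mathrm{sgn}}$ and has order $n!\,2^{n-1}$. (f) If $n\equiv 2\pmod 4$ and $n>6$, then $\langle L,R\rangle=\langle I,O\rangle=B_n$, which has order $n!\,2^n$. (g) If $n\equiv 3\pmod 4$, then $\langle L,R\rangle=B_n$, which has order $n!\,2^n$.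
   Context: Cards are indexed by their distance from the top of the deck: positions $0,1,\dots,2n-1$. A shuffle is identified with the permutation of $\{0,\dots,2n-1\}$ sending the position $i$ of a card before the shuffle to its position after the shuffle; products are compositions of functions (read right to left), and $\langle\cdot,\cdot\rangle$ is the subgroup of the symmetric group $S_{2n}$ on $\{0,\dots,2n-1\}$ generated by the listed elements. Left and right shuffles: deal the deck from the top alternately into two piles (first card to the left pile), then put the left pile on top of the right ($L$) or the right pile on top of the left ($R$). Explicitly, $L(i)=n-1-\tfrac{i}{2}$ for $i$ even, $L(i)=2n-\tfrac{i+1}{2}$ for $i$ odd; $R(i)=2n-1-\tfrac{i}{2}$ for $i$ even, $R(i)=n-\tfrac{i+1}{2}$ for $i$ odd. In and out (perfect) shuffles: cut the deck exactly in half and perfectly interlace the halves. Explicitly, $I(i)=2i+1$ for $0\le i\le n-1$, $I(i)=2i-2n$ for $n\le i\le 2n-1$; $O(i)=2i$ for $0\le i\le n-1$, $O(i)=2i-2n+1$ for $n\le i\le 2n-1$. $B_n$ is the group of centrally symmetric permutations: all permutations $g$ of $\{0,\dots,2n-1\}$ such that $i+j=2n-1$ implies $g(i)+g(j)=2n-1$. Each $g\in B_n$ induces a permutation $\phi(g)$ of the $n$ centrally symmetric pairs $\{i,2n-1-i\}$, giving a homomorphism $\phi:B_n\to S_n$. The homomorphism $\mathrm{sgn}:B_n\to\{\pm1\}$ sends $g$ to its sign as a permutation of the $2n$ elements, and $\overline{\mathrm{sgn}}:B_n\to\{\pm1\}$ sends $g$ to the sign of $\phi(g)\in S_n$. The kernels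 above are subgroups of $B_n$. *)

theory Defs
  imports "HOL-Algebra.Algebra"
begin

definition left_shuffle :: "nat \<Rightarrow> nat \<Rightarrow> nat" where
  "left_shuffle n i =
     (if i < 2 * n then if even i then n - 1 - i div 2 else 2 * n - (i + 1) div 2 else i)"

definition right_shuffle :: "nat \<Rightarrow> nat \<Rightarrow> nat" where
  "right_shuffle n i =
     (if i < 2 * n then if even i then 2 * n - 1 - i div 2 else n - (i + 1) div 2 else i)"

definition in_shuffle :: "nat \<Rightarrow> nat \<Rightarrow> nat" where
  "in_shuffle n i =
     (if i < 2 * n then if i < n then 2 * i + 1 else 2 * i - 2 * n else i)"

definition out_shuffle :: "nat \<Rightarrow> nat \<Rightarrow> nat" where
  "out_shuffle n i =
     (if i < 2 * n then if i < n then 2 * i else 2 * i - 2 * n + 1 else i)"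

text \<open>The library's \<^const>\<open>sym_group\<close> permutes \<open>{1..m}\<close>; deck positions start at \<open>0\<close>.\<close>

definition deck_group :: "nat \<Rightarrow> (nat \<Rightarrow> nat) monoid" where
  "deck_group n = \<lparr>carrier = {p. p permutes {0..<2 * n}}, monoid.mult = (\<circ>), one = id\<rparr>"

definition LR_group :: "nat \<Rightarrow> (nat \<Rightarrow> nat) monoid" where
  "LR_group n = subgroup_generated (deck_group n) {left_shuffle n, right_shuffle n}"

definition IO_group :: "nat \<Rightarrow> (nat \<Rightarrow> nat) monoid" where
  "IO_group n = subgroup_generated (deck_group n) {in_shuffle n, out_shuffle n}"

definition B_group :: "nat \<Rightarrow> (nat \<Rightarrow> nat) monoid" where
  "B_group n = (deck_group n)
     \<lparr>carrier := {g. g permutes {0..<2 * n} \<and>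
        (\<forall>i<2 * n. \<forall>j<2 * n. i + j = 2 * n - 1 \<longrightarrow> g i + g j = 2 * n - 1)}\<rparr>"

definition sym_pairs :: "nat \<Rightarrow> nat set set" where
  "sym_pairs n = {{i, 2 * n - 1 - i} | i. i < 2 * n}"

text \<open>The action on the symmetric pairs is by taking images; \<^const>\<open>restrict_id\<close> extends it by the
  identity to all other sets of positions, so that the library's \<^const>\<open>sign\<close> applies to it.\<close>

definition pair_perm :: "nat \<Rightarrow> (nat \<Rightarrow> nat) \<Rightarrow> nat set \<Rightarrow> nat set" where
  "pair_perm n g = restrict_id ((`) g) (sym_pairs n)"

definition sgn_bar :: "nat \<Rightarrow> (nat \<Rightarrow> nat) \<Rightarrow> int" where
  "sgn_bar n g = sign (pair_perm n g)"

definition semidirect_product ::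
    "('a, 'c) monoid_scheme \<Rightarrow> ('b, 'd) monoid_scheme \<Rightarrow> ('b \<Rightarrow> 'a \<Rightarrow> 'a) \<Rightarrow> ('a \<times> 'b) monoid" where
  "semidirect_product N H \<theta> =
     \<lparr>carrier = carrier N \<times> carrier H,
      monoid.mult = (\<lambda>(x, h) (y, k). (x \<otimes>\<^bsub>N\<^esub> \<theta> h y, h \<otimes>\<^bsub>H\<^esub> k)),
      one = (\<one>\<^bsub>N\<^esub>, \<one>\<^bsub>H\<^esub>)\<rparr>"

definition iso_to_semidirect_product ::
    "('e, 'f) monoid_scheme \<Rightarrow> ('a, 'c) monoid_scheme \<Rightarrow> ('b, 'd) monoid_scheme \<Rightarrow> bool" where
  "iso_to_semidirect_product G N H \<longleftrightarrow>
     (\<exists>\<theta> \<in> hom H (AutoGroup N). G \<cong> semidirect_product N H \<theta>)"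

definition Z2_power :: "nat \<Rightarrow> (nat \<Rightarrow> int) monoid" where
  "Z2_power k = product_group {..<k} (\<lambda>_. integer_mod_group 2)"

text \<open>The classical generators of the Mathieu group of degree 12. Reading the point \<open>i \<le> 11\<close> as
  \<open>i - 1\<close> in the field with 11 elements and the point \<open>12\<close> as infinity, they are the maps
  \<open>x + 1\<close>, \<open>4 x^2 - 3 x^7\<close> and \<open>-1 / x\<close> of the projective line.\<close>

definition mathieu_12 :: "(nat \<Rightarrow> nat) monoid" where
  "mathieu_12 = subgroup_generated (sym_group 12)
     {cycle_of_list [1, 2, 3, 4, 5, 6, 7, 8, 9, 10, 11],
      cycle_of_list [3, 7, 11, 8] \<circ> cycle_of_list [4, 10, 5, 6],
      cycle_of_list [1, 12] \<circ> cycle_of_list [2, 11] \<circ> cycle_of_list [3, 6] \<circ>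
        cycle_of_list [4, 8] \<circ> cycle_of_list [5, 9] \<circ> cycle_of_list [7, 10]}"

text \<open>\<^const>\<open>subgroup_generated\<close> discards generators outside the ambient carrier; the following
  facts show that none is lost here.\<close>

lemma deck_permI:
  fixes n :: nat
  assumes "\<And>i. i < 2 * n \<Longrightarrow> f i < 2 * n" "\<And>i. \<not> i < 2 * n \<Longrightarrow> f i = i"
    and "\<And>i j. i < 2 * n \<Longrightarrow> j < 2 * n \<Longrightarrow> f i = f j \<Longrightarrow> i = j"
  shows "f permutes {0..<2 * n}"
proof (rule bij_imp_permutes)
  have inj: "inj_on f {0..<2 * n}" using assms(3) by (auto intro!: inj_onI)
  have "f ` {0..<2 * n} = {0..<2 * n}"
    by (rule endo_inj_surj) (use assms(1) inj in auto)
  with inj show "bij_betw f {0..<2 * n} {0..<2 * n}" by (simp add: bij_betw_def)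
qed (use assms(2) in auto)

lemma left_shuffle_simps:
  "a < n \<Longrightarrow> left_shuffle n (2 * a) = n - 1 - a"
  "a < n \<Longrightarrow> left_shuffle n (2 * a + 1) = 2 * n - 1 - a"
  by (simp_all add: left_shuffle_def)

lemma right_shuffle_simps:
  "a < n \<Longrightarrow> right_shuffle n (2 * a) = 2 * n - 1 - a"
  "a < n \<Longrightarrow> right_shuffle n (2 * a + 1) = n - 1 - a"
  by (simp_all add: right_shuffle_def)

lemma position_cases:
  fixes i n :: nat
  assumes "i < 2 * n"
  obtains a where "a < n" "i = 2 * a" | a where "a < n" "i = 2 * a + 1"
  using assms by (cases "even i") (auto elim!: evenE oddE)

lemma left_shuffle_permutes: "left_shuffle n permutes {0..<2 * n}"
proof (rule deck_permI)
  fix i j assume i: "i < 2 * n" and j: "j < 2 * n" and eq: "left_shuffle n i = left_shuffle n j"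
  show "i = j"
    by (rule position_cases[OF i]; rule position_cases[OF j]; insert eq;
        simp only: left_shuffle_simps; linarith)
next
  fix i assume i: "i < 2 * n"
  show "left_shuffle n i < 2 * n"
    by (rule position_cases[OF i]; simp only: left_shuffle_simps; linarith)
qed (simp add: left_shuffle_def)

lemma right_shuffle_permutes: "right_shuffle n permutes {0..<2 * n}"
proof (rule deck_permI)
  fix i j assume i: "i < 2 * n" and j: "j < 2 * n" and eq: "right_shuffle n i = right_shuffle n j"
  show "i = j"
    by (rule position_cases[OF i]; rule position_cases[OF j]; insert eq;
        simp only: right_shuffle_simps; linarith)
next
  fix i assume i: "i < 2 * n"
  show "right_shuffle n i < 2 * n"
    by (rule position_cases[OF i]; simp only: right_shuffle_simps; linarith)
qed (simp add: right_shuffle_def)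

lemma in_shuffle_simps:
  "a < n \<Longrightarrow> in_shuffle n a = 2 * a + 1"
  "a < n \<Longrightarrow> in_shuffle n (n + a) = 2 * a"
  by (simp_all add: in_shuffle_def)

lemma out_shuffle_simps:
  "a < n \<Longrightarrow> out_shuffle n a = 2 * a"
  "a < n \<Longrightarrow> out_shuffle n (n + a) = 2 * a + 1"
  by (simp_all add: out_shuffle_def)

lemma half_cases:
  fixes i n :: nat
  assumes "i < 2 * n"
  obtains "i < n" | a where "a < n" "i = n + a"
proof (cases "i < n")
  case False
  then have "i - n < n" "i = n + (i - n)" using assms by linarith+
  then show ?thesis using that(2) by blast
qed (use that in blast)

lemma in_shuffle_permutes: "in_shuffle n permutes {0..<2 * n}"
proof (rule deck_permI)
  fix i j assume i: "i < 2 * n" and j: "j < 2 * n" and eq: "in_shuffle n i = in_shuffle n j"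
  show "i = j"
    by (rule half_cases[OF i]; rule half_cases[OF j]; insert eq; simp add: in_shuffle_simps; presburger)
qed (auto simp: in_shuffle_def)

lemma out_shuffle_permutes: "out_shuffle n permutes {0..<2 * n}"
proof (rule deck_permI)
  fix i j assume i: "i < 2 * n" and j: "j < 2 * n" and eq: "out_shuffle n i = out_shuffle n j"
  show "i = j"
    by (rule half_cases[OF i]; rule half_cases[OF j]; insert eq; simp add: out_shuffle_simps; presburger)
qed (auto simp: out_shuffle_def)

lemma sym_position_cases:
  fixes i j n :: nat
  assumes "i < 2 * n" "i + j = 2 * n - 1"
  obtains a b where "i = 2 * a" "j = 2 * b + 1" "a < n" "b < n" "a + b = n - 1"
  | a b where "i = 2 * a + 1" "j = 2 * b" "a < n" "b < n" "a + b = n - 1"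
proof (cases "even i")
  case True
  then obtain a where a: "i = 2 * a" by (rule evenE)
  define b where "b = n - 1 - a"
  have "a < n" "b < n" "j = 2 * b + 1" "a + b = n - 1"
    using assms a unfolding b_def by linarith+
  then show ?thesis using a that(1) by blast
next
  case False
  then obtain a where a: "i = 2 * a + 1" by (rule oddE)
  define b where "b = n - 1 - a"
  have "a < n" "b < n" "j = 2 * b" "a + b = n - 1"
    using assms a unfolding b_def by linarith+
  then show ?thesis using a that(2) by blast
qed

lemma sym_half_cases:
  fixes i j n :: nat
  assumes "i < 2 * n" "i + j = 2 * n - 1"
  obtains a where "a < n" "i = n + a" "j = n - 1 - a" | a where "a < n" "i = n - 1 - a" "j = n + a"
proof (cases "i < n")
  case True
  then have "n - 1 - i < n" "i = n - 1 - (n - 1 - i)" "j = n + (n - 1 - i)"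
    using assms by linarith+
  then show ?thesis using that(2) by blast
next
  case False
  then have "i - n < n" "i = n + (i - n)" "j = n - 1 - (i - n)" using assms by linarith+
  then show ?thesis using that(1) by blast
qed

lemma shuffles_in_B_group:
  "{left_shuffle n, right_shuffle n, in_shuffle n, out_shuffle n} \<subseteq> carrier (B_group n)"
proof -
  have "left_shuffle n i + left_shuffle n j = 2 * n - 1 \<and>
      right_shuffle n i + right_shuffle n j = 2 * n - 1 \<and>
      in_shuffle n i + in_shuffle n j = 2 * n - 1 \<and>
      out_shuffle n i + out_shuffle n j = 2 * n - 1"
    if ij: "i < 2 * n" "i + j = 2 * n - 1" for i j
  proof (intro conjI)
    show "left_shuffle n i + left_shuffle n j = 2 * n - 1"
      by (rule sym_position_cases[OF ij]; simp only: left_shuffle_simps; linarith)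
    show "right_shuffle n i + right_shuffle n j = 2 * n - 1"
      by (rule sym_position_cases[OF ij]; simp only: right_shuffle_simps; linarith)
    show "in_shuffle n i + in_shuffle n j = 2 * n - 1"
      by (rule sym_half_cases[OF ij]) (simp_all add: in_shuffle_simps)
    show "out_shuffle n i + out_shuffle n j = 2 * n - 1"
      by (rule sym_half_cases[OF ij]) (simp_all add: out_shuffle_simps)
  qed
  then show ?thesis
    using left_shuffle_permutes right_shuffle_permutes in_shuffle_permutes out_shuffle_permutes
    by (simp add: B_group_def)
qed

lemma B_group_subset_deck_group: "carrier (B_group n) \<subseteq> carrier (deck_group n)"
  by (auto simp: B_group_def deck_group_def)

lemma cycle_in_sym_group_12:
  "set cs \<subseteq> {1..12} \<Longrightarrow> cycle_of_list cs permutes {1..12}"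
  using cycle_permutes permutes_subset by blast

lemma mathieu_12_gens_in_sym_group:
  "{cycle_of_list [1, 2, 3, 4, 5, 6, 7, 8, 9, 10, 11],
    cycle_of_list [3, 7, 11, 8] \<circ> cycle_of_list [4, 10, 5, 6],
    cycle_of_list [1, 12] \<circ> cycle_of_list [2, 11] \<circ> cycle_of_list [3, 6] \<circ>
      cycle_of_list [4, 8] \<circ> cycle_of_list [5, 9] \<circ> cycle_of_list [7, 10]}
   \<subseteq> carrier (sym_group 12)"
  unfolding sym_group_def insert_subset
  by (intro conjI empty_subsetI; simp only: mem_Collect_eq partial_object.simps;
      intro permutes_compose cycle_in_sym_group_12; simp)

end

theory Submission
  imports Defs
begin

text \<open>A deck of \<open>2 n\<close> cards consists of \<open>n\<close> mirror pairs
  \<open>{i, 2 n - 1 - i}\<close>, and all four shuffles respect these pairs. A centrally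
  symmetric permutation \<open>g\<close> therefore induces a permutation of the pairs, written
  \<open>bar n g\<close> on the representatives below \<open>n\<close>, and the kernel of
  \<open>bar n\<close> consists of the flips: \<open>flip n S\<close> exchanges the two
  positions of each pair in \<open>S\<close>. Each shuffle group is an extension of its image
  under \<open>bar n\<close> by the flips it contains, and the proof determines these two parts.

  The image. The out shuffle induces \<open>monge n\<close>, and the in shuffle is the out
  shuffle followed by the exchange of the neighbours \<open>2 i\<close> and \<open>2 i +
  1\<close>, which induces \<open>rev_blocks n 2\<close>. The right and left shuffles are the
  inverses of the out and in shuffles up to the mirror, which acts trivially on the pairs. Hence
  both groups have the same image \<open>folded_group n\<close>, generated by \<open>monge
  n\<close> and \<open>rev_blocks n 2\<close>. Conjugation by \<open>monge n\<close> doubles the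
  length of reversed blocks (\<open>monge_rev_blocks\<close>), so the image contains many block
  reversals. Explicit products of them yield three-cycles when \<open>n\<close> is odd or twice
  an odd number, and \<open>contains_alternating_double\<close> passes from \<open>n\<close> to
  \<open>2 n\<close>; with separate computations for \<open>n = 10\<close> and \<open>n =
  24\<close> this gives the alternating group unless \<open>n\<close> is \<open>6\<close>,
  \<open>12\<close> or a power of two (\<open>folded_contains_alternating\<close>).

  The flips. Suppose that some element fixes a position and exchanges the positions of some
  other pair. The cube of its commutator with a suitable lift of a three-cycle is a flip of few
  pairs (\<open>crossing_gives_flip\<close>), and the alternating group spreads it to all flips
  of an even number of pairs. If there is no such element, one position can be selected from
  each pair in such a way that each element maps the selection to itself or to its complement
  (\<open>invariant_section\<close>). The formulas for the in and out shuffles then force a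
  position to be selected if and only if its number of binary ones is even, and for such a
  selection the formulas are contradictory unless \<open>n\<close> is a power of two
  (\<open>no_invariant_section\<close>).

  So for generic \<open>n\<close> both groups contain all elements on which the two sign
  homomorphisms are trivial, and what else they contain depends on the signs of the generators,
  which are periodic in \<open>n\<close> with period four. The orders come from the count
  \<open>n! 2^n\<close> of all centrally symmetric permutations.

  The exceptions. For \<open>2 n = 2^k\<close> positions are bit vectors, the out shuffle
  rotates the bits and the in shuffle moreover inverts one bit, so the groups consist of the
  affine maps formed from rotations and translations. For \<open>n = 6\<close> and \<open>n =
  12\<close> the image is not the alternating group: it permutes five perfect matchings of six
  points, respectively it is the Mathieu group, whose order follows from its action on the
  hexads of a Steiner system. In both cases a power of a short product of in and out shuffles flips
  one or two pairs, from which the group of all flips in question is generated; the lifts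
  \<open>unfold_perm n p\<close> of the elements \<open>p\<close> of the image are a complement
  to it.\<close>

section \<open>Permutation groups and three-cycles\<close>

text \<open>The permutations to be generated have finite order, so that closure under
  composition provides the inverses. Leaving inverses out keeps inductions to one generator per
  step.\<close>

inductive_set gen_by :: "('a \<Rightarrow> 'a) set \<Rightarrow> ('a \<Rightarrow> 'a) set" for S where
  gen_id: "id \<in> gen_by S"
| gen_step: "f \<in> S \<Longrightarrow> g \<in> gen_by S \<Longrightarrow> f \<circ> g \<in> gen_by S"

lemma gen_by_incl: "f \<in> S \<Longrightarrow> f \<in> gen_by S"
  using gen_step[OF _ gen_id, of f S] by simp

lemma gen_by_comp: "f \<in> gen_by S \<Longrightarrow> g \<in> gen_by S \<Longrightarrow> f \<circ> g \<in> gen_by S"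
  by (induction rule: gen_by.induct) (auto simp: comp_assoc intro: gen_step)

locale perm_group =
  fixes A :: "'a set" and M :: "('a \<Rightarrow> 'a) set"
  assumes finite_points: "finite A"
    and permutes: "p \<in> M \<Longrightarrow> p permutes A"
    and id_mem: "id \<in> M"
    and comp_mem: "p \<in> M \<Longrightarrow> q \<in> M \<Longrightarrow> p \<circ> q \<in> M"
begin

lemma finite_mem: "finite M"
  by (rule finite_subset[OF _ finite_permutations[OF finite_points]]) (use permutes in auto)

text \<open>Composition with \<open>p\<close> is injective on the finite set \<open>M\<close>,
  hence onto, and therefore takes the identity as a value.\<close>

lemma inv_mem:
  assumes "p \<in> M"
  shows "inv' p \<in> M"
proof -
  have b: "bij p" using permutes[OF assms] by (rule permutes_bij)
  have "inj_on ((\<circ>) p) M"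
  proof (rule inj_onI)
    fix x y assume "p \<circ> x = p \<circ> y"
    then have "inv' p \<circ> (p \<circ> x) = inv' p \<circ> (p \<circ> y)" by simp
    then show "x = y" using b by (simp add: bij_is_inj o_assoc)
  qed
  then have "(\<circ>) p ` M = M"
    by (intro endo_inj_surj[OF finite_mem]) (use assms comp_mem in auto)
  then obtain q where q: "q \<in> M" "p \<circ> q = id" using id_mem by (metis imageE)
  then have "inv' p \<circ> (p \<circ> q) = inv' p" by simp
  then have "q = inv' p" using b by (simp add: bij_is_inj o_assoc)
  then show ?thesis using q by simp
qed

lemma conj_mem: "p \<in> M \<Longrightarrow> q \<in> M \<Longrightarrow> p \<circ> q \<circ> inv' p \<in> M"
  by (intro comp_mem inv_mem)

lemma funpow_mem: "p \<in> M \<Longrightarrow> p ^^ k \<in> M"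
  by (induction k) (auto simp: id_mem[unfolded id_def] id_mem comp_mem)

lemma bij_mem: "p \<in> M \<Longrightarrow> bij p"
  using permutes permutes_bij by blast

lemma gen_by_subset: "S \<subseteq> M \<Longrightarrow> gen_by S \<subseteq> M"
proof
  fix x assume "x \<in> gen_by S" "S \<subseteq> M"
  then show "x \<in> M" by (induction rule: gen_by.induct) (auto intro: id_mem comp_mem)
qed

end

lemma perm_group_gen_by:
  assumes "finite A" and "\<And>p. p \<in> S \<Longrightarrow> p permutes A"
  shows "perm_group A (gen_by S)"
proof
  fix p assume "p \<in> gen_by S"
  then show "p permutes A"
  proof (induction rule: gen_by.induct)
    case gen_id
    show ?case by (rule permutes_id)
  next
    case (gen_step f g)
    then show ?case using permutes_compose assms(2) by blast
  qed
qed (auto intro: assms gen_by.intros gen_by_comp)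

definition three_cycle :: "'a \<Rightarrow> 'a \<Rightarrow> 'a \<Rightarrow> 'a \<Rightarrow> 'a" where
  "three_cycle a b c = transpose a b \<circ> transpose b c"

lemma three_cycle_apply:
  assumes "distinct [a, b, c]"
  shows "three_cycle a b c x = (if x = a then b else if x = b then c else if x = c then a else x)"
  using assms by (auto simp: three_cycle_def transpose_def)

lemma three_cycle_rotate: "distinct [a, b, c] \<Longrightarrow> three_cycle b c a = three_cycle a b c"
  by (rule ext) (auto simp: three_cycle_apply)

lemma three_cycle_square: "distinct [a, b, c] \<Longrightarrow> three_cycle a b c \<circ> three_cycle a b c = three_cycle a c b"
  by (rule ext) (auto simp: three_cycle_apply)

lemma three_cycle_permutes: "a \<in> A \<Longrightarrow> b \<in> A \<Longrightarrow> c \<in> A \<Longrightarrow> three_cycle a b c permutes A"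
  unfolding three_cycle_def by (intro permutes_compose permutes_swap_id)

lemma bij_distinct3: "bij p \<Longrightarrow> distinct [a, b, c] \<Longrightarrow> distinct [p a, p b, p c]"
  by (auto dest: bij_is_inj injD)

lemma three_cycle_conj:
  assumes "bij p" "distinct [a, b, c]"
  shows "p \<circ> three_cycle a b c \<circ> inv' p = three_cycle (p a) (p b) (p c)"
proof (rule ext)
  fix x
  obtain y where x: "x = p y" using bij_pointE[OF assms(1)] by metis
  have eq: "p u = p v \<longleftrightarrow> u = v" for u v using bij_is_inj[OF assms(1)] by (auto dest: injD)
  have "inv' p (p y) = y" using assms(1) by (simp add: bij_is_inj)
  then show "(p \<circ> three_cycle a b c \<circ> inv' p) x = three_cycle (p a) (p b) (p c) x"
    using assms(2) by (simp add: x eq three_cycle_apply)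
qed

text \<open>Two permutations that move only one point in common have a three-cycle as
  commutator. This is how single three-cycles are obtained from permutations that move many
  points.\<close>

lemma commutator_three_cycle:
  assumes f: "bij f" and g: "bij g" and a: "f a \<noteq> a" "g a \<noteq> a"
    and one: "\<And>x. x \<noteq> a \<Longrightarrow> f x = x \<or> g x = x"
  shows "distinct [a, f a, g a]" "f \<circ> g \<circ> inv' f \<circ> inv' g = three_cycle a (f a) (g a)"
proof -
  have fi: "f u = f v \<longleftrightarrow> u = v" for u v using bij_is_inj[OF f] by (auto dest: injD)
  have gi: "g u = g v \<longleftrightarrow> u = v" for u v using bij_is_inj[OF g] by (auto dest: injD)
  have gfa: "g (f a) = f a" using one[of "f a"] a fi by auto
  have fga: "f (g a) = g a" using one[of "g a"] a gi by auto
  show d: "distinct [a, f a, g a]" using a gfa by (auto simp: gi)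
  have "f (g y) = three_cycle a (f a) (g a) (g (f y))" for y
  proof (cases "y = a")
    case True then show ?thesis using d gfa fga by (auto simp: three_cycle_apply)
  next
    case False
    then consider "f y = y" "g y = y" | "f y = y" "g y \<noteq> y" | "g y = y" "f y \<noteq> y"
      using one by blast
    then show ?thesis
    proof cases
      case 1
      then have "y \<noteq> f a" "y \<noteq> g a" using a gi fi gfa fga by metis+
      then show ?thesis using 1 d False by (simp add: three_cycle_apply)
    next
      case 2
      have n: "g y \<noteq> f a" "g y \<noteq> g a" using 2 False gfa gi by metis+
      show ?thesis
      proof (cases "g y = a")
        case True then show ?thesis using 2 d by (auto simp: three_cycle_apply)
      next
        case False
        have "f (g y) = g y" using one[OF False] 2 gi by metis
        then show ?thesis using 2 n False d by (simp add: three_cycle_apply)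
      qed
    next
      case 3
      have n: "f y \<noteq> f a" "f y \<noteq> g a" using 3 False fga fi by metis+
      show ?thesis
      proof (cases "f y = a")
        case True then show ?thesis using 3 d by (auto simp: three_cycle_apply)
      next
        case False
        have "g (f y) = f y" using one[OF False] 3 fi by metis
        then show ?thesis using 3 n False d by (simp add: three_cycle_apply)
      qed
    qed
  qed
  then have "f \<circ> g = three_cycle a (f a) (g a) \<circ> (g \<circ> f)" by auto
  then have "f \<circ> g \<circ> inv' f \<circ> inv' g = three_cycle a (f a) (g a) \<circ> (g \<circ> (f \<circ> inv' f) \<circ> inv' g)"
    by (simp add: o_assoc)
  also have "\<dots> = three_cycle a (f a) (g a)"
    using f g by (simp add: bij_is_surj surj_iff[THEN iffD1])
  finally show "f \<circ> g \<circ> inv' f \<circ> inv' g = three_cycle a (f a) (g a)" .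
qed

context perm_group begin

text \<open>Lying on a common three-cycle of \<open>M\<close>. The relation is an equivalence
  that the group preserves, so that linking all points to a single one suffices to obtain every
  three-cycle.\<close>

definition linked :: "'a \<Rightarrow> 'a \<Rightarrow> bool" where
  "linked a b \<longleftrightarrow> a = b \<or> (\<exists>c. distinct [a, b, c] \<and> three_cycle a b c \<in> M)"

lemma linked_refl: "linked a a" by (simp add: linked_def)

lemma three_cycle_mem_rotate: "distinct [a, b, c] \<Longrightarrow> three_cycle a b c \<in> M \<Longrightarrow> three_cycle b c a \<in> M"
  by (simp add: three_cycle_rotate)

lemma three_cycle_mem_swap: "distinct [a, b, c] \<Longrightarrow> three_cycle a b c \<in> M \<Longrightarrow> three_cycle a c b \<in> M"
  using comp_mem three_cycle_square by metis

lemma three_cycle_mem_conj: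
  "p \<in> M \<Longrightarrow> distinct [a, b, c] \<Longrightarrow> three_cycle a b c \<in> M \<Longrightarrow> three_cycle (p a) (p b) (p c) \<in> M"
  using conj_mem three_cycle_conj bij_mem by metis

lemma linked_sym: "linked a b \<Longrightarrow> linked b a"
  unfolding linked_def using three_cycle_mem_swap three_cycle_mem_rotate
  by (metis distinct_length_2_or_more distinct_singleton)

lemma linked_apply: "p \<in> M \<Longrightarrow> linked a b \<Longrightarrow> linked (p a) (p b)"
  unfolding linked_def using three_cycle_mem_conj bij_distinct3[OF bij_mem] by metis

lemma linkedI: "distinct [a, b, c] \<Longrightarrow> three_cycle a b c \<in> M \<Longrightarrow> linked a b"
  by (auto simp: linked_def)

lemma linked_trans:
  assumes "linked a b" "linked b d"
  shows "linked a d"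
proof (cases "a = b \<or> b = d \<or> a = d")
  case True
  then show ?thesis using assms linked_refl by auto
next
  case False
  then obtain c e where c: "distinct [a, b, c]" "three_cycle a b c \<in> M"
    and e: "distinct [b, d, e]" "three_cycle b d e \<in> M"
    using assms by (auto simp: linked_def)
  note x = three_cycle_mem_conj[OF e(2) c]
  show ?thesis
  proof (cases "d = c")
    case True
    then show ?thesis using c three_cycle_mem_swap[OF c] linkedI[of a c b] by auto
  next
    case dc: False
    consider "e = a" | "e = c" | "e \<noteq> a" "e \<noteq> c" by blast
    then show ?thesis
    proof cases
      case 1
      have "three_cycle b d c \<in> M" using x e c dc False 1 by (auto simp: three_cycle_apply split: if_splits)
      moreover have d: "distinct [b, d, a]" using e 1 by simp
      ultimately have "three_cycle d a c \<in> M"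
        using three_cycle_mem_conj[OF e(2), of b d c] 1 e c dc False by (auto simp: three_cycle_apply split: if_splits)
      then have "linked d a" using dc c False by (intro linkedI[of d a c]) auto
      then show ?thesis by (rule linked_sym)
    next
      case 2
      have "three_cycle a d b \<in> M" using x e c dc False 2 by (auto simp: three_cycle_apply split: if_splits)
      then show ?thesis using False by (intro linkedI[of a d b]) auto
    next
      case 3
      have "three_cycle a d c \<in> M" using x e c dc False 3 by (auto simp: three_cycle_apply split: if_splits)
      then show ?thesis using False dc c by (intro linkedI[of a d c]) auto
    qed
  qed
qed

text \<open>Conjugating one of the two given three-cycles by the other replaces its third point;
  the cases are the possible coincidences of the third points with the points \<open>a\<close>
  and \<open>c\<close> and with each other.\<close>

lemma three_cycle_mem_if_linked:
  assumes ab: "linked a b" and bc: "linked b c" and abc: "distinct [a, b, c]"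
  shows "three_cycle a b c \<in> M"
proof -
  obtain d where d: "distinct [a, b, d]" "three_cycle a b d \<in> M" using ab abc by (auto simp: linked_def)
  obtain e where e: "distinct [b, c, e]" "three_cycle b c e \<in> M" using bc abc by (auto simp: linked_def)
  show ?thesis
  proof (cases "d = c")
    case False
    consider "e = a" | "e = d" | "e \<noteq> a" "e \<noteq> d" by blast
    then show ?thesis
    proof cases
      case 1 then show ?thesis using e three_cycle_rotate[OF abc] by simp
    next
      case 2
      have "three_cycle a c b \<in> M"
        using three_cycle_mem_conj[OF e(2) d] 2 e d abc False by (auto simp: three_cycle_apply split: if_splits)
      then show ?thesis using three_cycle_mem_swap[of a c b] abc by auto
    next
      case 3
      have acd: "three_cycle a c d \<in> M"
        using three_cycle_mem_conj[OF e(2) d] 3 e d abc False by (auto simp: three_cycle_apply split: if_splits)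
      have "three_cycle b c a \<in> M"
        using three_cycle_mem_conj[OF d(2) _ acd] d abc False by (auto simp: three_cycle_apply split: if_splits)
      then show ?thesis using three_cycle_rotate[OF abc] by simp
    qed
  qed (use d in auto)
qed

end

text \<open>Stated by three-cycles, the form in which it is established;
  \<open>even_perm_mem\<close> turns it into membership of all even permutations.\<close>

definition contains_alternating :: "'a set \<Rightarrow> ('a \<Rightarrow> 'a) set \<Rightarrow> bool" where
  "contains_alternating A M \<longleftrightarrow>
     (\<forall>a\<in>A. \<forall>b\<in>A. \<forall>c\<in>A. distinct [a, b, c] \<longrightarrow> three_cycle a b c \<in> M)"

lemma (in perm_group) contains_alternatingI:
  assumes "\<And>x. x \<in> A \<Longrightarrow> linked z x"
  shows "contains_alternating A M"
  unfolding contains_alternating_def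
  using assms linked_trans linked_sym three_cycle_mem_if_linked by meson

text \<open>If the transpositions share no point, a transposition joining them is inserted
  twice.\<close>

lemma two_transpositions_even:
  assumes M: "contains_alternating A M" and id: "id \<in> M" and comp: "\<And>p q. p \<in> M \<Longrightarrow> q \<in> M \<Longrightarrow> p \<circ> q \<in> M"
    and "a \<in> A" "b \<in> A" "c \<in> A" "d \<in> A" "a \<noteq> b" "c \<noteq> d"
  shows "transpose a b \<circ> transpose c d \<in> M"
proof -
  have *: "transpose x y \<circ> transpose y z \<in> M" if "x \<in> A" "y \<in> A" "z \<in> A" "x \<noteq> y" "y \<noteq> z" for x y z
  proof (cases "x = z")
    case True
    then show ?thesis using id by (simp add: transpose_commute[of z y])
  next
    case False
    then show ?thesis using M that unfolding contains_alternating_def three_cycle_def by auto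
  qed
  show ?thesis
  proof (cases "b = c")
    case True then show ?thesis using * assms by auto
  next
    case False
    have "transpose a b \<circ> transpose c d = (transpose a b \<circ> transpose b c) \<circ> (transpose b c \<circ> transpose c d)"
      by (simp add: fun_eq_iff)
    then show ?thesis using comp * assms False by metis
  qed
qed

lemma even_perm_mem:
  assumes "finite A" and M: "contains_alternating A M" "id \<in> M" "\<And>p q. p \<in> M \<Longrightarrow> q \<in> M \<Longrightarrow> p \<circ> q \<in> M"
    and p: "p permutes A" "sign p = 1"
  shows "p \<in> M"
proof -
  have "if sign p = 1 then p \<in> M else \<forall>a\<in>A. \<forall>b\<in>A. a \<noteq> b \<longrightarrow> transpose a b \<circ> p \<in> M"
    using p(1) \<open>finite A\<close>
  proof (induction p rule: permutes_induct)
    case id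
    then show ?case using M(2) by simp
  next
    case (swap a b p)
    have pp: "permutation p" using swap assms(1) permutation_permutes by blast
    have s: "sign (transpose a b \<circ> p) = - sign p"
      using swap pp by (simp add: sign_compose permutation_swap_id sign_swap_id)
    show ?case
    proof (cases "sign p = 1")
      case True
      have t: "transpose c d \<circ> (transpose a b \<circ> p) \<in> M" if "c \<in> A" "d \<in> A" "c \<noteq> d" for c d
        using M(3)[OF two_transpositions_even[OF M, of c d a b], of p] that swap True
        by (simp add: o_assoc)
      have n: "sign (transpose a b \<circ> p) \<noteq> 1" unfolding s True by simp
      show ?thesis unfolding if_not_P[OF n] using t by blast
    next
      case False
      then have "sign p = -1" using sign_cases[of p] by auto
      then have n: "sign (transpose a b \<circ> p) = 1" using s by simp
      show ?thesis unfolding if_P[OF n] using swap False by auto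
    qed
  qed
  then show ?thesis using p(2) by simp
qed

section \<open>Block reversals and the folded out shuffle\<close>

text \<open>A last block shorter than \<open>d\<close> stays in place. With this convention
  \<open>monge_rev_blocks\<close> also holds when \<open>n\<close> is an odd multiple of the
  block length.\<close>

definition rev_blocks :: "nat \<Rightarrow> nat \<Rightarrow> nat \<Rightarrow> nat" where
  "rev_blocks n d x =
     (if 0 < d \<and> x < n \<and> x div d * d + d \<le> n then x div d * d + (d - 1 - x mod d) else x)"

lemma block_decomposition:
  fixes x d :: nat
  assumes "0 < d"
  obtains B r where "x = B + r" "d dvd B" "r < d"
  using assms that[of "x div d * d" "x mod d"] by simp

lemma rev_blocks_apply:
  assumes "d dvd B" "r < d"
  shows "rev_blocks n d (B + r) = (if B + d \<le> n then B + (d - 1 - r) else B + r)"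
proof -
  have "(B + r) div d * d = B" "(B + r) mod d = r" using assms by auto
  then show ?thesis using assms by (simp add: rev_blocks_def)
qed

lemma dvd_block_le:
  fixes d B n :: nat
  assumes "d dvd B" "d dvd n" "B < n"
  shows "B + d \<le> n"
proof -
  have "d dvd n - B" using assms by (simp add: dvd_diff_nat)
  then have "d \<le> n - B" using assms by (intro dvd_imp_le) auto
  then show ?thesis using assms by simp
qed

lemma dvd_between_imp_eq: "h dvd k \<Longrightarrow> 0 < k \<Longrightarrow> k < h * 2 \<Longrightarrow> k = (h::nat)"
  by (metis One_nat_def dvd_def less_2_cases mult.right_neutral mult_0_right nat_less_le nat_mult_less_cancel_disj)

lemma rev_blocks_involution: "rev_blocks n d (rev_blocks n d x) = x"
proof (cases "d = 0")
  case True then show ?thesis by (simp add: rev_blocks_def)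
next
  case False
  then obtain B r where "x = B + r" "d dvd B" "r < d" using block_decomposition by blast
  then show ?thesis
    using rev_blocks_apply[of d B "d - 1 - r" n] rev_blocks_apply[of d B r n] by auto
qed

lemma rev_blocks_less: "x < n \<Longrightarrow> rev_blocks n d x < n"
proof (cases "d = 0")
  case True then show "x < n \<Longrightarrow> ?thesis" by (simp add: rev_blocks_def)
next
  case False
  assume "x < n"
  moreover obtain B r where "x = B + r" "d dvd B" "r < d" using False block_decomposition by blast
  ultimately show ?thesis using rev_blocks_apply[of d B r n] by auto
qed

lemma rev_blocks_permutes: "rev_blocks n d permutes {..<n}"
proof (rule bij_imp_permutes)
  show "bij_betw (rev_blocks n d) {..<n} {..<n}"
    by (rule bij_betwI[where g = "rev_blocks n d"])
      (auto simp: rev_blocks_less rev_blocks_involution)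
qed (simp add: rev_blocks_def)

lemma rev_blocks_whole: "x < n \<Longrightarrow> rev_blocks n n x = n - 1 - x"
  by (simp add: rev_blocks_def)

lemma rev_blocks_two:
  assumes "x < n"
  shows "rev_blocks n 2 x = (if even x then if Suc x < n then Suc x else x else x - 1)"
proof -
  obtain B r where x: "x = B + r" "2 dvd B" "r < 2" by (rule block_decomposition[of 2 x]) auto
  then have "r = 0 \<or> r = 1" by auto
  then show ?thesis using rev_blocks_apply[OF x(2,3), of n] x assms by auto
qed

text \<open>The permutation of the mirror pairs that is induced by the out shuffle; a variant of
  the Monge shuffle.\<close>

definition monge :: "nat \<Rightarrow> nat \<Rightarrow> nat" where
  "monge n x = (if x < n then if 2 * x < n then 2 * x else 2 * n - 1 - 2 * x else x)"

lemma monge_less: "x < n \<Longrightarrow> monge n x < n"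
  by (auto simp: monge_def)

lemma monge_permutes: "monge n permutes {..<n}"
proof (rule bij_imp_permutes)
  have "inj_on (monge n) {..<n}"
  proof (rule inj_onI)
    fix x y assume "x \<in> {..<n}" "y \<in> {..<n}" "monge n x = monge n y"
    then show "x = y"
      by (cases "2 * x < n"; cases "2 * y < n"; simp add: monge_def; presburger)
  qed
  moreover from this have "monge n ` {..<n} = {..<n}"
    by (intro endo_inj_surj) (auto simp: monge_less)
  ultimately show "bij_betw (monge n) {..<n} {..<n}" by (simp add: bij_betw_def)
qed (simp add: monge_def)

text \<open>A block of length \<open>h\<close> in the first half is sent to the even positions
  of a block of length \<open>2 h\<close>, one in the second half to the odd positions of such a
  block. Reversing the long block reverses the image but changes its parity, which the exchange
  of neighbours restores. If \<open>n\<close> is an odd multiple of \<open>h\<close>, one block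
  lies across the middle; \<open>monge n\<close> folds it onto the incomplete last block.\<close>

lemma monge_rev_blocks:
  assumes "h dvd n" "x < n"
  shows "monge n (rev_blocks n h x) = rev_blocks n (2 * h) (rev_blocks n 2 (monge n x))"
proof -
  have h0: "0 < h" using assms by (auto intro: Nat.gr0I)
  obtain B r where x: "x = B + r" "h dvd B" "r < h" using h0 block_decomposition by blast
  have Bn: "B + h \<le> n" using dvd_block_le[OF x(2) assms(1)] assms x by simp
  have rx: "rev_blocks n h x = B + (h - 1 - r)" using rev_blocks_apply[OF x(2,3), of n] x Bn by simp
  have dB: "2 * h dvd 2 * B" using x by simp
  consider "2 * B + 2 * h \<le> n" | "n \<le> 2 * B" | "2 * B < n" "n < 2 * B + 2 * h" by linarith
  then show ?thesis
  proof cases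
    case 1
    have "rev_blocks n 2 (monge n x) = 2 * B + (2 * r + 1)"
      using 1 x assms by (simp add: monge_def rev_blocks_two)
    moreover have "rev_blocks n (2 * h) (2 * B + (2 * r + 1)) = 2 * B + (2 * h - 1 - (2 * r + 1))"
      using rev_blocks_apply[OF dB, of "2 * r + 1" n] x 1 by simp
    moreover have "2 * (B + (h - 1 - r)) < n" using 1 x(3) by simp
    then have "monge n (rev_blocks n h x) = 2 * B + 2 * (h - 1 - r)"
      unfolding rx by (simp add: monge_def)
    ultimately show ?thesis using x by simp
  next
    case 2
    have m: "monge n x = 2 * (n - 1 - x) + 1" using 2 x assms by (simp add: monge_def)
    have e: "n - 1 - x = (n - h - B) + (h - 1 - r)" using x(1,3) Bn by linarith
    have "2 * (n - 1 - x) + 1 < n" using 2 x(1) assms(2) by linarith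
    then have "rev_blocks n 2 (2 * (n - 1 - x) + 1) = 2 * (n - 1 - x)" by (simp add: rev_blocks_two)
    then have "rev_blocks n 2 (monge n x) = 2 * (n - h - B) + 2 * (h - 1 - r)"
      by (simp only: m e add_mult_distrib2)
    moreover have "2 * h dvd 2 * (n - h - B)"
      using x assms(1) Bn by (intro mult_dvd_mono) (auto intro!: dvd_diff_nat)
    moreover have "2 * (n - h - B) + 2 * h \<le> n" using 2 Bn by linarith
    moreover have "2 * (h - 1 - r) < 2 * h" using x(3) by linarith
    ultimately have "rev_blocks n 2 (monge n x) = 2 * (n - h - B) + 2 * (h - 1 - r)"
      "rev_blocks n (2 * h) (2 * (n - h - B) + 2 * (h - 1 - r)) =
        2 * (n - h - B) + (2 * h - 1 - 2 * (h - 1 - r))"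
      using rev_blocks_apply[of "2 * h" "2 * (n - h - B)" "2 * (h - 1 - r)" n] by metis+
    moreover have "monge n (rev_blocks n h x) = 2 * n - 1 - 2 * (B + (h - 1 - r))"
      using rx 2 x Bn by (simp add: monge_def)
    moreover have "2 * n - 1 - 2 * (B + (h - 1 - r)) =
        2 * (n - h - B) + (2 * h - 1 - 2 * (h - 1 - r))" 
    proof -
      obtain t where t: "h = Suc (r + t)" using x(3) less_imp_Suc_add by blast
      obtain u where u: "n = B + h + u" using Bn le_Suc_ex by blast
      show ?thesis unfolding u t by simp
    qed
    ultimately show ?thesis by metis
  next
    case 3
    have "h dvd n - 2 * B" "0 < n - 2 * B" "n - 2 * B < h * 2"
      using assms x 3 by (auto intro: dvd_diff_nat)
    then have "n - 2 * B = h" by (rule dvd_between_imp_eq)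
    then have n: "n = 2 * B + h" using 3 by linarith
    have fixed: "rev_blocks n (2 * h) (2 * B + s) = 2 * B + s" if "s < 2 * h" for s
      using rev_blocks_apply[OF dB that, of n] n h0 by simp
    obtain t where t: "h = Suc (r + t)" using x(3) less_imp_Suc_add by blast
    show ?thesis
    proof (cases "2 * x < n")
      case True
      show ?thesis
      proof (cases "Suc (2 * x) < n")
        case True
        then have "rev_blocks n 2 (2 * x) = 2 * B + Suc (2 * r)" using x by (simp add: rev_blocks_two)
        moreover have "monge n x = 2 * x" using True x by (simp add: monge_def)
        moreover have "monge n (rev_blocks n h x) = 2 * B + Suc (2 * r)"
          unfolding rx using True x n t by (simp add: monge_def)
        ultimately show ?thesis using fixed[of "Suc (2 * r)"] x(3) by simp
      next
        case False
        then have "rev_blocks n 2 (2 * x) = 2 * B + 2 * r" using \<open>2 * x < n\<close> x by (simp add: rev_blocks_two)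
        moreover have "monge n x = 2 * x" using True x by (simp add: monge_def)
        moreover have "rev_blocks n h x = x" unfolding rx using False \<open>2 * x < n\<close> n x t by simp
        ultimately show ?thesis using fixed[of "2 * r"] x by simp
      qed
    next
      case False
      have m: "monge n x = Suc (2 * (B + t))" using False x n t assms(2) by (simp add: monge_def)
      have "Suc (2 * (B + t)) < n" using False x n t by simp
      then have "rev_blocks n 2 (monge n x) = 2 * B + 2 * t"
        unfolding m by (simp add: rev_blocks_two)
      moreover have "monge n (rev_blocks n h x) = 2 * B + 2 * t"
        unfolding rx using n x False t by (simp add: monge_def)
      ultimately show ?thesis using fixed[of "2 * t"] t by simp
    qed
  qed
qed

text \<open>The block lengths that arise from \<open>1\<close> by doubling and from
  \<open>n\<close> by halving.\<close>

definition block_revs :: "nat \<Rightarrow> (nat \<Rightarrow> nat) set" where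
  "block_revs n = {rev_blocks n d | d j. d = 2 ^ j \<and> d dvd 2 * n \<or> d * 2 ^ j = n}"

lemma block_revs_pow: "2 ^ j dvd 2 * n \<Longrightarrow> rev_blocks n (2 ^ j) \<in> gen_by (block_revs n)"
  by (intro gen_by_incl) (auto simp: block_revs_def)

lemma block_revs_copow: "d * 2 ^ j = n \<Longrightarrow> rev_blocks n d \<in> gen_by (block_revs n)"
  by (intro gen_by_incl) (auto simp: block_revs_def)

lemma block_revs_two: "rev_blocks n 2 \<in> gen_by (block_revs n)"
  using block_revs_pow[of 1 n] by simp

lemma block_revs_whole: "rev_blocks n n \<in> gen_by (block_revs n)"
  using block_revs_copow[of n 0 n] by simp

lemma perm_group_block_revs: "perm_group {..<n} (gen_by (block_revs n))"
  by (rule perm_group_gen_by) (auto simp: block_revs_def rev_blocks_permutes)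

text \<open>Mirror pairs are represented by their members below \<open>n\<close>.\<close>

definition fold_pos :: "nat \<Rightarrow> nat \<Rightarrow> nat" where
  "fold_pos n x = (if x < n then x else 2 * n - 1 - x)"

lemma fold_pos_less: "x < 2 * n \<Longrightarrow> fold_pos n x < n"
  by (auto simp: fold_pos_def)

lemma fold_pos_eq_iff:
  "x < 2 * n \<Longrightarrow> y < 2 * n \<Longrightarrow> fold_pos n x = fold_pos n y \<longleftrightarrow> x = y \<or> x = 2 * n - 1 - y"
  by (auto simp: fold_pos_def)

section \<open>Doubling the deck\<close>

text \<open>The two positions of a mirror pair have opposite parity. By the last clause the
  action on the pairs therefore determines a lift up to the mirror.\<close>

definition lifts :: "nat \<Rightarrow> (nat \<Rightarrow> nat) \<Rightarrow> (nat \<Rightarrow> nat) \<Rightarrow> bool" where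
  "lifts n h p \<longleftrightarrow>
     (\<forall>x<2 * n. h x < 2 * n \<and> h (2 * n - 1 - x) = 2 * n - 1 - h x \<and> fold_pos n (h x) = p (fold_pos n x)) \<and>
     ((\<forall>x<2 * n. even (h x) = even x) \<or> (\<forall>x<2 * n. even (h x) \<noteq> even x))"

lemma lifts_comp: "lifts n h p \<Longrightarrow> lifts n k q \<Longrightarrow> lifts n (h \<circ> k) (p \<circ> q)"
  unfolding lifts_def by auto

lemma rev_blocks_mirror:
  assumes "d dvd 2 * n" "x < 2 * n"
  shows "rev_blocks (2 * n) d (2 * n - 1 - x) = 2 * n - 1 - rev_blocks (2 * n) d x"
proof -
  have "0 < d" using assms by (auto intro: Nat.gr0I)
  then obtain B r where x: "x = B + r" "d dvd B" "r < d" using block_decomposition by blast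
  have B: "B + d \<le> 2 * n" using dvd_block_le[OF x(2) assms(1)] assms x by simp
  have "d dvd 2 * n - d - B" using x assms B by (auto intro!: dvd_diff_nat)
  moreover have "2 * n - 1 - x = (2 * n - d - B) + (d - 1 - r)" using x B by simp
  ultimately show ?thesis
    using rev_blocks_apply[OF x(2,3), of "2 * n"] x B
      rev_blocks_apply[of d "2 * n - d - B" "d - 1 - r" "2 * n"] by simp
qed

lemma rev_blocks_fold:
  assumes "d dvd 2 * n" "x < n"
  shows "fold_pos n (rev_blocks (2 * n) d x) = rev_blocks n d x"
proof -
  have d0: "0 < d" using assms by (auto intro: Nat.gr0I)
  then obtain B r where x: "x = B + r" "d dvd B" "r < d" using block_decomposition by blast
  have B: "B + d \<le> 2 * n" using dvd_block_le[OF x(2) assms(1)] assms x by simp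
  show ?thesis
  proof (cases "B + d \<le> n")
    case True
    then show ?thesis using rev_blocks_apply[OF x(2,3)] x B by (simp add: fold_pos_def)
  next
    case False
    have "d dvd 2 * n - 2 * B" "0 < 2 * n - 2 * B" "2 * n - 2 * B < d * 2"
      using assms x False by (auto intro!: dvd_diff_nat)
    then have "2 * n - 2 * B = d" by (rule dvd_between_imp_eq)
    then have n: "2 * n = 2 * B + d" using d0 by linarith
    show ?thesis using rev_blocks_apply[OF x(2,3)] x B False n assms by (auto simp: fold_pos_def)
  qed
qed

lemma lifts_rev_blocks:
  assumes "d dvd 2 * n" "0 < n"
  shows "lifts n (rev_blocks (2 * n) d) (rev_blocks n d)"
  unfolding lifts_def
proof (intro conjI allI impI)
  fix x assume x: "x < 2 * n"
  show "rev_blocks (2 * n) d x < 2 * n" using x by (rule rev_blocks_less)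
  show m: "rev_blocks (2 * n) d (2 * n - 1 - x) = 2 * n - 1 - rev_blocks (2 * n) d x"
    by (rule rev_blocks_mirror[OF assms(1) x])
  show "fold_pos n (rev_blocks (2 * n) d x) = rev_blocks n d (fold_pos n x)"
  proof (cases "x < n")
    case True
    then show ?thesis using rev_blocks_fold[OF assms(1) True] by (simp add: fold_pos_def)
  next
    case False
    then have y: "2 * n - 1 - x < n" using x by simp
    have "fold_pos n (rev_blocks (2 * n) d (2 * n - 1 - x)) = fold_pos n (rev_blocks (2 * n) d x)"
      unfolding m using rev_blocks_less[OF x, of d]
      by (auto simp: fold_pos_def)
    then show ?thesis using rev_blocks_fold[OF assms(1) y] False by (simp add: fold_pos_def)
  qed
next
  have d0: "0 < d" using assms by (auto intro: Nat.gr0I)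
  have "even (rev_blocks (2 * n) d x) = (even x \<noteq> even d)" if "x < 2 * n" for x
  proof -
    obtain B r where x: "x = B + r" "d dvd B" "r < d" using d0 block_decomposition by blast
    have B: "B + d \<le> 2 * n" using dvd_block_le[OF x(2) assms(1)] that x by simp
    have e: "even d \<Longrightarrow> even B" using x dvd_trans by blast
    have "even (d - 1 - r) = ((even r) \<noteq> (even d))" using x(3) by auto
    then show ?thesis using rev_blocks_apply[OF x(2,3), of "2 * n"] B x e by auto
  qed
  then show "(\<forall>x<2 * n. even (rev_blocks (2 * n) d x) = even x) \<or>
      (\<forall>x<2 * n. even (rev_blocks (2 * n) d x) \<noteq> even x)" by blast
qed

text \<open>A block length that arises for \<open>n\<close> also arises for \<open>2 n\<close>,
  and the reversals of equal length correspond.\<close>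

lemma lifts_exist:
  assumes "p \<in> gen_by (block_revs n)" "0 < n"
  shows "\<exists>h\<in>gen_by (block_revs (2 * n)). lifts n h p"
  using assms(1)
proof (induction rule: gen_by.induct)
  case gen_id
  have "lifts n id id" by (auto simp: lifts_def)
  then show ?case using gen_by.gen_id by blast
next
  case (gen_step f g)
  then obtain h where h: "h \<in> gen_by (block_revs (2 * n))" "lifts n h g" by blast
  obtain d j where d: "f = rev_blocks n d" "d = 2 ^ j \<and> d dvd 2 * n \<or> d * 2 ^ j = n"
    using gen_step(1) by (auto simp: block_revs_def)
  have dv: "d dvd 2 * n" using d(2) by auto
  have "rev_blocks (2 * n) d \<in> gen_by (block_revs (2 * n))"
    using d(2)
  proof
    assume "d = 2 ^ j \<and> d dvd 2 * n"
    then have "2 ^ j dvd 2 * (2 * n)" "d = 2 ^ j" using dvd_mult by blast+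
    then show ?thesis using block_revs_pow by blast
  next
    assume "d * 2 ^ j = n"
    then show ?thesis using block_revs_copow[of d "Suc j" "2 * n"] by simp
  qed
  then show ?case
    using lifts_comp[OF lifts_rev_blocks[OF dv assms(2)] h(2)] gen_by_comp h(1) d(1) by blast
qed

text \<open>The square of a lift of the inverse three-cycle: squaring removes both the exchange
  of parities and the exchange of positions in pairs that are fixed.\<close>

lemma double_cycle_exists:
  assumes alt: "contains_alternating {..<n} (gen_by (block_revs n))"
    and abc: "a < n" "b < n" "c < n" "distinct [a, b, c]"
  obtains h where "h \<in> gen_by (block_revs (2 * n))"
    "\<And>x. x < 2 * n \<Longrightarrow> fold_pos n x \<notin> {a, b, c} \<Longrightarrow> h x = x"
    "\<And>x. x < 2 * n \<Longrightarrow> fold_pos n (h x) = three_cycle a b c (fold_pos n x)"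
    "\<And>x. x < 2 * n \<Longrightarrow> even (h x) = even x"
    "\<And>x. x < 2 * n \<Longrightarrow> h x < 2 * n"
proof -
  let ?p = "three_cycle a c b"
  have d: "distinct [a, c, b]" using abc by auto
  have "?p \<in> gen_by (block_revs n)" using alt abc d by (auto simp: contains_alternating_def)
  then obtain h where h: "h \<in> gen_by (block_revs (2 * n))" "lifts n h ?p"
    using lifts_exist abc by (metis gr_zeroI not_less0)
  have L: "h x < 2 * n" "h (2 * n - 1 - x) = 2 * n - 1 - h x" "fold_pos n (h x) = ?p (fold_pos n x)"
    if "x < 2 * n" for x using h(2) that by (auto simp: lifts_def)
  show ?thesis
  proof
    show "h \<circ> h \<in> gen_by (block_revs (2 * n))" using h gen_by_comp by blast
  next
    fix x assume x: "x < 2 * n" "fold_pos n x \<notin> {a, b, c}"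
    then have "fold_pos n (h x) = fold_pos n x" using L d by (simp add: three_cycle_apply)
    then have "h x = x \<or> h x = 2 * n - 1 - x" using fold_pos_eq_iff L x by metis
    then show "(h \<circ> h) x = x"
    proof
      assume e: "h x = 2 * n - 1 - x"
      have "h (h x) = 2 * n - 1 - h x" using L(2)[OF x(1)] e by metis
      then show ?thesis using e x by simp
    qed simp
  next
    fix x assume x: "x < 2 * n"
    have "fold_pos n ((h \<circ> h) x) = ?p (?p (fold_pos n x))" using L x by simp
    also have "\<dots> = three_cycle a b c (fold_pos n x)"
      using three_cycle_square[OF d] by (metis comp_apply)
    finally show "fold_pos n ((h \<circ> h) x) = three_cycle a b c (fold_pos n x)" .
    show "even ((h \<circ> h) x) = even x" using h(2) x by (auto simp: lifts_def)
    show "(h \<circ> h) x < 2 * n" using L x by simp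
  qed
qed

lemma obtain_outside:
  assumes "finite A" "card A < (n::nat)"
  obtains x where "x < n" "x \<notin> A"
proof -
  have "\<not> {..<n} \<subseteq> A" using card_mono[OF assms(1), of "{..<n}"] assms(2) by auto
  then show ?thesis using that by blast
qed

text \<open>A lift of a three-cycle to \<open>2 n\<close> positions acts on the even and on the
  odd positions by a three-cycle each. To separate the two, let \<open>e\<close> be the power of
  two for which the last block of length \<open>e\<close> is only half present among \<open>2
  n\<close> positions. The reversal \<open>s\<close> of such blocks moves \<open>0\<close> to
  \<open>e - 1\<close> but fixes the last position, so it separates the pair of
  \<open>0\<close>. A lift \<open>h\<close> that moves \<open>\<alpha> = e - 1\<close> and the
  conjugate \<open>g\<close> by \<open>s\<close> of a lift that moves \<open>0\<close> can be
  chosen to have only \<open>\<alpha>\<close> as common moved point; their commutator is a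
  single three-cycle.\<close>

lemma contains_alternating_double:
  assumes alt: "contains_alternating {..<n} (gen_by (block_revs n))"
    and n: "10 \<le> n" "n = 2 ^ a * m" "1 \<le> a" "odd m" "3 \<le> m"
  shows "contains_alternating {..<2 * n} (gen_by (block_revs (2 * n)))"
proof -
  let ?M = "gen_by (block_revs (2 * n))"
  interpret perm_group "{..<2 * n}" ?M by (rule perm_group_block_revs)
  define e where "e = (2::nat) ^ (a + 2)"
  define s where "s = rev_blocks (2 * n) e"
  define \<alpha> where "\<alpha> = e - 1"
  have e4: "4 dvd e" "e \<ge> 8"
    using n(3) power_increasing[of 3 "a + 2" "2::nat"] by (auto simp: e_def power_add)
  have e2n: "e < 2 * n"
  proof -
    have "e = 2 * (2 ^ a * 2)" by (simp add: e_def power_add)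
    also have "\<dots> < 2 * (2 ^ a * m)" using n(5) by simp
    finally show ?thesis using n(2) by simp
  qed
  have sM: "s \<in> ?M" unfolding s_def e_def
    using n(2) by (intro block_revs_pow) (simp add: power_add)
  have ss: "s (s x) = x" for x by (simp add: s_def rev_blocks_involution)
  have sless: "x < 2 * n \<Longrightarrow> s x < 2 * n" for x by (simp add: s_def rev_blocks_less)
  have s0: "s 0 = \<alpha>" using rev_blocks_apply[of e 0 0 "2 * n"] e4 e2n by (simp add: s_def \<alpha>_def)
  \<comment> \<open>As \<open>2 n\<close> is an odd multiple of \<open>e div 2\<close>, the
    last block is incomplete and stays in place.\<close>
  have slast: "s (2 * n - 1) = 2 * n - 1"
  proof -
    obtain l where m: "m = 2 * l + 1" using n(4) oddE by blast
    have 1: "2 * n = e * l + e div 2" unfolding n(2) m e_def by (simp add: power_add algebra_simps)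
    have "rev_blocks (2 * n) e (e * l + (e div 2 - 1)) = e * l + (e div 2 - 1)"
      using rev_blocks_apply[of e "e * l" "e div 2 - 1" "2 * n"] 1 e4 by auto
    then show ?thesis using 1 e4 by (simp add: s_def)
  qed
  have \<alpha>: "odd \<alpha>" "\<alpha> < 2 * n" "\<alpha> \<noteq> 2 * n - 1" "\<alpha> \<noteq> 0"
    using e4 e2n by (auto simp: \<alpha>_def dest: dvd_trans[of 2 4 e, simplified])
  have parity: "x = y" if "fold_pos n x = fold_pos n y" "even x = even y" "x < 2 * n" "y < 2 * n" for x y
    using that fold_pos_eq_iff[of x n y] by auto
  have fold0: "fold_pos n x = 0 \<longleftrightarrow> x = 0 \<or> x = 2 * n - 1" if "x < 2 * n" for x
    using that n(1) by (auto simp: fold_pos_def)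
  have main: "linked \<alpha> b" if b: "odd b" "b < 2 * n" "b \<noteq> 2 * n - 1" for b
  proof (cases "b = \<alpha>")
    case True then show ?thesis by (simp add: linked_refl)
  next
    case False
    let ?A = "fold_pos n \<alpha>" and ?B = "fold_pos n b"
    have AB: "?A \<noteq> ?B" "?A \<noteq> 0" "?B \<noteq> 0" "?A < n" "?B < n"
      using parity[of \<alpha> b] False \<alpha> b fold0 by (auto simp: fold_pos_less odd_pos)
    have "card {?A, ?B, 0} < n" using n by (auto simp: card_insert_if)
    then obtain c where c: "c < n" "c \<notin> {?A, ?B, 0}" using obtain_outside[of "{?A, ?B, 0}" n] by auto
    \<comment> \<open>With \<open>u\<close> and \<open>v\<close> outside this set,
      \<open>s\<close> takes no position moved by \<open>h\<close> into the pairs of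
      \<open>u\<close> and \<open>v\<close>, apart possibly from
      \<open>\<alpha>\<close>.\<close>
    let ?S = "insert 0 ((\<lambda>x. fold_pos n (s x)) ` {2 * n - 1 - \<alpha>, b, 2 * n - 1 - b, c, 2 * n - 1 - c})"
    have cS: "card ?S \<le> 6"
    proof -
      have "card {2 * n - 1 - \<alpha>, b, 2 * n - 1 - b, c, 2 * n - 1 - c} \<le> 5"
        by (simp add: card_insert_if)
      then have "card ((\<lambda>x. fold_pos n (s x)) ` {2 * n - 1 - \<alpha>, b, 2 * n - 1 - b, c, 2 * n - 1 - c}) \<le> 5"
        using card_image_le[of "{2 * n - 1 - \<alpha>, b, 2 * n - 1 - b, c, 2 * n - 1 - c}"] by (meson finite.intros le_trans)
      then show ?thesis by (simp add: card_insert_if)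
    qed
    have finS: "finite ?S" by simp
    have "card ?S < n" using cS n(1) by linarith
    then obtain u where u: "u < n" "u \<notin> ?S" using obtain_outside[OF finS] by metis
    have "card (insert u ?S) \<le> Suc (card ?S)" by (rule card_insert_le_m1) simp_all
    then have "card (insert u ?S) < n" using cS n(1) by linarith
    moreover have "finite (insert u ?S)" by simp
    ultimately obtain v where v: "v < n" "v \<notin> insert u ?S" using obtain_outside by metis
    have "distinct [?A, ?B, c]" using AB c by auto
    from double_cycle_exists[OF alt AB(4,5) c(1) this] obtain h where h: "h \<in> ?M"
      "\<And>x. x < 2 * n \<Longrightarrow> fold_pos n x \<notin> {?A, ?B, c} \<Longrightarrow> h x = x"
      "\<And>x. x < 2 * n \<Longrightarrow> fold_pos n (h x) = three_cycle ?A ?B c (fold_pos n x)"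
      "\<And>x. x < 2 * n \<Longrightarrow> even (h x) = even x" "\<And>x. x < 2 * n \<Longrightarrow> h x < 2 * n" by metis
    have duv: "distinct [0, u, v]" using u v by auto
    have "0 < n" using n by simp
    from double_cycle_exists[OF alt this u(1) v(1) duv] obtain k where k: "k \<in> ?M"
      "\<And>x. x < 2 * n \<Longrightarrow> fold_pos n x \<notin> {0, u, v} \<Longrightarrow> k x = x"
      "\<And>x. x < 2 * n \<Longrightarrow> fold_pos n (k x) = three_cycle 0 u v (fold_pos n x)" by metis
    define g where "g = s \<circ> k \<circ> s"
    have gM: "g \<in> ?M" using sM k comp_mem by (simp add: g_def)
    have h\<alpha>: "h \<alpha> = b"
    proof (rule parity)
      show "fold_pos n (h \<alpha>) = fold_pos n b"
        using h(3)[OF \<alpha>(2)] AB c by (simp add: three_cycle_apply)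
    qed (use h \<alpha> b in auto)
    have s\<alpha>: "s \<alpha> = 0" using ss[of 0] s0 by simp
    have k0: "k 0 \<noteq> 0"
    proof
      assume "k 0 = 0"
      moreover have "fold_pos n (k 0) = u" using k(3)[of 0] n duv by (simp add: fold_pos_def three_cycle_apply)
      ultimately show False using u n by (simp add: fold_pos_def)
    qed
    have "g \<alpha> \<noteq> \<alpha>" using k0 s\<alpha> ss by (metis comp_apply g_def)
    moreover have "h \<alpha> \<noteq> \<alpha>" using h\<alpha> False by simp
    moreover have "h x = x \<or> g x = x" if x: "x \<noteq> \<alpha>" for x
    proof (rule ccontr)
      assume ne: "\<not> (h x = x \<or> g x = x)"
      have x2: "x < 2 * n" using ne permutes_not_in[OF permutes[OF h(1)], of x] by auto
      have f1: "fold_pos n x \<in> {?A, ?B, c}" using h(2)[OF x2] ne by blast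
      have "k (s x) \<noteq> s x" using ne ss by (metis comp_apply g_def)
      then have f2: "fold_pos n (s x) \<in> {0, u, v}" using k(2)[OF sless[OF x2]] by blast
      have "fold_pos n c = c" using c by (simp add: fold_pos_def)
      then have "fold_pos n x = fold_pos n \<alpha> \<or> fold_pos n x = fold_pos n b \<or> fold_pos n x = fold_pos n c"
        using f1 by auto
      then have xin: "x \<in> {2 * n - 1 - \<alpha>, b, 2 * n - 1 - b, c, 2 * n - 1 - c}"
        using fold_pos_eq_iff[OF x2] \<alpha> b c x by auto
      then have "fold_pos n (s x) \<noteq> u" "fold_pos n (s x) \<noteq> v" using u v by blast+
      then have "fold_pos n (s x) = 0" using f2 by blast
      then have "s x = 0 \<or> s x = 2 * n - 1" using fold0 sless[OF x2] by blast
      then have "x = \<alpha> \<or> x = 2 * n - 1" using ss s0 slast by metis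
      then have "fold_pos n x = 0" using x fold0[OF x2] by metis
      then show False using f1 AB c by auto
    qed
    ultimately have "distinct [\<alpha>, h \<alpha>, g \<alpha>]" "three_cycle \<alpha> (h \<alpha>) (g \<alpha>) \<in> ?M"
      using commutator_three_cycle[of h g \<alpha>] bij_mem[OF h(1)] bij_mem[OF gM]
        comp_mem[OF comp_mem[OF comp_mem[OF h(1) gM] inv_mem[OF h(1)]] inv_mem[OF gM]] by auto
    then show ?thesis using h\<alpha> linkedI by metis
  qed
  let ?\<rho> = "rev_blocks (2 * n) (2 * n)"
  have \<rho>: "?\<rho> x = 2 * n - 1 - x" if "x < 2 * n" for x using that by (rule rev_blocks_whole)
  have "linked 1 3" using linked_trans[OF linked_sym[OF main[of 1]] main[of 3]] n by simp
  then have "linked 0 2"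
    using linked_apply[OF block_revs_two[of "2 * n"], of 1 3] n by (simp add: rev_blocks_two)
  then have "linked (2 * n - 1) (2 * n - 3)"
    using linked_apply[OF block_revs_whole[of "2 * n"], of 0 2] \<rho>[of 0] \<rho>[of 2] n by (simp add: numeral_3_eq_3)
  moreover have "linked \<alpha> (2 * n - 3)" using main[of "2 * n - 3"] n by auto
  ultimately have last: "linked \<alpha> (2 * n - 1)" using linked_sym linked_trans by blast
  have odds: "linked \<alpha> x" if "odd x" "x < 2 * n" for x using main last that by blast
  have "linked 0 (2 * n - 1)" using linked_apply[OF sM last] slast ss[of 0] s0 by simp
  then have zero: "linked \<alpha> 0" using last linked_sym linked_trans by blast
  have "linked \<alpha> x" if "x < 2 * n" for x
  proof (cases "odd x")
    case False
    have "linked \<alpha> (2 * n - 1 - x)" using False that by (intro odds) auto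
    then have "linked (2 * n - 1) (2 * n - 1 - x)" using last linked_sym linked_trans by blast
    then have "linked 0 x"
      using linked_apply[OF block_revs_whole[of "2 * n"]] \<rho>[of "2 * n - 1"] \<rho>[of "2 * n - 1 - x"] that n
      by fastforce
    then show ?thesis using zero linked_trans by blast
  qed (use that odds in auto)
  then show ?thesis by (intro contains_alternatingI[of \<alpha>]) auto
qed

section \<open>The alternating group on mirror pairs\<close>

lemma permutes_eqI:
  fixes p q :: "nat \<Rightarrow> nat"
  assumes "p permutes {..<n}" "q permutes {..<n}" "\<And>x. x < n \<Longrightarrow> p x = q x"
  shows "p = q"
proof (rule ext)
  fix x show "p x = q x" using assms(3) permutes_not_in[OF assms(1)] permutes_not_in[OF assms(2)]
    by (cases "x < n") auto
qed

definition folded_group :: "nat \<Rightarrow> (nat \<Rightarrow> nat) set" where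
  "folded_group n = gen_by {monge n, rev_blocks n 2}"

lemma perm_group_folded: "perm_group {..<n} (folded_group n)"
  unfolding folded_group_def
  by (rule perm_group_gen_by) (auto simp: rev_blocks_permutes monge_permutes)

lemma monge_in_folded: "monge n \<in> folded_group n"
  unfolding folded_group_def by (rule gen_by_incl) simp

lemma rev_two_in_folded: "rev_blocks n 2 \<in> folded_group n"
  unfolding folded_group_def by (rule gen_by_incl) simp

lemma monge_conj_rev_blocks:
  assumes "h dvd n"
  shows "monge n \<circ> rev_blocks n h = rev_blocks n (2 * h) \<circ> rev_blocks n 2 \<circ> monge n"
  by (rule permutes_eqI[of _ n])
    (use monge_rev_blocks[OF assms] in
      \<open>auto intro!: permutes_compose[OF rev_blocks_permutes] permutes_compose[OF monge_permutes]
        monge_permutes rev_blocks_permutes\<close>)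

lemma rev_blocks_halve_double:
  assumes "h dvd n"
  shows "rev_blocks n h \<in> folded_group n \<longleftrightarrow> rev_blocks n (2 * h) \<in> folded_group n"
proof -
  interpret perm_group "{..<n}" "folded_group n" by (rule perm_group_folded)
  note c = monge_conj_rev_blocks[OF assms]
  have b: "bij (monge n)" "bij (rev_blocks n 2)" using monge_permutes rev_blocks_permutes permutes_bij by blast+
  have "inv' (monge n) \<circ> (monge n \<circ> rev_blocks n h) = rev_blocks n h"
    using b by (simp add: o_assoc bij_is_inj)
  then have 1: "rev_blocks n h = inv' (monge n) \<circ> rev_blocks n (2 * h) \<circ> rev_blocks n 2 \<circ> monge n"
    unfolding c by (simp add: o_assoc)
  have "rev_blocks n (2 * h) \<circ> rev_blocks n 2 \<circ> monge n \<circ> inv' (monge n) \<circ> rev_blocks n 2 = rev_blocks n (2 * h)"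
    using b rev_blocks_involution
    by (simp add: fun_eq_iff bij_is_surj surj_f_inv_f)
  then have 2: "rev_blocks n (2 * h) = monge n \<circ> rev_blocks n h \<circ> inv' (monge n) \<circ> rev_blocks n 2"
    unfolding c by simp
  show ?thesis
  proof
    assume "rev_blocks n h \<in> folded_group n"
    then show "rev_blocks n (2 * h) \<in> folded_group n"
      by (subst 2) (intro comp_mem inv_mem monge_in_folded rev_two_in_folded)
  next
    assume "rev_blocks n (2 * h) \<in> folded_group n"
    then show "rev_blocks n h \<in> folded_group n"
      by (subst 1) (intro comp_mem inv_mem monge_in_folded rev_two_in_folded)
  qed
qed

lemma rev_blocks_big: "n < d \<Longrightarrow> rev_blocks n d = id"
  by (rule ext) (auto simp: rev_blocks_def)

text \<open>Blocks of length \<open>2 n\<close> do not fit, so their reversal is trivial;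
  halving this length gives the reversal of the whole range.\<close>

lemma rev_whole_in_folded: "rev_blocks n n \<in> folded_group n"
proof (cases "n = 0")
  case True
  then have "rev_blocks n n = id" by (auto simp: rev_blocks_def)
  then show ?thesis unfolding folded_group_def using gen_id by metis
next
  case False
  then have "rev_blocks n (2 * n) = id" by (intro rev_blocks_big) simp
  then show ?thesis using rev_blocks_halve_double[of n n] gen_id unfolding folded_group_def by simp
qed

lemma block_revs_in_folded:
  assumes "0 < n"
  shows "gen_by (block_revs n) \<subseteq> folded_group n"
proof -
  interpret perm_group "{..<n}" "folded_group n" by (rule perm_group_folded)
  have pow: "rev_blocks n (2 ^ j) \<in> folded_group n" if "2 ^ j dvd 2 * n" for j
    using that
  proof (induction j)
    case 0
    have "rev_blocks n (2 ^ 0) = id" by (rule ext) (simp add: rev_blocks_def)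
    then show ?case using id_mem by metis
  next
    case (Suc j)
    then have "2 ^ j dvd n" by simp
    then show ?case using Suc rev_blocks_halve_double[of "2 ^ j" n] by simp
  qed
  have copow: "rev_blocks n d \<in> folded_group n" if "d * 2 ^ j = n" for d j
    using that
  proof (induction j arbitrary: d)
    case 0 then show ?case using rev_whole_in_folded by simp
  next
    case (Suc j)
    then have "rev_blocks n (2 * d) \<in> folded_group n" by simp
    moreover have "d dvd n" using Suc by auto
    ultimately show ?case using rev_blocks_halve_double by blast
  qed
  show ?thesis
  proof (rule gen_by_subset, rule subsetI)
    fix f assume "f \<in> block_revs n"
    then show "f \<in> folded_group n" unfolding block_revs_def using pow copow by blast
  qed
qed

lemma contains_alternating_mono: "contains_alternating A M \<Longrightarrow> M \<subseteq> M' \<Longrightarrow> contains_alternating A M'"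
  by (auto simp: contains_alternating_def)

text \<open>The element \<open>t\<close>, a conjugate of the full reversal, reverses the
  positions up to \<open>p\<close> and those above \<open>p\<close> separately. Composed with
  the full reversal it is a rotation by \<open>p\<close>, and as \<open>2 p = n - 1\<close> its
  square \<open>w\<close> is the rotation by one position. The commutator of the exchange of
  neighbours with \<open>w \<circ> w\<close> is a three-cycle on the last three positions, and
  rotating it links all positions.\<close>

lemma contains_alternating_odd:
  assumes n: "n = 2 * p + 1" "1 \<le> p"
  shows "contains_alternating {..<n} (folded_group n)"
proof -
  interpret perm_group "{..<n}" "folded_group n" by (rule perm_group_folded)
  define t where "t = (\<lambda>x. if x < n then if x \<le> p then p - x else 3 * p + 1 - x else x)"
  define w where "w = (\<lambda>x. if x < n then if x = 0 then n - 1 else x - 1 else x)"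
  let ?s = "rev_blocks n 2"
  have mt: "monge n (t x) = rev_blocks n n (monge n x)" if "x < n" for x
  proof (cases "x \<le> p")
    case True
    then obtain d where d: "p = x + d" using le_Suc_ex by blast
    show ?thesis using True that unfolding n(1) d by (simp add: t_def monge_def rev_blocks_whole n(1) d)
  next
    case False
    have "rev_blocks n n (monge n x) = n - 1 - (2 * n - 1 - 2 * x)"
      using False that n by (simp add: monge_def rev_blocks_whole)
    also have "\<dots> = 2 * n - 1 - 2 * (3 * p + 1 - x)"
      using False that unfolding n(1) by simp
    also have "\<dots> = monge n (t x)"
    proof -
      have "n \<le> 2 * (3 * p + 1 - x)" "3 * p + 1 - x < n" using False that n by linarith+
      then show ?thesis using False that by (simp add: t_def monge_def)
    qed
    finally show ?thesis by simp
  qed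
  have "monge n \<circ> t = rev_blocks n n \<circ> monge n"
  proof (rule ext)
    fix x show "(monge n \<circ> t) x = (rev_blocks n n \<circ> monge n) x"
      using mt by (cases "x < n") (simp_all add: t_def monge_def rev_blocks_def)
  qed
  then have "inv' (monge n) \<circ> (monge n \<circ> t) = inv' (monge n) \<circ> rev_blocks n n \<circ> monge n"
    by (simp add: o_assoc)
  then have "t = inv' (monge n) \<circ> rev_blocks n n \<circ> monge n"
    using bij_mem[OF monge_in_folded] by (simp add: o_assoc bij_is_inj)
  then have tM: "t \<in> folded_group n"
    using comp_mem inv_mem monge_in_folded rev_whole_in_folded by metis
  have "w = (rev_blocks n n \<circ> t) \<circ> (rev_blocks n n \<circ> t)"
  proof (rule ext)
    fix x
    have u: "rev_blocks n n (t y) = (if y \<le> p then p + y else y - p - 1)" if "y < n" for y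
      using that n by (auto simp: t_def rev_blocks_whole)
    show "w x = ((rev_blocks n n \<circ> t) \<circ> (rev_blocks n n \<circ> t)) x"
    proof (cases "x < n")
      case True
      consider "x = 0" | "0 < x" "x \<le> p" | "p < x" by linarith
      then show ?thesis by cases (use True n u[OF True] u[of "p + x"] u[of "x - p - 1"] in \<open>auto simp: w_def\<close>)
    qed (simp add: w_def t_def rev_blocks_def)
  qed
  then have wM: "w \<in> folded_group n" using comp_mem tM rev_whole_in_folded by metis
  let ?u = "n - 2" and ?v = "n - 1" and ?y = "n - 3"
  have d: "distinct [?u, ?v, ?y]" using n by auto
  define \<tau> where "\<tau> = three_cycle ?u ?v ?y"
  note \<tau> = three_cycle_apply[OF d, folded \<tau>_def]
  have main: "?s (w (w (?s x))) = \<tau> (w (w x))" if x: "x < n" for x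
  proof -
    consider "x = 0" | "x = 1" | "x = n - 1" "1 < x" | k where "x = 2 * k" "0 < k" "k < p"
      | k where "x = 2 * k + 1" "0 < k" "k < p"
    proof (cases "even x")
      case True
      then obtain k where "x = 2 * k" by blast
      then show ?thesis using x n that(1,3,4) by (cases "k = 0"; cases "k = p") auto
    next
      case False
      then obtain k where "x = 2 * k + 1" using oddE by blast
      then show ?thesis using x n that(2,5) by (cases "k = 0") auto
    qed
    then show ?thesis
      by cases (use n in \<open>auto simp: w_def rev_blocks_two \<tau>\<close>)
  qed
  have tc: "three_cycle ?u ?v ?y \<in> folded_group n"
  proof -
    have "?s \<circ> w \<circ> w \<circ> ?s = three_cycle ?u ?v ?y \<circ> w \<circ> w"
    proof (rule permutes_eqI)
      show "(?s \<circ> w \<circ> w \<circ> ?s) permutes {..<n}"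
        using permutes comp_mem wM rev_two_in_folded by metis
      have "three_cycle ?u ?v ?y permutes {..<n}" using n by (intro three_cycle_permutes) auto
      then show "three_cycle ?u ?v ?y \<circ> w \<circ> w permutes {..<n}"
        using permutes_compose permutes[OF wM] by blast
    qed (use main in \<open>auto simp: \<tau>_def\<close>)
    then have "three_cycle ?u ?v ?y \<circ> (w \<circ> (w \<circ> inv' w) \<circ> inv' w) = ?s \<circ> w \<circ> w \<circ> ?s \<circ> inv' w \<circ> inv' w"
      by (simp add: o_assoc)
    then have "three_cycle ?u ?v ?y = ?s \<circ> w \<circ> w \<circ> ?s \<circ> inv' w \<circ> inv' w"
      using bij_mem[OF wM] by (simp add: bij_is_surj surj_iff[THEN iffD1])
    then show ?thesis using comp_mem inv_mem wM rev_two_in_folded by metis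
  qed
  have top: "linked ?v ?u" using linkedI[OF d tc] linked_sym by blast
  have step: "linked ?v (n - 1 - k)" if "k < n" for k
    using that
  proof (induction k)
    case 0 then show ?case using linked_refl by simp
  next
    case (Suc k)
    then have "linked (w ?v) (w (n - 1 - k))" using linked_apply[OF wM] by simp
    moreover have "w ?v = ?u" using n by (simp add: w_def)
    moreover have "w (n - 1 - k) = n - 1 - Suc k" using Suc n by (simp add: w_def)
    ultimately have "linked ?u (n - 1 - Suc k)" by simp
    then show ?case using top linked_trans by blast
  qed
  show ?thesis
  proof (rule contains_alternatingI)
    fix x assume "x \<in> {..<n}"
    then show "linked ?v x" using step[of "n - 1 - x"] by simp
  qed
qed

text \<open>The element \<open>a\<close> exchanges the two halves, and \<open>z\<close>, the
  square of \<open>a\<close> times the exchange of neighbours, moves even positions up and odd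
  positions down by two, cyclically. The element \<open>s\<close> exchanges \<open>x\<close> and
  \<open>x + 2\<close> inside the blocks of length four and commutes with \<open>z \<circ>
  z\<close> except near the ends, where the commutator \<open>\<beta>\<close> is a product of
  two three-cycles. The conjugate of \<open>\<beta>\<close> by \<open>y\<close> has one moved
  point in common with \<open>\<beta>\<close>, so that a further commutator is a three-cycle.\<close>

lemma contains_alternating_twice_odd:
  assumes n: "n = 4 * l + 2" "3 \<le> l"
  shows "contains_alternating {..<n} (gen_by (block_revs n))"
proof -
  let ?M = "gen_by (block_revs n)"
  interpret perm_group "{..<n}" ?M by (rule perm_group_block_revs)
  define a where "a = rev_blocks n (2 * l + 1) \<circ> rev_blocks n n"
  define z where "z = (\<lambda>x. if x < n then if even x then if x + 2 < n then x + 2 else 0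
     else if 2 \<le> x then x - 2 else n - 1 else x)"
  define s where "s = rev_blocks n 2 \<circ> rev_blocks n 4"
  have aM: "a \<in> ?M" unfolding a_def
    using n by (intro comp_mem block_revs_whole block_revs_copow[of _ 1]) simp
  have a: "a x = (if x < 2 * l + 1 then x + (2 * l + 1) else x - (2 * l + 1))" if "x < n" for x
  proof (cases "x < 2 * l + 1")
    case True
    have "rev_blocks n n x = (2 * l + 1) + (2 * l - x)" using True n that by (simp add: rev_blocks_whole)
    then show ?thesis
      using rev_blocks_apply[of "2 * l + 1" "2 * l + 1" "2 * l - x" n] True n by (simp add: a_def)
  next
    case False
    have "rev_blocks n n x = 0 + (4 * l + 1 - x)" using False n that by (simp add: rev_blocks_whole)
    then show ?thesis
      using rev_blocks_apply[of "2 * l + 1" "0" "4 * l + 1 - x" n] False n that by (simp add: a_def)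
  qed
  let ?r = "rev_blocks n 2"
  have "z = (a \<circ> ?r) \<circ> (a \<circ> ?r)"
  proof (rule permutes_eqI)
    have "inj_on z {..<n}" unfolding z_def n(1) by (rule inj_onI) (auto split: if_splits; presburger)
    moreover have "z ` {..<n} \<subseteq> {..<n}" using n by (auto simp: z_def)
    ultimately have "bij_betw z {..<n} {..<n}" by (simp add: bij_betw_def endo_inj_surj)
    then show "z permutes {..<n}" by (rule bij_imp_permutes) (simp add: z_def)
    show "(a \<circ> ?r) \<circ> (a \<circ> ?r) permutes {..<n}" using permutes comp_mem aM block_revs_two by metis
  next
    fix x assume x: "x < n"
    show "z x = ((a \<circ> ?r) \<circ> (a \<circ> ?r)) x"
    proof (cases "even x")
      case True
      then obtain k where k: "x = 2 * k" by blast
      have "Suc x < n" using x k n by presburger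
      then have r: "?r x = 2 * k + 1" using k x by (simp add: rev_blocks_two)
      consider "k < l" | "k = l" | "l < k" "k < 2 * l" | "k = 2 * l" using x k n by linarith
      then show ?thesis
      proof cases
        case 1
        have "?r (2 * (k + l + 1)) = 2 * (k + l + 1) + 1" using 1 n by (simp add: rev_blocks_two)
        then show ?thesis using 1 r k n a[of "2 * k + 1"] a[of "2 * (k + l + 1) + 1"] by (simp add: z_def)
      next
        case 2
        have "?r 0 = 1" using n by (simp add: rev_blocks_two)
        then show ?thesis using 2 r k n a[of "2 * k + 1"] a[of 1] by (simp add: z_def)
      next
        case 3
        have "?r (2 * (k - l)) = 2 * (k - l) + 1" using 3 n by (simp add: rev_blocks_two)
        moreover have "a (2 * k + 1) = 2 * (k - l)" using 3 n a[of "2 * k + 1"] by simp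
        moreover have "a (2 * (k - l) + 1) = 2 * k + 2"
        proof -
          obtain d where "k = l + d" using 3(1) less_imp_le le_Suc_ex by metis
          then show ?thesis using 3 n a[of "2 * (k - l) + 1"] by simp
        qed
        ultimately show ?thesis using 3 r k n by (simp add: z_def)
      next
        case 4
        have "?r (2 * l) = 2 * l + 1" using n by (simp add: rev_blocks_two)
        then show ?thesis using 4 r k n a[of "2 * k + 1"] a[of "2 * l + 1"] by (simp add: z_def)
      qed
    next
      case False
      then obtain k where k: "x = 2 * k + 1" using oddE by blast
      have r: "?r x = 2 * k" using x k n by (simp add: rev_blocks_two)
      consider "k = 0" | "0 < k" "k \<le> l" | "l < k" "k \<le> 2 * l" using x k n by linarith
      then show ?thesis
      proof cases
        case 1
        have "?r (2 * l + 1) = 2 * l" using n by (simp add: rev_blocks_two)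
        then show ?thesis using 1 r k n a[of 0] a[of "2 * l"] by (simp add: z_def)
      next
        case 2
        have "?r (2 * (k + l) + 1) = 2 * (k + l)" using 2 n by (simp add: rev_blocks_two)
        then show ?thesis using 2 r k n a[of "2 * k"] a[of "2 * (k + l)"] by (simp add: z_def)
      next
        case 3
        have "?r (2 * (k - l - 1) + 1) = 2 * (k - l - 1)" using 3 n by (simp add: rev_blocks_two)
        moreover have "a (2 * k) = 2 * (k - l - 1) + 1" using 3 n a[of "2 * k"] by simp
        moreover have "a (2 * (k - l - 1)) = 2 * k - 1"
        proof -
          obtain d where "k = Suc (l + d)" using 3(1) less_imp_Suc_add by blast
          then show ?thesis using 3 n a[of "2 * (k - l - 1)"] by simp
        qed
        ultimately show ?thesis using 3 r k n by (simp add: z_def)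
      qed
    qed
  qed
  then have zM: "z \<in> ?M" using comp_mem aM block_revs_two by metis
  have "2 * n = 2 ^ 2 * (2 * l + 1)" using n by simp
  then have "2 ^ 2 dvd 2 * n" by (metis dvd_triv_left)
  from block_revs_pow[OF this] have sM: "s \<in> ?M" unfolding s_def
    by (intro comp_mem block_revs_two) simp
  have s4: "s (4 * i) = 4 * i + 2" "s (4 * i + 1) = 4 * i + 3" "s (4 * i + 2) = 4 * i"
    "s (4 * i + 3) = 4 * i + 1" if "i < l" for i
    using that n rev_blocks_apply[of 4 "4 * i" 0 n] rev_blocks_apply[of 4 "4 * i" 1 n]
      rev_blocks_apply[of 4 "4 * i" 2 n] rev_blocks_apply[of 4 "4 * i" 3 n]
    by (auto simp: s_def rev_blocks_two)
  have s4l: "s (4 * l) = 4 * l + 1" "s (4 * l + 1) = 4 * l"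
    using n rev_blocks_apply[of 4 "4 * l" 0 n] rev_blocks_apply[of 4 "4 * l" 1 n]
    by (auto simp: s_def rev_blocks_two)
  obtain q where l: "l = q + 1" "2 \<le> q" using that[of "l - 1"] n(2) by simp
  have nq: "n = 4 * q + 6" using n l by simp
  define c where "c = three_cycle 0 (4 * q + 5) (4 * q + 1)"
  define c' where "c' = three_cycle 2 (4 * q + 3) (4 * q + 4)"
  have dc: "distinct [0, 4 * q + 5, 4 * q + 1]" "distinct [2, 4 * q + 3, 4 * q + 4]" using l(2) by auto
  note ca = three_cycle_apply[OF dc(1), folded c_def] three_cycle_apply[OF dc(2), folded c'_def]
  define \<beta> where "\<beta> = c \<circ> c'"
  have \<beta>: "\<beta> x = (if x = 0 then 4 * q + 5 else if x = 4 * q + 5 then 4 * q + 1 else if x = 4 * q + 1 then 0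
      else if x = 2 then 4 * q + 3 else if x = 4 * q + 3 then 4 * q + 4 else if x = 4 * q + 4 then 2 else x)" for x
  proof -
    have d: "distinct [0, 4 * q + 5, 4 * q + 1, 2, 4 * q + 3, 4 * q + 4]" using l(2) by auto
    consider "x = 0" | "x = 4 * q + 5" | "x = 4 * q + 1" | "x = 2" | "x = 4 * q + 3" | "x = 4 * q + 4"
      | "x \<notin> {0, 4 * q + 5, 4 * q + 1, 2, 4 * q + 3, 4 * q + 4}" by blast
    then show ?thesis
      by cases (use d in \<open>simp_all add: \<beta>_def ca\<close>)
  qed
  have \<beta>4: "\<beta> (4 * i) = (if i = 0 then 4 * q + 5 else if i = q + 1 then 2 else 4 * i)"
    "\<beta> (4 * i + 1) = (if i = q + 1 then 4 * q + 1 else if i = q then 0 else 4 * i + 1)"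
    "\<beta> (4 * i + 2) = (if i = 0 then 4 * q + 3 else 4 * i + 2)"
    "\<beta> (4 * i + 3) = (if i = q then 4 * q + 4 else 4 * i + 3)" for i
  proof -
    have ne: "4 * i \<noteq> 4 * q + 5" "4 * i \<noteq> 4 * q + 1" "4 * i \<noteq> 2" "4 * i \<noteq> 4 * q + 3"
      "4 * i + 1 \<noteq> 0" "4 * i + 1 \<noteq> 2" "4 * i + 1 \<noteq> 4 * q + 3" "4 * i + 1 \<noteq> 4 * q + 4"
      "4 * i + 2 \<noteq> 0" "4 * i + 2 \<noteq> 4 * q + 5" "4 * i + 2 \<noteq> 4 * q + 1" "4 * i + 2 \<noteq> 4 * q + 3"
      "4 * i + 2 \<noteq> 4 * q + 4" "4 * i + 3 \<noteq> 0" "4 * i + 3 \<noteq> 4 * q + 5"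
      "4 * i + 3 \<noteq> 4 * q + 1" "4 * i + 3 \<noteq> 2" "4 * i + 3 \<noteq> 4 * q + 4" by presburger+
    have eq: "4 * i = 0 \<longleftrightarrow> i = 0" "4 * i = 4 * q + 4 \<longleftrightarrow> i = q + 1"
      "4 * i + 1 = 4 * q + 5 \<longleftrightarrow> i = q + 1" "4 * i + 1 = 4 * q + 1 \<longleftrightarrow> i = q"
      "4 * i + 2 = 2 \<longleftrightarrow> i = 0" "4 * i + 3 = 4 * q + 3 \<longleftrightarrow> i = q" by linarith+
    show "\<beta> (4 * i) = (if i = 0 then 4 * q + 5 else if i = q + 1 then 2 else 4 * i)"
      "\<beta> (4 * i + 1) = (if i = q + 1 then 4 * q + 1 else if i = q then 0 else 4 * i + 1)"
      "\<beta> (4 * i + 2) = (if i = 0 then 4 * q + 3 else 4 * i + 2)"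
      "\<beta> (4 * i + 3) = (if i = q then 4 * q + 4 else 4 * i + 3)"
      unfolding \<beta> by (simp_all only: ne eq if_False if_cancel refl)
  qed
  have \<beta>2: "\<beta> 2 = 4 * q + 3" using l unfolding \<beta> by simp
  have s02: "s 0 = 2" "s 1 = 3" "s 2 = 0" "s 3 = 1" using s4[of 0] n by (simp_all add: numeral_3_eq_3 numeral_2_eq_2)
  have z4: "i \<le> q \<Longrightarrow> z (z (4 * i)) = 4 * (i + 1)" "z (z (4 * (q + 1))) = 2"
    "z (z 1) = 4 * q + 3" "i \<le> q \<Longrightarrow> z (z (4 * (i + 1) + 1)) = 4 * i + 1"
    "i < q \<Longrightarrow> z (z (4 * i + 2)) = 4 * (i + 1) + 2" "z (z (4 * q + 2)) = 0"
    "z (z 3) = 4 * q + 5" "i < q \<Longrightarrow> z (z (4 * (i + 1) + 3)) = 4 * i + 3" for i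
    unfolding z_def nq by simp_all
  note s4' = s4[unfolded l] s4l[unfolded l]
  \<comment> \<open>Inside the deck \<open>z \<circ> z\<close> shifts even and odd positions
    by one block each and so commutes with \<open>s\<close>; the permutation
    \<open>\<beta>\<close> records what happens at the two ends.\<close>
  have main: "s (z (z (s x))) = \<beta> (z (z x))" if x: "x < n" for x
  proof -
    have dm: "x = 4 * (x div 4) + x mod 4" by simp
    have "x mod 4 = 0 \<or> x mod 4 = 1 \<or> x mod 4 = 2 \<or> x mod 4 = 3" by presburger
    then consider (a) i where "x = 4 * i" | (b) i where "x = 4 * i + 1"
      | (c) i where "x = 4 * i + 2" | (d) i where "x = 4 * i + 3"
      using dm by (metis add.right_neutral)
    then show ?thesis
    proof cases
      case (a i)
      then consider "i < q" | "i = q" | "i = q + 1" using x nq by linarith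
      then show ?thesis
      proof cases
        case 1
        then show ?thesis using a z4(1)[of i] z4(5)[of i] s4'(1)[of i] s4'(3)[of "i + 1"] \<beta>4(1)[of "i + 1"] by (simp add: algebra_simps)
      next
        case 2
        then show ?thesis using a z4(1)[of q] z4(6) s4'(1)[of q] s02 \<beta>4(1)[of "q + 1"] by (simp add: algebra_simps)
      next
        case 3
        then show ?thesis using a z4(2) z4(4)[of q] s4'(5) s4'(2)[of q] \<beta>2 by (simp add: algebra_simps)
      qed
    next
      case (b i)
      then consider "i = 0" | "0 < i" "i \<le> q" | "i = q + 1" using x nq by linarith
      then show ?thesis
      proof cases
        case 1
        then show ?thesis using b z4(3) z4(7) s02 s4'(6) \<beta>4(4)[of q] by (simp add: algebra_simps)
      next
        case 2
        then obtain k where "i = k + 1" by (metis Suc_eq_plus1 gr0_implies_Suc)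
        then show ?thesis using 2 b z4(4)[of k] z4(8)[of k] s4'(2)[of i] s4'(4)[of k] \<beta>4(2)[of k] by (simp add: algebra_simps)
      next
        case 3
        then show ?thesis using b z4(2) z4(4)[of q] s4'(6) s02 \<beta>4(2)[of q] by (simp add: algebra_simps)
      qed
    next
      case (c i)
      then consider "i < q" | "i = q" using x nq by linarith
      then show ?thesis
      proof cases
        case 1
        then show ?thesis using c z4(1)[of i] z4(5)[of i] s4'(3)[of i] s4'(1)[of "i + 1"] \<beta>4(3)[of "i + 1"] by (simp add: algebra_simps)
      next
        case 2
        then show ?thesis using c z4(1)[of q] z4(6) s4'(3)[of q] s4'(5) \<beta>4(1)[of 0] by (simp add: algebra_simps)
      qed
    next
      case (d i)
      then consider "i = 0" | "0 < i" "i \<le> q" using x nq by linarith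
      then show ?thesis
      proof cases
        case 1
        then show ?thesis using d z4(3) z4(7) s02 s4'(4)[of q] \<beta>4(2)[of "q + 1"] by (simp add: algebra_simps)
      next
        case 2
        then obtain k where "i = k + 1" by (metis Suc_eq_plus1 gr0_implies_Suc)
        then show ?thesis using 2 d z4(4)[of k] z4(8)[of k] s4'(4)[of i] s4'(2)[of k] \<beta>4(4)[of k] by (simp add: algebra_simps)
      qed
    qed
  qed
  have \<beta>P: "\<beta> permutes {..<n}" unfolding \<beta>_def c_def c'_def
    using nq by (intro permutes_compose three_cycle_permutes) auto
  have "s \<circ> z \<circ> z \<circ> s = \<beta> \<circ> z \<circ> z"
  proof (rule permutes_eqI)
    show "s \<circ> z \<circ> z \<circ> s permutes {..<n}" using permutes comp_mem sM zM by metis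
    show "\<beta> \<circ> z \<circ> z permutes {..<n}" using permutes_compose \<beta>P permutes[OF zM] by blast
  qed (use main in auto)
  then have "\<beta> \<circ> (z \<circ> (z \<circ> inv' z) \<circ> inv' z) = s \<circ> z \<circ> z \<circ> s \<circ> inv' z \<circ> inv' z"
    by (simp add: o_assoc)
  then have "\<beta> = s \<circ> z \<circ> z \<circ> s \<circ> inv' z \<circ> inv' z"
    using bij_mem[OF zM] by (simp add: bij_is_surj surj_iff[THEN iffD1])
  then have \<beta>M: "\<beta> \<in> ?M" using comp_mem inv_mem sM zM by metis
  \<comment> \<open>Chosen such that \<open>y\<close> takes the six points moved by
    \<open>\<beta>\<close> to a set that has only one point in common with them.\<close>
  define y where "y = (inv' z ^^ 3) \<circ> rev_blocks n n"
  have yM: "y \<in> ?M" unfolding y_def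
    by (intro comp_mem funpow_mem inv_mem zM block_revs_whole)
  have zi: "inv' z (z u) = u" for u using bij_mem[OF zM] by (simp add: bij_is_inj)
  have y: "y u = v" if "u < n" "z (z (z v)) = n - 1 - u" for u v
  proof -
    have "y u = inv' z (inv' z (inv' z (z (z (z v)))))"
      using that by (simp add: y_def numeral_3_eq_3 rev_blocks_whole)
    then show ?thesis by (simp only: zi)
  qed
  have yv: "y 0 = 5" "y (4 * q + 5) = 4 * q" "y (4 * q + 1) = 4 * q + 4"
    "y 2 = 3" "y (4 * q + 3) = 4 * q + 2" "y (4 * q + 4) = 7"
    by (rule y; use l(2) in \<open>simp add: z_def nq\<close>)+
  define \<beta>' where "\<beta>' = y \<circ> \<beta> \<circ> inv' y"
  have \<beta>'M: "\<beta>' \<in> ?M" unfolding \<beta>'_def by (rule conj_mem[OF yM \<beta>M])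
  have "\<beta>' = (y \<circ> c \<circ> inv' y) \<circ> (y \<circ> c' \<circ> inv' y)"
    using bij_mem[OF yM] by (simp add: \<beta>'_def \<beta>_def fun_eq_iff bij_is_inj inv_f_f)
  then have \<beta>'e: "\<beta>' = three_cycle 5 (4 * q) (4 * q + 4) \<circ> three_cycle 3 (4 * q + 2) 7"
    unfolding c_def c'_def using three_cycle_conj[OF bij_mem[OF yM]] dc yv by simp
  have dd: "distinct [5, 4 * q, 4 * q + 4]" "distinct [3, 4 * q + 2, 7]"
  proof -
    have "4 * q \<noteq> 3" "4 * q \<noteq> 1" "4 * q \<noteq> 5" "4 * q + 4 \<noteq> 5" "4 * q + 2 \<noteq> 3" "4 * q + 2 \<noteq> 7" by presburger+
    then show "distinct [5, 4 * q, 4 * q + 4]" "distinct [3, 4 * q + 2, 7]" by simp_all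
  qed
  have common: "x = 4 * q + 4" if "\<beta> x \<noteq> x" "\<beta>' x \<noteq> x" for x
  proof -
    have "x = 0 \<or> x = 4 * q + 5 \<or> x = 4 * q + 1 \<or> x = 2 \<or> x = 4 * q + 3 \<or> x = 4 * q + 4"
      using that(1) unfolding \<beta> by (auto split: if_splits)
    moreover have "x = 5 \<or> x = 4 * q \<or> x = 4 * q + 4 \<or> x = 3 \<or> x = 4 * q + 2 \<or> x = 7"
      using that(2) unfolding \<beta>'e comp_apply three_cycle_apply[OF dd(1)] three_cycle_apply[OF dd(2)]
      by (auto split: if_splits)
    ultimately show ?thesis using l(2) by presburger
  qed
  have one: "\<beta> x = x \<or> \<beta>' x = x" if "x \<noteq> 4 * q + 4" for x
    using common that by blast
  have n2: "n - 2 = 4 * q + 4" using nq by simp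
  have "4 * q \<noteq> 3" by presburger
  then have "\<beta>' (4 * q + 4) = 5" using dd
    unfolding \<beta>'e comp_apply three_cycle_apply[OF dd(1)] three_cycle_apply[OF dd(2)] by simp
  moreover have "\<beta> (4 * q + 4) = 2" by (simp add: \<beta>)
  ultimately have tc: "distinct [n - 2, 2, 5]" "three_cycle (n - 2) 2 5 \<in> ?M"
    using commutator_three_cycle[of \<beta> \<beta>' "4 * q + 4"] one bij_mem[OF \<beta>M] bij_mem[OF \<beta>'M]
      comp_mem[OF comp_mem[OF comp_mem[OF \<beta>M \<beta>'M] inv_mem[OF \<beta>M]] inv_mem[OF \<beta>'M]]
    unfolding n2 by auto
  have e1: "linked (n - 2) 2" using linkedI[OF tc] .
  have e2: "linked 2 5" using linkedI[of 2 5 "n - 2"] three_cycle_mem_rotate[OF tc] tc(1) by auto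
  have "linked (z (n - 2)) (z 2)" using linked_apply[OF zM e1] .
  then have e3: "linked 0 4" using n by (simp add: z_def)
  have up: "linked (2 * k) (2 * k + 4)" if "2 * k + 4 < n" for k
    using that
  proof (induction k)
    case 0 then show ?case using e3 by simp
  next
    case (Suc k)
    then have "linked (z (2 * k)) (z (2 * k + 4))" using linked_apply[OF zM] by simp
    then show ?case using Suc by (simp add: z_def)
  qed
  have mult4: "linked 0 (4 * i)" if "4 * i < n" for i
    using that
  proof (induction i)
    case (Suc i)
    then show ?case using up[of "2 * i"] linked_trans[of 0 "4 * i" "4 * i + 4"] by (simp add: add.commute)
  qed (simp add: linked_refl)
  have e4: "linked 0 2" using mult4[of l] e1 n linked_trans by simp
  have evens: "linked 0 (2 * i)" if "2 * i < n" for i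
    using that
  proof (induction i rule: less_induct)
    case (less i)
    consider "i = 0" | "i = 1" | k where "i = k + 2" by (metis One_nat_def add_2_eq_Suc' not0_implies_Suc)
    then show ?case
    proof cases
      case (3 k)
      have e: "2 * i = 2 * k + 4" using 3 by simp
      have "linked 0 (2 * k)" using less 3 by simp
      then show ?thesis unfolding e using up[of k] linked_trans less.prems e by metis
    qed (use e4 linked_refl in auto)
  qed
  have zs: "z 0 = 2" "z 5 = 3" "z 3 = 1" "z 1 = n - 1" using n by (simp_all add: z_def)
  have z0: "linked 0 (z u)" if "linked 0 u" for u
    using linked_apply[OF zM that] e4 linked_trans zs(1) by metis
  have five: "linked 0 5" using e4 e2 linked_trans by blast
  have "linked 0 3" using z0[OF five] unfolding zs .
  then have "linked 0 1" using z0 zs(3) by metis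
  then have last: "linked 0 (n - 1)" using z0 zs(4) by metis
  have odds: "linked 0 (n - 1 - 2 * k)" if "2 * k < n" for k
    using that
  proof (induction k)
    case 0 then show ?case using last by simp
  next
    case (Suc k)
    then have "linked 0 (z (n - 1 - 2 * k))" using z0 by simp
    moreover have "z (n - 1 - 2 * k) = n - 1 - 2 * Suc k" using Suc n by (auto simp: z_def)
    ultimately show ?case by simp
  qed
  show ?thesis
  proof (rule contains_alternatingI)
    fix x assume x: "x \<in> {..<n}"
    show "linked 0 x"
    proof (cases "even x")
      case True then show ?thesis using evens[of "x div 2"] x by simp
    next
      case False
      then have "x = n - 1 - 2 * ((n - 1 - x) div 2)" using x n by (auto elim!: oddE)
      then show ?thesis using odds[of "(n - 1 - x) div 2"] x by simp
    qed
  qed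
qed

text \<open>An element \<open>g\<close> carries a class of linked points into the class of
  \<open>z\<close> as soon as it does so for one of them.\<close>

lemma (in perm_group) linked_expand:
  assumes "g \<in> M" "\<forall>x\<in>S. linked z x" "u \<in> S" "g u \<in> S"
  shows "\<forall>x\<in>S \<union> g ` S. linked z x"
  using assms linked_apply linked_sym linked_trans by (metis (no_types, lifting) Un_iff imageE)

text \<open>The product \<open>f\<close> consists of a three-cycle, a five-cycle and two fixed
  points, hence its fifth power is a three-cycle. This length is too small for
  \<open>contains_alternating_twice_odd\<close>.\<close>

lemma contains_alternating_10: "contains_alternating {..<10} (gen_by (block_revs 10))"
proof -
  let ?M = "gen_by (block_revs 10)"
  interpret perm_group "{..<10}" ?M by (rule perm_group_block_revs)
  have r: "rev_blocks 10 2 \<in> ?M" "rev_blocks 10 4 \<in> ?M" "rev_blocks 10 5 \<in> ?M" "rev_blocks 10 10 \<in> ?M"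
    using block_revs_pow[of 1 10] block_revs_pow[of 2 10] block_revs_copow[of 5 1 10] block_revs_whole by simp_all
  define f where "f = rev_blocks 10 4 \<circ> rev_blocks 10 5 \<circ> rev_blocks 10 4 \<circ> rev_blocks 10 5 \<circ>
    rev_blocks 10 2 \<circ> rev_blocks 10 5 \<circ> rev_blocks 10 4 \<circ> rev_blocks 10 10"
  have fM: "f \<in> ?M" unfolding f_def by (intro comp_mem r)
  have tab: "f 0 = 2" "f (Suc 0) = 3" "f 2 = 7" "f 3 = 9" "f 4 = 8" "f 5 = 5" "f 6 = 6" "f 7 = 0" "f 8 = Suc 0" "f 9 = 4"
    by (simp_all add: f_def rev_blocks_def)
  have split: "x = 0 \<or> x = Suc 0 \<or> x = 2 \<or> x = 3 \<or> x = 4 \<or> x = 5 \<or> x = 6 \<or> x = 7 \<or> x = 8 \<or> x = 9" if "x < 10" for x :: nat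
    using that by presburger
  have "f (f (f (f (f x)))) = three_cycle 0 7 2 x" if "x < 10" for x
    using split[OF that] by (elim disjE) (simp_all add: tab three_cycle_apply)
  then have "f \<circ> f \<circ> f \<circ> f \<circ> f = three_cycle 0 7 2"
    by (intro permutes_eqI[of _ 10]) (auto intro!: three_cycle_permutes permutes_compose permutes[OF fM])
  then have "three_cycle 0 7 2 \<in> ?M" using comp_mem fM by metis
  then have "linked 0 7" "linked 0 2"
    using linkedI[of 0 7 2] linkedI[of 0 2 7] three_cycle_mem_swap[of 0 7 2] by auto
  then have 1: "\<forall>x\<in>{0, 2, 7}. linked 0 x" using linked_refl by auto
  have 2: "\<forall>x\<in>{0, 2, 7, 9}. linked 0 x"
    using linked_expand[OF r(4) 1, of 2] by (simp add: rev_blocks_def)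
  have 3: "\<forall>x\<in>{0, 2, 4, 5, 7, 9}. linked 0 x"
    using linked_expand[OF r(3) 2, of 2] by (simp add: rev_blocks_def)
  have 4: "\<forall>x\<in>{0, 1, 2, 3, 4, 5, 6, 7, 9}. linked 0 x"
    using linked_expand[OF r(2) 3, of 4] by (simp add: rev_blocks_def)
  have 5: "\<forall>x\<in>{0, 1, 2, 3, 4, 5, 6, 7, 8, 9}. linked 0 x"
    using linked_expand[OF r(4) 4, of 0] by (simp add: rev_blocks_def)
  show ?thesis
  proof (rule contains_alternatingI)
    fix x :: nat assume "x \<in> {..<10}"
    then have "x < 10" by simp
    from split[OF this] show "linked 0 x" using 5 by (elim disjE) simp_all
  qed
qed

text \<open>The cycles of \<open>f\<close> besides one three-cycle have lengths
  \<open>1\<close>, \<open>2\<close> and \<open>5\<close>, hence its tenth power is a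
  three-cycle. As \<open>6\<close> and \<open>12\<close> are exceptions, the lengths \<open>3
  \<cdot> 2^a\<close> start here.\<close>

lemma contains_alternating_24: "contains_alternating {..<24} (gen_by (block_revs 24))"
proof -
  let ?M = "gen_by (block_revs 24)"
  interpret perm_group "{..<24}" ?M by (rule perm_group_block_revs)
  have r: "rev_blocks 24 2 \<in> ?M" "rev_blocks 24 4 \<in> ?M" "rev_blocks 24 8 \<in> ?M" "rev_blocks 24 16 \<in> ?M"
    "rev_blocks 24 3 \<in> ?M" "rev_blocks 24 6 \<in> ?M" "rev_blocks 24 12 \<in> ?M" "rev_blocks 24 24 \<in> ?M"
    using block_revs_pow[of 1 24] block_revs_pow[of 2 24] block_revs_pow[of 3 24] block_revs_pow[of 4 24]
      block_revs_copow[of 3 3 24] block_revs_copow[of 6 2 24] block_revs_copow[of 12 1 24] block_revs_whole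
    by simp_all
  define f where "f = rev_blocks 24 16 \<circ> rev_blocks 24 3 \<circ> rev_blocks 24 16 \<circ> rev_blocks 24 4 \<circ> rev_blocks 24 12"
  have fM: "f \<in> ?M" unfolding f_def by (intro comp_mem r)
  have tab: "f 0 = 8" "f (Suc 0) = 7" "f 2 = 12" "f 3 = 11" "f 4 = 6" "f 5 = 5" "f 6 = 4" "f 7 = 9" "f 8 = 17" "f 9 = 3" "f 10 = 2" "f 11 = Suc 0" "f 12 = 18" "f 13 = 23" "f 14 = 22" "f 15 = 21" "f 16 = 16" "f 17 = 0" "f 18 = 20" "f 19 = 19" "f 20 = 10" "f 21 = 15" "f 22 = 14" "f 23 = 13"
    by (simp_all add: f_def rev_blocks_def)
  have split: "x = 0 \<or> x = Suc 0 \<or> x = 2 \<or> x = 3 \<or> x = 4 \<or> x = 5 \<or> x = 6 \<or> x = 7 \<or> x = 8 \<or> x = 9 \<or> x = 10 \<or> x = 11 \<or> x = 12 \<or> x = 13 \<or> x = 14 \<or> x = 15 \<or> x = 16 \<or> x = 17 \<or> x = 18 \<or> x = 19 \<or> x = 20 \<or> x = 21 \<or> x = 22 \<or> x = 23" if "x < 24" for x :: nat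
    using that by presburger
  have "f (f (f (f (f (f (f (f (f (f x))))))))) = three_cycle 0 8 17 x" if "x < 24" for x
    using split[OF that] by (elim disjE) (simp_all add: tab three_cycle_apply)
  then have "f \<circ> f \<circ> f \<circ> f \<circ> f \<circ> f \<circ> f \<circ> f \<circ> f \<circ> f = three_cycle 0 8 17"
    by (intro permutes_eqI[of _ 24]) (auto intro!: three_cycle_permutes permutes_compose permutes[OF fM])
  then have "three_cycle 0 8 17 \<in> ?M" using comp_mem fM by metis
  then have "linked 0 8" "linked 0 17"
    using linkedI[of 0 8 17] linkedI[of 0 17 8] three_cycle_mem_swap[of 0 8 17] by auto
  then have 1: "\<forall>x\<in>{0, 8, 17}. linked 0 x" using linked_refl by auto
  have 2: "\<forall>x\<in>{0, 7, 8, 15, 17}. linked 0 x"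
    using linked_expand[OF r(4) 1, of 17] by (simp add: rev_blocks_def)
  have 3: "\<forall>x\<in>{0, 6, 7, 8, 15, 16, 17, 23}. linked 0 x"
    using linked_expand[OF r(8) 2, of 8] by (simp add: rev_blocks_def)
  have 4: "\<forall>x\<in>{0, 1, 6, 7, 8, 9, 14, 15, 16, 17, 22, 23}. linked 0 x"
    using linked_expand[OF r(1) 3, of 6] by (simp add: rev_blocks_def)
  have 5: "\<forall>x\<in>{0, 1, 4, 5, 6, 7, 8, 9, 10, 11, 12, 13, 14, 15, 16, 17, 18, 19, 22, 23}. linked 0 x"
    using linked_expand[OF r(6) 4, of 8] by (simp add: rev_blocks_def)
  have 6: "\<forall>x\<in>{0, 1, 2, 3, 4, 5, 6, 7, 8, 9, 10, 11, 12, 13, 14, 15, 16, 17, 18, 19, 20, 21, 22, 23}. linked 0 x"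
    using linked_expand[OF r(3) 5, of 0] by (simp add: rev_blocks_def)
  show ?thesis
  proof (rule contains_alternatingI)
    fix x :: nat assume "x \<in> {..<24}"
    then have "x < 24" by simp
    from split[OF this] show "linked 0 x" using 6 by (elim disjE) simp_all
  qed
qed

lemma two_power_odd_decomposition:
  assumes "0 < (n::nat)"
  obtains a m where "n = 2 ^ a * m" "odd m"
  using assms
proof (induction n arbitrary: thesis rule: less_induct)
  case (less n)
  show ?case
  proof (cases "odd n")
    case True then show ?thesis using less(2)[of 0 n] by simp
  next
    case False
    then obtain k where k: "n = 2 * k" by blast
    then obtain a m where "k = 2 ^ a * m" "odd m" using less(1)[of k] less(3) by auto
    then show ?thesis using less(2)[of "Suc a" m] k by simp
  qed
qed

lemma contains_alternating_iterate:
  assumes "contains_alternating {..<2 ^ b * m} (gen_by (block_revs (2 ^ b * m)))"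
    and "10 \<le> 2 ^ b * m" "1 \<le> b" "odd m" "3 \<le> m" "b \<le> a"
  shows "contains_alternating {..<2 ^ a * m} (gen_by (block_revs (2 ^ a * m)))"
  using assms(6)
proof (induction a rule: dec_induct)
  case base then show ?case by (rule assms(1))
next
  case (step c)
  have "(2::nat) ^ b * m \<le> 2 ^ c * m" using step by simp
  then have "10 \<le> 2 ^ c * m" using assms(2) by linarith
  moreover have "1 \<le> c" using step assms(3) by simp
  ultimately show ?case
    using contains_alternating_double[OF step(3), of c m] assms(4,5) by (simp add: mult.assoc)
qed

text \<open>Write \<open>n = 2^a m\<close> with \<open>m\<close> odd. Repeated doubling starts
  from \<open>2 m\<close>, and from \<open>24\<close> when \<open>m = 3\<close>.\<close>

theorem folded_contains_alternating:
  assumes "3 \<le> n" "\<nexists>k. n = 2 ^ k" "n \<noteq> 6" "n \<noteq> 12"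
  shows "contains_alternating {..<n} (folded_group n)"
proof -
  obtain a m where n: "n = 2 ^ a * m" "odd m" using two_power_odd_decomposition[of n] assms by auto
  have m3: "3 \<le> m" using n assms(2) by (cases "m = 1") (auto elim!: oddE)
  show ?thesis
  proof (cases "a = 0")
    case True
    then show ?thesis using contains_alternating_odd[of n "n div 2"] n m3 by simp
  next
    case False
    have "contains_alternating {..<n} (gen_by (block_revs n))"
    proof (cases "m = 3")
      case True
      have "a \<noteq> 1" "a \<noteq> 2" using n True assms by auto
      then have "3 \<le> a" using False by simp
      then show ?thesis using contains_alternating_iterate[of 3 3 a] contains_alternating_24 n True by simp
    next
      case m: False
      have "contains_alternating {..<2 * m} (gen_by (block_revs (2 * m)))"
      proof (cases "m = 5")
        case True then show ?thesis using contains_alternating_10 by simp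
      next
        case False
        obtain l where l: "m = 2 * l + 1" using n(2) oddE by blast
        then show ?thesis using contains_alternating_twice_odd[of "2 * m" l] m False m3 by simp
      qed
      moreover have "10 \<le> 2 * m" using m m3 n(2) by (auto elim!: oddE)
      ultimately show ?thesis using contains_alternating_iterate[of 1 m a] False n m3 by simp
    qed
    then show ?thesis using contains_alternating_mono block_revs_in_folded assms by (metis gr_zeroI not_numeral_le_zero)
  qed
qed

section \<open>Centrally symmetric permutations and the shuffle groups\<close>

definition mirror :: "nat \<Rightarrow> nat \<Rightarrow> nat" where
  "mirror n x = (if x < 2 * n then 2 * n - 1 - x else x)"

lemma mirror_less: "x < 2 * n \<Longrightarrow> mirror n x < 2 * n" by (simp add: mirror_def)
lemma mirror_mirror: "mirror n (mirror n x) = x" by (auto simp: mirror_def)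
lemma mirror_neq: "x < 2 * n \<Longrightarrow> mirror n x \<noteq> x" by (simp add: mirror_def) presburger
lemma fold_mirror: "x < 2 * n \<Longrightarrow> fold_pos n (mirror n x) = fold_pos n x"
  by (auto simp: mirror_def fold_pos_def)
lemma fold_pos_eq_mirror:
  "x < 2 * n \<Longrightarrow> y < 2 * n \<Longrightarrow> fold_pos n x = fold_pos n y \<longleftrightarrow> x = y \<or> x = mirror n y"
  by (simp add: fold_pos_eq_iff mirror_def)
lemma fold_pos_id: "x < n \<Longrightarrow> fold_pos n x = x" by (simp add: fold_pos_def)

lemma mirror_permutes: "mirror n permutes {0..<2 * n}"
proof (rule bij_imp_permutes)
  show "bij_betw (mirror n) {0..<2 * n} {0..<2 * n}"
    by (rule bij_betwI[where g = "mirror n"]) (auto simp: mirror_less mirror_mirror)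
qed (simp add: mirror_def)

abbreviation central :: "nat \<Rightarrow> (nat \<Rightarrow> nat) set" where
  "central n \<equiv> carrier (B_group n)"

lemma central_iff:
  "g \<in> central n \<longleftrightarrow> g permutes {0..<2 * n} \<and> (\<forall>x<2 * n. g (mirror n x) = mirror n (g x))"
proof -
  have "(\<forall>i<2 * n. \<forall>j<2 * n. i + j = 2 * n - 1 \<longrightarrow> g i + g j = 2 * n - 1) \<longleftrightarrow>
      (\<forall>x<2 * n. g (mirror n x) = mirror n (g x))" (is "?l \<longleftrightarrow> ?r") if "g permutes {0..<2 * n}"
  proof
    have lt: "g x < 2 * n" if "x < 2 * n" for x
      using permutes_in_image[OF \<open>g permutes {0..<2 * n}\<close>, of x] that by simp
    {
      assume l: ?l
      show ?r
      proof (intro allI impI)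
        fix x assume x: "x < 2 * n"
        then have "g x + g (2 * n - 1 - x) = 2 * n - 1" using l[rule_format, of x "2 * n - 1 - x"] by simp
        then show "g (mirror n x) = mirror n (g x)" using x lt by (simp add: mirror_def)
      qed
    }
    assume r: ?r
    show ?l
    proof (intro allI impI)
      fix i j assume ij: "i < 2 * n" "j < 2 * n" "i + j = 2 * n - 1"
      then have "j = mirror n i" by (simp add: mirror_def)
      then show "g i + g j = 2 * n - 1" using r ij lt[of i] by (simp add: mirror_def)
    qed
  qed
  then show ?thesis by (auto simp: B_group_def)
qed

lemma central_permutes: "g \<in> central n \<Longrightarrow> g permutes {0..<2 * n}" by (simp add: central_iff)
lemma central_mirror: "g \<in> central n \<Longrightarrow> g (mirror n x) = mirror n (g x)"
proof (cases "x < 2 * n")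
  case False
  assume "g \<in> central n"
  then have "g x = x" using central_permutes permutes_not_in[of g "{0..<2*n}" x] False by simp
  then show ?thesis using False by (simp add: mirror_def)
qed (simp add: central_iff)
lemma central_less: "g \<in> central n \<Longrightarrow> x < 2 * n \<Longrightarrow> g x < 2 * n"
  using permutes_in_image[OF central_permutes, of g n x] by simp

lemma perm_group_central: "perm_group {0..<2 * n} (central n)"
proof
  fix p q assume pq: "p \<in> central n" "q \<in> central n"
  show "p \<circ> q \<in> central n"
    using pq central_less[OF pq(2)]
    by (auto simp: central_iff intro: permutes_compose)
next
  show "id \<in> central n" unfolding central_iff using permutes_id by auto
qed (auto simp: central_permutes)

lemma mirror_central: "mirror n \<in> central n"
  using mirror_permutes by (simp add: central_iff)

lemma deck_group_simps:
  "p \<in> carrier (deck_group n) \<longleftrightarrow> p permutes {0..<2 * n}"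
  "p \<otimes>\<^bsub>deck_group n\<^esub> q = p \<circ> q" "\<one>\<^bsub>deck_group n\<^esub> = id"
  unfolding deck_group_def by simp_all

lemma group_deck: "group (deck_group n)"
proof (rule groupI)
  show "\<one>\<^bsub>deck_group n\<^esub> \<in> carrier (deck_group n)"
    unfolding deck_group_simps by (rule permutes_id)
  fix p assume p: "p \<in> carrier (deck_group n)"
  show "\<exists>q\<in>carrier (deck_group n). q \<otimes>\<^bsub>deck_group n\<^esub> p = \<one>\<^bsub>deck_group n\<^esub>"
    using p permutes_inv permutes_inv_o(2) unfolding deck_group_simps by (metis deck_group_simps(1))
  show "\<one>\<^bsub>deck_group n\<^esub> \<otimes>\<^bsub>deck_group n\<^esub> p = p" unfolding deck_group_simps by simp
  fix q assume q: "q \<in> carrier (deck_group n)"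
  show "p \<otimes>\<^bsub>deck_group n\<^esub> q \<in> carrier (deck_group n)"
    using p q permutes_compose unfolding deck_group_simps by metis
  fix r show "p \<otimes>\<^bsub>deck_group n\<^esub> q \<otimes>\<^bsub>deck_group n\<^esub> r = p \<otimes>\<^bsub>deck_group n\<^esub> (q \<otimes>\<^bsub>deck_group n\<^esub> r)"
    unfolding deck_group_simps by (simp add: comp_assoc)
qed

lemma generate_eq_gen_by:
  fixes G :: "('a \<Rightarrow> 'a) monoid"
  assumes G: "group G" "\<And>p. p \<in> carrier G \<longleftrightarrow> p permutes A" "\<And>p q. p \<otimes>\<^bsub>G\<^esub> q = p \<circ> q" "\<one>\<^bsub>G\<^esub> = id"
    and A: "finite A" and S: "\<And>p. p \<in> S \<Longrightarrow> p permutes A"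
  shows "generate G S = gen_by S"
proof
  interpret perm_group A "gen_by S" by (rule perm_group_gen_by) (use A S in auto)
  show "generate G S \<subseteq> gen_by S"
  proof
    fix x assume "x \<in> generate G S"
    then show "x \<in> gen_by S"
    proof (induction rule: generate.induct)
      case one show ?case unfolding G(4) by (rule gen_id)
    next
      case (incl h) then show ?case by (rule gen_by_incl)
    next
      case (inv h)
      have h: "h permutes A" using S inv by blast
      have "inv\<^bsub>G\<^esub> h = inv' h"
      proof (rule group.inv_equality[OF G(1)])
        show "inv' h \<otimes>\<^bsub>G\<^esub> h = \<one>\<^bsub>G\<^esub>" unfolding G(3,4) by (rule permutes_inv_o(2)[OF h])
      qed (use h permutes_inv G(2) in blast)+
      then show ?case using inv_mem[OF gen_by_incl[OF inv]] by simp
    next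
      case (eng h1 h2) then show ?case unfolding G(3) by (intro gen_by_comp)
    qed
  qed
next
  show "gen_by S \<subseteq> generate G S"
  proof
    fix x assume "x \<in> gen_by S"
    then show "x \<in> generate G S"
    proof (induction rule: gen_by.induct)
      case gen_id show ?case using generate.one[of G S] unfolding G(4) .
    next
      case (gen_step f g)
      then show ?case using generate.eng[OF generate.incl[of f S G], of g] unfolding G(3) by blast
    qed
  qed
qed

lemmas generate_deck = generate_eq_gen_by[OF group_deck deck_group_simps finite_atLeastLessThan]

lemma carrier_IO: "carrier (IO_group n) = gen_by {in_shuffle n, out_shuffle n}"
proof -
  have "carrier (deck_group n) \<inter> {in_shuffle n, out_shuffle n} = {in_shuffle n, out_shuffle n}"
    using in_shuffle_permutes out_shuffle_permutes by (auto simp: deck_group_def)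
  then show ?thesis
    unfolding IO_group_def carrier_subgroup_generated
    using generate_deck[of "{in_shuffle n, out_shuffle n}" n] in_shuffle_permutes out_shuffle_permutes by auto
qed

lemma carrier_LR: "carrier (LR_group n) = gen_by {left_shuffle n, right_shuffle n}"
proof -
  have "carrier (deck_group n) \<inter> {left_shuffle n, right_shuffle n} = {left_shuffle n, right_shuffle n}"
    using left_shuffle_permutes right_shuffle_permutes by (auto simp: deck_group_def)
  then show ?thesis
    unfolding LR_group_def carrier_subgroup_generated
    using generate_deck[of "{left_shuffle n, right_shuffle n}" n] left_shuffle_permutes right_shuffle_permutes by auto
qed

lemma perm_group_IO: "perm_group {0..<2 * n} (carrier (IO_group n))"
  unfolding carrier_IO by (rule perm_group_gen_by) (use in_shuffle_permutes out_shuffle_permutes in auto)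

lemma perm_group_LR: "perm_group {0..<2 * n} (carrier (LR_group n))"
  unfolding carrier_LR by (rule perm_group_gen_by) (use left_shuffle_permutes right_shuffle_permutes in auto)

lemma IO_subset_central: "carrier (IO_group n) \<subseteq> central n"
  unfolding carrier_IO
  by (rule perm_group.gen_by_subset[OF perm_group_central]) (use shuffles_in_B_group in auto)

lemma LR_subset_central: "carrier (LR_group n) \<subseteq> central n"
  unfolding carrier_LR
  by (rule perm_group.gen_by_subset[OF perm_group_central]) (use shuffles_in_B_group in auto)

lemma deck_ext:
  fixes f g :: "nat \<Rightarrow> nat"
  assumes "f permutes {0..<2 * n}" "g permutes {0..<2 * n}" "\<And>x. x < 2 * n \<Longrightarrow> f x = g x"
  shows "f = g"
  by (rule permutes_eqI[of _ "2 * n"]) (use assms in \<open>auto simp: lessThan_atLeast0\<close>)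

text \<open>The left and right shuffles undo the in and out shuffles, but leave the deck in
  reverse order.\<close>

lemma right_out: "right_shuffle n \<circ> out_shuffle n = mirror n"
proof (rule deck_ext)
  fix x assume "x < 2 * n"
  then show "(right_shuffle n \<circ> out_shuffle n) x = mirror n x"
    by (rule half_cases) (auto simp: out_shuffle_simps right_shuffle_simps right_shuffle_simps(2)[simplified] mirror_def)
qed (auto intro: permutes_compose right_shuffle_permutes out_shuffle_permutes mirror_permutes)

lemma left_in: "left_shuffle n \<circ> in_shuffle n = mirror n"
proof (rule deck_ext)
  fix x assume "x < 2 * n"
  then show "(left_shuffle n \<circ> in_shuffle n) x = mirror n x"
    by (rule half_cases) (auto simp: in_shuffle_simps left_shuffle_simps left_shuffle_simps(2)[simplified] mirror_def)
qed (auto intro: permutes_compose left_shuffle_permutes in_shuffle_permutes mirror_permutes)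

lemma in_out: "in_shuffle n = rev_blocks (2 * n) 2 \<circ> out_shuffle n"
proof (rule deck_ext)
  fix x assume "x < 2 * n"
  then show "in_shuffle n x = (rev_blocks (2 * n) 2 \<circ> out_shuffle n) x"
    by (rule half_cases) (auto simp: in_shuffle_simps out_shuffle_simps rev_blocks_two)
qed (use permutes_compose[OF out_shuffle_permutes rev_blocks_permutes[of "2 * n", unfolded lessThan_atLeast0]]
  in_shuffle_permutes in auto)

lemma shuffle_inverses:
  "right_shuffle n = mirror n \<circ> inv' (out_shuffle n)" "left_shuffle n = mirror n \<circ> inv' (in_shuffle n)"
  "inv' (right_shuffle n) = mirror n \<circ> out_shuffle n" "inv' (left_shuffle n) = mirror n \<circ> in_shuffle n"
proof -
  have b: "bij (out_shuffle n)" "bij (in_shuffle n)" "bij (right_shuffle n)" "bij (left_shuffle n)"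
    using permutes_bij out_shuffle_permutes in_shuffle_permutes right_shuffle_permutes left_shuffle_permutes by blast+
  show "right_shuffle n = mirror n \<circ> inv' (out_shuffle n)"
    using b(1) by (simp add: fun_eq_iff right_out[symmetric] bij_is_surj surj_f_inv_f)
  show "left_shuffle n = mirror n \<circ> inv' (in_shuffle n)"
    using b(2) by (simp add: fun_eq_iff left_in[symmetric] bij_is_surj surj_f_inv_f)
  have o: "out_shuffle n \<in> central n" "in_shuffle n \<in> central n" using shuffles_in_B_group by auto
  have e1: "right_shuffle n (mirror n (out_shuffle n x)) = x" for x
    using fun_cong[OF right_out[of n], of "mirror n x"] central_mirror[OF o(1)] by (simp add: mirror_mirror)
  have e2: "left_shuffle n (mirror n (in_shuffle n x)) = x" for x
    using fun_cong[OF left_in[of n], of "mirror n x"] central_mirror[OF o(2)] by (simp add: mirror_mirror)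
  show "inv' (right_shuffle n) = mirror n \<circ> out_shuffle n"
    using e1 b(3) by (metis bij_inv_eq_iff comp_apply ext)
  show "inv' (left_shuffle n) = mirror n \<circ> in_shuffle n"
    using e2 b(4) by (metis bij_inv_eq_iff comp_apply ext)
qed

text \<open>A common overgroup of the two shuffle groups. Either of them meets every coset of
  the mirror in it, and equals it if it contains the mirror.\<close>

definition shuffle_hull :: "nat \<Rightarrow> (nat \<Rightarrow> nat) set" where
  "shuffle_hull n = gen_by {in_shuffle n, out_shuffle n, mirror n}"

lemma perm_group_hull: "perm_group {0..<2 * n} (shuffle_hull n)"
  unfolding shuffle_hull_def
  by (rule perm_group_gen_by) (use in_shuffle_permutes out_shuffle_permutes mirror_permutes in auto)

lemma hull_subset_central: "shuffle_hull n \<subseteq> central n"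
  unfolding shuffle_hull_def
  by (rule perm_group.gen_by_subset[OF perm_group_central]) (use shuffles_in_B_group mirror_central in auto)

text \<open>The mirror commutes with the shuffles, so all its occurrences in a product can be
  collected in front.\<close>

lemma hull_mod_mirror:
  assumes M: "perm_group {0..<2 * n} M" "M \<subseteq> central n"
    and gens: "in_shuffle n \<in> M \<or> mirror n \<circ> in_shuffle n \<in> M" "out_shuffle n \<in> M \<or> mirror n \<circ> out_shuffle n \<in> M"
    and g: "g \<in> shuffle_hull n"
  shows "g \<in> M \<or> mirror n \<circ> g \<in> M"
proof -
  interpret perm_group "{0..<2 * n}" M by (rule M(1))
  have mm: "mirror n \<circ> mirror n = id" by (auto simp: mirror_mirror)
  show ?thesis
    using g unfolding shuffle_hull_def
  proof (induction rule: gen_by.induct)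
    case gen_id show ?case using id_mem by blast
  next
    case (gen_step f g)
    have "mirror n \<circ> mirror n \<in> M" unfolding mm by (rule id_mem)
    then have f: "f \<in> M \<or> mirror n \<circ> f \<in> M" using gen_step(1) gens by blast
    have fc: "f \<in> central n" using gen_step(1) shuffles_in_B_group mirror_central by auto
    have 1: "(mirror n \<circ> f) \<circ> g = mirror n \<circ> (f \<circ> g)" by auto
    have 2: "f \<circ> (mirror n \<circ> g) = mirror n \<circ> (f \<circ> g)" using central_mirror[OF fc] by auto
    have 3: "(mirror n \<circ> f) \<circ> (mirror n \<circ> g) = f \<circ> g" using central_mirror[OF fc] by (auto simp: mirror_mirror)
    show ?case using f gen_step(3) comp_mem 1 2 3 by metis
  qed
qed

lemma hull_IO: "g \<in> shuffle_hull n \<Longrightarrow> g \<in> carrier (IO_group n) \<or> mirror n \<circ> g \<in> carrier (IO_group n)"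
  by (rule hull_mod_mirror[OF perm_group_IO IO_subset_central]) (auto simp: carrier_IO intro: gen_by_incl)

lemma hull_LR: "g \<in> shuffle_hull n \<Longrightarrow> g \<in> carrier (LR_group n) \<or> mirror n \<circ> g \<in> carrier (LR_group n)"
proof (rule hull_mod_mirror[OF perm_group_LR LR_subset_central])
  interpret perm_group "{0..<2 * n}" "carrier (LR_group n)" by (rule perm_group_LR)
  have "left_shuffle n \<in> carrier (LR_group n)" "right_shuffle n \<in> carrier (LR_group n)"
    by (auto simp: carrier_LR intro: gen_by_incl)
  from inv_mem[OF this(1)] inv_mem[OF this(2)]
  show "in_shuffle n \<in> carrier (LR_group n) \<or> mirror n \<circ> in_shuffle n \<in> carrier (LR_group n)"
    "out_shuffle n \<in> carrier (LR_group n) \<or> mirror n \<circ> out_shuffle n \<in> carrier (LR_group n)"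
    unfolding shuffle_inverses(3,4) by blast+
qed

lemma IO_subset_hull: "carrier (IO_group n) \<subseteq> shuffle_hull n"
  unfolding carrier_IO
  by (rule perm_group.gen_by_subset[OF perm_group_hull]) (auto simp: shuffle_hull_def intro: gen_by_incl)

lemma LR_subset_hull: "carrier (LR_group n) \<subseteq> shuffle_hull n"
  unfolding carrier_LR
proof (rule perm_group.gen_by_subset[OF perm_group_hull])
  interpret perm_group "{0..<2 * n}" "shuffle_hull n" by (rule perm_group_hull)
  have "in_shuffle n \<in> shuffle_hull n" "out_shuffle n \<in> shuffle_hull n" "mirror n \<in> shuffle_hull n" by (auto simp: shuffle_hull_def intro: gen_by_incl)
  then show "{left_shuffle n, right_shuffle n} \<subseteq> shuffle_hull n"
    using shuffle_inverses(1,2)[of n] comp_mem inv_mem by simp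
qed

section \<open>The action on mirror pairs\<close>

text \<open>The action on the mirror pairs, read on their representatives.\<close>

definition bar :: "nat \<Rightarrow> (nat \<Rightarrow> nat) \<Rightarrow> nat \<Rightarrow> nat" where
  "bar n g x = (if x < n then fold_pos n (g x) else x)"

lemma bar_fold:
  assumes "g \<in> central n" "x < 2 * n"
  shows "bar n g (fold_pos n x) = fold_pos n (g x)"
proof (cases "x < n")
  case False
  then have "fold_pos n x = mirror n x" "mirror n x < n" using assms(2) by (simp_all add: fold_pos_def mirror_def)
  then show ?thesis
    using central_mirror[OF assms(1)] fold_mirror[OF central_less[OF assms]] by (simp add: bar_def)
qed (simp add: fold_pos_def bar_def)

lemma bar_comp: "g \<in> central n \<Longrightarrow> h \<in> central n \<Longrightarrow> bar n (g \<circ> h) = bar n g \<circ> bar n h"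
proof (rule ext)
  fix x assume gh: "g \<in> central n" "h \<in> central n"
  show "bar n (g \<circ> h) x = (bar n g \<circ> bar n h) x"
  proof (cases "x < n")
    case True
    then have "bar n h x = fold_pos n (h x)" by (simp add: bar_def)
    then show ?thesis using bar_fold[OF gh(1) central_less[OF gh(2), of x]] True by (simp add: bar_def)
  qed (simp add: bar_def)
qed

lemma bar_id: "bar n id = id" by (auto simp: fun_eq_iff bar_def fold_pos_def)
lemma bar_mirror: "bar n (mirror n) = id"
  by (auto simp: fun_eq_iff bar_def fold_pos_def mirror_def)

lemma bar_inverse:
  assumes "g \<in> central n"
  shows "bar n (inv' g) \<circ> bar n g = id" "bar n g \<circ> bar n (inv' g) = id"
proof -
  have i: "inv' g \<in> central n" using perm_group.inv_mem[OF perm_group_central assms] .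
  have b: "bij g" using central_permutes[OF assms] permutes_bij by blast
  have "inv' g \<circ> g = id" "g \<circ> inv' g = id" using b by (auto simp: bij_is_inj bij_is_surj surj_iff[symmetric])
  then show "bar n (inv' g) \<circ> bar n g = id" "bar n g \<circ> bar n (inv' g) = id"
    using bar_comp[OF assms i] bar_comp[OF i assms] bar_id by metis+
qed

lemma bar_less: "g \<in> central n \<Longrightarrow> x < n \<Longrightarrow> bar n g x < n"
  by (simp add: bar_def fold_pos_less central_less)

lemma bar_permutes:
  assumes "g \<in> central n"
  shows "bar n g permutes {..<n}"
proof (rule bij_imp_permutes)
  have i: "inv' g \<in> central n" using perm_group.inv_mem[OF perm_group_central assms] .
  show "bij_betw (bar n g) {..<n} {..<n}"
    by (rule bij_betwI[where g = "bar n (inv' g)"])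
      (use bar_inverse[OF assms] bar_less assms i in \<open>auto simp: fun_eq_iff\<close>)
qed (simp add: bar_def)

lemma bar_inv: "g \<in> central n \<Longrightarrow> bar n (inv' g) = inv' (bar n g)"
  using bar_inverse inv_unique_comp by metis

lemma bar_out: "bar n (out_shuffle n) = monge n"
  by (auto simp: fun_eq_iff bar_def monge_def fold_pos_def out_shuffle_def)

lemma bar_rev_two: "bar n (rev_blocks (2 * n) 2) = rev_blocks n 2"
proof (rule ext)
  fix x show "bar n (rev_blocks (2 * n) 2) x = rev_blocks n 2 x"
  proof (cases "x < n")
    case True then show ?thesis using rev_blocks_fold[of 2 n x] by (simp add: bar_def)
  qed (simp add: bar_def rev_blocks_def)
qed

lemma rev_two_central: "rev_blocks (2 * n) 2 \<in> central n"
  using rev_blocks_permutes[of "2 * n" 2] rev_blocks_mirror[of 2 n] rev_blocks_less[of _ "2 * n" 2]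
  by (simp add: central_iff lessThan_atLeast0 mirror_def)

lemma bar_in: "bar n (in_shuffle n) = rev_blocks n 2 \<circ> monge n"
  unfolding in_out using bar_comp[OF rev_two_central, of "out_shuffle n"] shuffles_in_B_group[of n]
  by (simp add: bar_rev_two bar_out)

text \<open>What the two shuffle groups have in common at the level of mirror pairs. Most
  arguments below use only this and the relation to the hull, and so apply to both groups at
  once.\<close>

definition covers :: "nat \<Rightarrow> (nat \<Rightarrow> nat) set \<Rightarrow> bool" where
  "covers n M \<longleftrightarrow> perm_group {0..<2 * n} M \<and> M \<subseteq> central n \<and> bar n ` M = folded_group n"

lemma bar_hull: "bar n ` shuffle_hull n \<subseteq> folded_group n"
proof
  interpret perm_group "{..<n}" "folded_group n" by (rule perm_group_folded)
  fix p assume "p \<in> bar n ` shuffle_hull n"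
  then obtain g where "p = bar n g" "g \<in> gen_by {in_shuffle n, out_shuffle n, mirror n}"
    by (auto simp: shuffle_hull_def)
  moreover have "bar n g \<in> folded_group n"
    using calculation(2)
  proof (induction rule: gen_by.induct)
    case gen_id show ?case unfolding bar_id by (rule id_mem)
  next
    case (gen_step f g)
    have "f \<in> central n" "g \<in> central n"
      using gen_step(1,2) shuffles_in_B_group mirror_central hull_subset_central by (auto simp: shuffle_hull_def)
    moreover have "bar n f \<in> folded_group n"
      using gen_step(1) bar_in bar_out bar_mirror comp_mem id_mem monge_in_folded rev_two_in_folded
      by (metis insert_iff singletonD)
    ultimately show ?case using bar_comp gen_step(3) comp_mem by metis
  qed
  ultimately show "p \<in> folded_group n" by simp
qed

lemma covers_mod_mirror:
  assumes M: "perm_group {0..<2 * n} M" "M \<subseteq> shuffle_hull n"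
    and mod: "\<And>g. g \<in> shuffle_hull n \<Longrightarrow> g \<in> M \<or> mirror n \<circ> g \<in> M"
  shows "covers n M"
proof -
  interpret perm_group "{0..<2 * n}" "shuffle_hull n" by (rule perm_group_hull)
  have cen: "M \<subseteq> central n" using M hull_subset_central by blast
  have gens: "in_shuffle n \<in> shuffle_hull n" "out_shuffle n \<in> shuffle_hull n" by (auto simp: shuffle_hull_def intro: gen_by_incl)
  have oc: "out_shuffle n \<in> central n" "in_shuffle n \<in> central n" using shuffles_in_B_group by auto
  have "p \<in> bar n ` shuffle_hull n" if "p \<in> folded_group n" for p
    using that unfolding folded_group_def
  proof (induction rule: gen_by.induct)
    case gen_id then show ?case using bar_id id_mem by (metis image_eqI)
  next
    case (gen_step f g)
    then obtain h where h: "h \<in> shuffle_hull n" "g = bar n h" by blast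
    have "inv' (out_shuffle n) \<in> central n" using inv_mem[OF gens(2)] hull_subset_central by blast
    then have "bar n (in_shuffle n \<circ> inv' (out_shuffle n)) = rev_blocks n 2 \<circ> (monge n \<circ> bar n (inv' (out_shuffle n)))"
      using bar_comp[OF oc(2)] bar_in by (simp add: o_assoc)
    then have "bar n (in_shuffle n \<circ> inv' (out_shuffle n)) = rev_blocks n 2"
      using bar_inverse(2)[OF oc(1)] bar_out by simp
    moreover have "in_shuffle n \<circ> inv' (out_shuffle n) \<in> shuffle_hull n" using comp_mem inv_mem gens by blast
    ultimately obtain k where k: "k \<in> shuffle_hull n" "f = bar n k" using gen_step(1) bar_out gens by auto
    have "k \<in> central n" "h \<in> central n" using k(1) h(1) hull_subset_central by auto
    then have "f \<circ> g = bar n (k \<circ> h)" unfolding k(2) h(2) by (rule bar_comp[symmetric])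
    moreover have "k \<circ> h \<in> shuffle_hull n" by (rule comp_mem[OF k(1) h(1)])
    ultimately show ?case by (rule image_eqI)
  qed
  moreover have "bar n g \<in> bar n ` M" if "g \<in> shuffle_hull n" for g
  proof (cases "g \<in> M")
    case False
    then have "mirror n \<circ> g \<in> M" using mod that by blast
    moreover have "bar n (mirror n \<circ> g) = bar n g"
      using bar_comp[OF mirror_central, of g] that hull_subset_central by (auto simp: bar_mirror)
    ultimately show ?thesis by (metis image_eqI)
  qed simp
  ultimately have "bar n ` M = folded_group n" using bar_hull M by blast
  then show ?thesis using M cen by (simp add: covers_def)
qed

lemma covers_hull: "covers n (shuffle_hull n)"
  by (rule covers_mod_mirror[OF perm_group_hull]) auto
lemma covers_IO: "covers n (carrier (IO_group n))"
  by (rule covers_mod_mirror[OF perm_group_IO IO_subset_hull]) (rule hull_IO)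
lemma covers_LR: "covers n (carrier (LR_group n))"
  by (rule covers_mod_mirror[OF perm_group_LR LR_subset_hull]) (rule hull_LR)

section \<open>Flips\<close>

definition flip :: "nat \<Rightarrow> nat set \<Rightarrow> nat \<Rightarrow> nat" where
  "flip n S x = (if fold_pos n x \<in> S then mirror n x else x)"

lemma fold_flip: "x < 2 * n \<Longrightarrow> fold_pos n (flip n S x) = fold_pos n x"
  by (simp add: flip_def fold_mirror)

lemma flip_outside: "\<not> x < 2 * n \<Longrightarrow> flip n S x = x" by (simp add: flip_def mirror_def)

lemma flip_flip: "flip n S \<circ> flip n T = flip n ((S - T) \<union> (T - S))"
proof (rule ext)
  fix x show "(flip n S \<circ> flip n T) x = flip n ((S - T) \<union> (T - S)) x"
  proof (cases "x < 2 * n")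
    case True
    then show ?thesis using fold_mirror[OF True] by (auto simp: flip_def mirror_mirror)
  qed (simp add: flip_outside)
qed

lemma flip_involution: "flip n S (flip n S x) = x"
  using fun_cong[OF flip_flip[of n S S], of x] by (simp add: flip_def)

lemma flip_central: "flip n S \<in> central n"
  unfolding central_iff
proof
  show "flip n S permutes {0..<2 * n}"
  proof (rule bij_imp_permutes)
    show "bij_betw (flip n S) {0..<2 * n} {0..<2 * n}"
      by (rule bij_betwI[where g = "flip n S"]) (auto simp: flip_involution, auto simp: flip_def mirror_less)
  qed (simp add: flip_outside)
  show "\<forall>x<2 * n. flip n S (mirror n x) = mirror n (flip n S x)"
    by (simp add: flip_def fold_mirror)
qed

lemma bar_flip: "bar n (flip n S) = id"
  by (auto simp: fun_eq_iff bar_def fold_flip fold_pos_id)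

text \<open>An element acting trivially on the pairs fixes or exchanges the two positions of
  each pair.\<close>

lemma flip_if_bar_id:
  assumes "g \<in> central n" "bar n g = id"
  shows "g = flip n {x. x < n \<and> g x \<noteq> x}"
proof (rule deck_ext)
  fix x assume x: "x < 2 * n"
  have "fold_pos n (g x) = fold_pos n x" using bar_fold[OF assms(1) x] assms(2) by simp
  then have "g x = x \<or> g x = mirror n x" using fold_pos_eq_mirror[OF central_less[OF assms(1) x] x] by blast
  moreover have "g (fold_pos n x) = fold_pos n x \<longleftrightarrow> g x = x"
  proof (cases "x < n")
    case False
    then have "fold_pos n x = mirror n x" using x by (simp add: fold_pos_def mirror_def)
    then show ?thesis using central_mirror[OF assms(1)] mirror_mirror by metis
  qed (simp add: fold_pos_id)
  ultimately show "g x = flip n {x. x < n \<and> g x \<noteq> x} x" 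
    using fold_pos_less[OF x] by (auto simp: flip_def)
qed (use assms flip_central central_permutes in auto)

lemma flip_conj:
  assumes "g \<in> central n" "S \<subseteq> {..<n}"
  shows "g \<circ> flip n S \<circ> inv' g = flip n (bar n g ` S)"
proof (rule deck_ext)
  have i: "inv' g \<in> central n" using perm_group.inv_mem[OF perm_group_central assms(1)] .
  have b: "bij g" using central_permutes[OF assms(1)] permutes_bij by blast
  note cm = perm_group.comp_mem[OF perm_group_central]
  show "g \<circ> flip n S \<circ> inv' g permutes {0..<2 * n}"
    using cm[OF cm[OF assms(1) flip_central] i] central_permutes by blast
  show "flip n (bar n g ` S) permutes {0..<2 * n}" using flip_central central_permutes by blast
  fix x assume x: "x < 2 * n"
  obtain y where y: "x = g y" using bij_pointE[OF b] by metis
  have y2: "y < 2 * n"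
    using permutes_in_image[OF central_permutes[OF assms(1)], of y] x y by simp
  have inj: "inj (bar n g)" using bar_permutes[OF assms(1)] permutes_inj by blast
  have "fold_pos n x \<in> bar n g ` S \<longleftrightarrow> fold_pos n y \<in> S"
    using bar_fold[OF assms(1) y2] y inj by (metis inj_image_mem_iff)
  then show "(g \<circ> flip n S \<circ> inv' g) x = flip n (bar n g ` S) x"
    using b central_mirror[OF assms(1)] by (auto simp: y flip_def bij_is_inj inv_f_f)
qed

lemma mirror_flip: "mirror n = flip n {..<n}"
  by (rule ext) (auto simp: flip_def mirror_def fold_pos_def)

lemma even_flips_from_pairs:
  assumes M: "perm_group {0..<2 * n} M"
    and pairs: "\<And>a b. a < n \<Longrightarrow> b < n \<Longrightarrow> a \<noteq> b \<Longrightarrow> flip n {a, b} \<in> M"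
    and T: "T \<subseteq> {..<n}" "even (card T)"
  shows "flip n T \<in> M"
proof -
  interpret perm_group "{0..<2 * n}" M by (rule M)
  have fin: "finite T" using T finite_subset by blast
  show ?thesis
    using fin T
  proof (induction "card T" arbitrary: T rule: less_induct)
    case less
    show ?case
    proof (cases "T = {}")
      case True
      have "flip n {} = id" by (auto simp: flip_def)
      then show ?thesis using True id_mem by simp
    next
      case False
      then obtain a where a: "a \<in> T" by blast
      have "T \<noteq> {a}" using less by auto
      then obtain b where b: "b \<in> T" "b \<noteq> a" using a by blast
      let ?U = "T - {a, b}"
      have "card ?U = card T - card {a, b}" using a b by (intro card_Diff_subset) auto
      moreover have "card {a, b} \<le> card T" using a b less(2) by (intro card_mono) auto
      moreover have "card {a, b} = 2" using b by simp
      ultimately have c: "card T = card ?U + 2" by linarith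
      have "flip n ?U \<in> M" using c less by (intro less(1)) auto
      moreover have "flip n {a, b} \<in> M" using a b less by (intro pairs) auto
      moreover have "flip n T = flip n ?U \<circ> flip n {a, b}"
        unfolding flip_flip using a b by (intro arg_cong[of _ _ "flip n"]) auto
      ultimately show ?thesis using comp_mem by simp
    qed
  qed
qed

text \<open>Where no folding occurs, \<open>monge n\<close> doubles and \<open>rev_blocks n
  2\<close> adds one to an even number, so that the binary digits of \<open>x\<close> lead from
  \<open>0\<close> to \<open>x\<close>.\<close>

lemma related_from_zero_one:
  assumes refl: "\<And>x. x < n \<Longrightarrow> Q x x" and trans: "\<And>x y z. Q x y \<Longrightarrow> Q y z \<Longrightarrow> Q x z"
    and monge: "\<And>x y. x < n \<Longrightarrow> y < n \<Longrightarrow> Q x y \<Longrightarrow> Q (monge n x) (monge n y)"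
    and rev: "\<And>x y. x < n \<Longrightarrow> y < n \<Longrightarrow> Q x y \<Longrightarrow> Q (rev_blocks n 2 x) (rev_blocks n 2 y)"
    and 01: "Q 0 1" and n: "2 \<le> n" and x: "x < n"
  shows "Q 0 x"
  using x
proof (induction x rule: less_induct)
  case (less x)
  have ev: "Q 0 (2 * y)" if "2 * y < n" "y < x \<or> y = 0" for y
  proof (cases "y = 0")
    case False
    then have "Q 0 y" using less that by auto
    then show ?thesis using monge[of 0 y] that n by (simp add: monge_def)
  qed (use refl n in auto)
  show ?case
  proof (cases "even x")
    case True
    then obtain y where "x = 2 * y" by blast
    then show ?thesis using ev[of y] less(2) by auto
  next
    case False
    then obtain y where y: "x = 2 * y + 1" using oddE by blast
    then have "Q 0 (2 * y)" using ev[of y] less(2) by auto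
    then have "Q 1 x" using rev[of 0 "2 * y"] y less(2) n by (simp add: rev_blocks_two)
    then show ?thesis using 01 trans by blast
  qed
qed

text \<open>For a group \<open>M\<close> covering the folded group this is an equivalence that
  the folded group preserves.\<close>

definition flip_linked :: "nat \<Rightarrow> (nat \<Rightarrow> nat) set \<Rightarrow> nat \<Rightarrow> nat \<Rightarrow> bool" where
  "flip_linked n M a b \<longleftrightarrow> a < n \<and> b < n \<and> (a = b \<or> flip n {a, b} \<in> M)"

lemma flip_linked_sym: "flip_linked n M a b \<Longrightarrow> flip_linked n M b a"
  by (auto simp: flip_linked_def insert_commute)

lemma flip_linked_trans:
  assumes "covers n M" "flip_linked n M x y" "flip_linked n M y z"
  shows "flip_linked n M x z"
proof -
  interpret perm_group "{0..<2 * n}" M using assms by (simp add: covers_def)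
  show ?thesis
  proof (cases "x = y \<or> y = z \<or> x = z")
    case False
    then have "flip n {x, y} \<circ> flip n {y, z} = flip n {x, z}"
      unfolding flip_flip by (intro arg_cong[of _ _ "flip n"]) auto
    then show ?thesis using assms False comp_mem unfolding flip_linked_def by metis
  qed (use assms in \<open>auto simp: flip_linked_def\<close>)
qed

lemma flip_linked_act:
  assumes cov: "covers n M" and p: "p \<in> folded_group n" and ab: "flip_linked n M a b"
  shows "flip_linked n M (p a) (p b)"
proof -
  interpret perm_group "{0..<2 * n}" M using cov by (simp add: covers_def)
  obtain g where g: "g \<in> M" "p = bar n g" using p cov by (auto simp: covers_def)
  have gc: "g \<in> central n" using g cov by (auto simp: covers_def)
  have "flip n {p a, p b} \<in> M" if "a \<noteq> b"
    using flip_conj[OF gc, of "{a, b}"] conj_mem[OF g(1), of "flip n {a, b}"] ab that g by (auto simp: flip_linked_def)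
  then show ?thesis using ab bar_less[OF gc] g by (auto simp: flip_linked_def)
qed

lemma even_flips_from_zero_one:
  assumes cov: "covers n M" and f: "flip_linked n M 0 1" and T: "T \<subseteq> {..<n}" "even (card T)"
  shows "flip n T \<in> M"
proof (rule even_flips_from_pairs[OF _ _ T])
  show "perm_group {0..<2 * n} M" using cov by (simp add: covers_def)
  have Q0: "flip_linked n M 0 x" if "x < n" for x
  proof (rule related_from_zero_one[of n "flip_linked n M"])
    show "2 \<le> n" using f by (simp add: flip_linked_def)
    show "flip_linked n M x x" if "x < n" for x using that by (simp add: flip_linked_def)
  qed (use that f flip_linked_trans[OF cov] flip_linked_act[OF cov monge_in_folded]
      flip_linked_act[OF cov rev_two_in_folded] in auto)
  fix a b assume ab: "a < n" "b < n" "a \<noteq> b"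
  have "flip_linked n M a b" using flip_linked_trans[OF cov flip_linked_sym[OF Q0] Q0] ab by blast
  then show "flip n {a, b} \<in> M" using ab by (simp add: flip_linked_def)
qed

text \<open>A three-cycle that replaces one element of \<open>S\<close> by one outside gives a
  second flip in \<open>M\<close>, and the two compose to the flip of two pairs. Three-cycles
  move these two pairs to any two others.\<close>

lemma three_cycle_flips:
  assumes M: "perm_group {0..<2 * n} M" "M \<subseteq> central n" and alt: "contains_alternating {..<n} (bar n ` M)"
    and S: "S \<subseteq> {..<n}" "S \<noteq> {}" "S \<noteq> {..<n}" "flip n S \<in> M" and n: "3 \<le> n"
    and T: "T \<subseteq> {..<n}" "even (card T)"
  shows "flip n T \<in> M"
proof -
  interpret perm_group "{0..<2 * n}" M by (rule M)
  have conj: "flip n (three_cycle a b c ` U) \<in> M"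
    if "flip n U \<in> M" "U \<subseteq> {..<n}" "a < n" "b < n" "c < n" "distinct [a, b, c]" for a b c U
  proof -
    obtain g where g: "g \<in> M" "bar n g = three_cycle a b c"
    proof -
      have "three_cycle a b c \<in> bar n ` M"
        using alt \<open>a < n\<close> \<open>b < n\<close> \<open>c < n\<close> \<open>distinct [a, b, c]\<close> unfolding contains_alternating_def by blast
      then show ?thesis using that by auto
    qed
    then show ?thesis using flip_conj[of g n U] M that conj_mem[OF g(1) that(1)] by auto
  qed
  have third: "\<exists>c<n. c \<noteq> a \<and> c \<noteq> b" for a b
  proof -
    have "card {a, b} < n" using n by (cases "a = b") auto
    then show ?thesis using obtain_outside[of "{a, b}" n] by auto
  qed
  obtain a b where a: "a \<in> S" and b: "b < n" "b \<notin> S" using S by blast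
  have an: "a < n" using a S by blast
  obtain c where c: "c < n" "c \<noteq> a" "c \<noteq> b" using third by blast
  have d: "distinct [a, b, c]" using a b c by auto
  have inj: "inj (three_cycle a b c)" using three_cycle_permutes[of a UNIV b c] permutes_inj by blast
  have im: "y \<in> three_cycle a b c ` S \<longleftrightarrow> three_cycle a c b y \<in> S" for y
  proof -
    have dd: "distinct [a, c, b]" using d by auto
    have "three_cycle a b c (three_cycle a c b y) = y"
      using d dd by (auto simp: three_cycle_apply)
    then show ?thesis using inj by (metis inj_image_mem_iff)
  qed
  obtain u v where uv: "u < n" "v < n" "u \<noteq> v" "flip n {u, v} \<in> M"
  proof -
    let ?S' = "three_cycle a b c ` S"
    have m: "flip n ((S - ?S') \<union> (?S' - S)) \<in> M"
      using comp_mem[OF S(4) conj[OF S(4,1) an b(1) c(1) d]] flip_flip by metis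
    have dd: "distinct [a, c, b]" using d by auto
    show ?thesis
    proof (cases "c \<in> S")
      case True
      have "(S - ?S') \<union> (?S' - S) = {c, b}"
        unfolding set_eq_iff Un_iff Diff_iff im using a b c True by (auto simp: three_cycle_apply[OF dd])
      then show ?thesis using that[of c b] m b c by simp
    next
      case False
      have "(S - ?S') \<union> (?S' - S) = {a, b}"
        unfolding set_eq_iff Un_iff Diff_iff im using a b c False by (auto simp: three_cycle_apply[OF dd])
      then show ?thesis using that[of a b] m a b an by auto
    qed
  qed
  have move: "flip n {y, z} \<in> M" if "flip n {x, y} \<in> M" "x < n" "y < n" "z < n" "x \<noteq> y" "z \<noteq> x" "z \<noteq> y" for x y z
  proof -
    have "distinct [x, y, z]" using that by auto
    then have "three_cycle x y z ` {x, y} = {y, z}" by (auto simp: three_cycle_apply)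
    then show ?thesis using conj[OF that(1), of x y z] that by auto
  qed
  show ?thesis
  proof (rule even_flips_from_pairs[OF M(1) _ T])
    fix x y assume xy: "x < n" "y < n" "x \<noteq> y"
    have ux: "flip n {u, x} \<in> M \<or> x = u" if "x < n" for x
      using move[of v u x] uv that by (metis insert_commute)
    show "flip n {x, y} \<in> M"
    proof (cases "x = u \<or> y = u")
      case True
      then show ?thesis using ux xy by (metis insert_commute)
    next
      case False
      then show ?thesis using move[of u x y] ux[of x] uv xy by metis
    qed
  qed
qed

section \<open>All flips of an even number of pairs\<close>

lemma covers_perm_group: "covers n M \<Longrightarrow> perm_group {0..<2 * n} M"
  and covers_central: "covers n M \<Longrightarrow> g \<in> M \<Longrightarrow> g \<in> central n"
  by (auto simp: covers_def)

text \<open>A lift of the inverse three-cycle fixes or exchanges the two positions of each other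
  pair; its square fixes them.\<close>

lemma pointwise_lift:
  assumes cov: "covers n M" and alt: "contains_alternating {..<n} (folded_group n)"
    and abc: "a < n" "b < n" "c < n" "distinct [a, b, c]"
  obtains k where "k \<in> M" "bar n k = three_cycle a b c"
    "\<And>y. y < 2 * n \<Longrightarrow> fold_pos n y \<notin> {a, b, c} \<Longrightarrow> k y = y"
proof -
  interpret perm_group "{0..<2 * n}" M by (rule covers_perm_group[OF cov])
  have d: "distinct [a, c, b]" using abc by auto
  have "three_cycle a c b \<in> bar n ` M"
    using cov alt abc d unfolding covers_def contains_alternating_def by auto
  then obtain g where g: "g \<in> M" "bar n g = three_cycle a c b" by auto
  have gc: "g \<in> central n" using g cov covers_central by blast
  show ?thesis
  proof
    show "g \<circ> g \<in> M" by (rule comp_mem[OF g(1) g(1)])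
    show "bar n (g \<circ> g) = three_cycle a b c"
      unfolding bar_comp[OF gc gc] g(2) by (rule three_cycle_square[OF d])
    fix y assume y: "y < 2 * n" "fold_pos n y \<notin> {a, b, c}"
    then have "fold_pos n (g y) = fold_pos n y"
      using bar_fold[OF gc y(1)] g(2) d by (simp add: three_cycle_apply)
    then have "g y = y \<or> g y = mirror n y" using fold_pos_eq_mirror central_less[OF gc] y by blast
    then show "(g \<circ> g) y = y" using central_mirror[OF gc] mirror_mirror by (metis comp_apply)
  qed
qed

text \<open>The product fixes \<open>a\<close>; it is a three-cycle on \<open>b\<close>,
  \<open>c\<close>, \<open>d\<close>, or the identity when \<open>c = d\<close>.\<close>

lemma three_cycle_pair_cube:
  assumes "distinct [a, b, c]" "distinct [a, d, b]"
  shows "(three_cycle a d b \<circ> three_cycle a b c) \<circ> (three_cycle a d b \<circ> three_cycle a b c) \<circ>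
    (three_cycle a d b \<circ> three_cycle a b c) = id"
proof (cases "c = d")
  case True
  then have "three_cycle a d b \<circ> three_cycle a b c = id"
    using assms by (auto simp: fun_eq_iff three_cycle_apply)
  then show ?thesis by simp
next
  case False
  then have d: "distinct [b, c, d]" "distinct [b, d, c]" using assms by auto
  have "three_cycle a d b \<circ> three_cycle a b c = three_cycle b c d"
    using assms False by (auto simp: fun_eq_iff three_cycle_apply)
  moreover have "three_cycle b d c \<circ> three_cycle b c d = id"
    using d by (auto simp: fun_eq_iff three_cycle_apply)
  ultimately show ?thesis using three_cycle_square[OF d(1)] by simp
qed

text \<open>Let \<open>k\<close> lift a three-cycle on the pairs of \<open>x\<close>, of
  \<open>c\<close> and of a further position \<open>y\<close>. The commutator \<open>q\<close>
  of \<open>g\<close> with the inverse of \<open>k\<close> still exchanges the two positions of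
  the pair of \<open>x\<close>, it fixes all positions outside four pairs, and the third power
  of its action on the pairs is trivial. So the cube of \<open>q\<close> is a flip of between
  one and four pairs.\<close>

lemma crossing_gives_flip:
  assumes cov: "covers n M" and alt: "contains_alternating {..<n} (folded_group n)" and n: "5 \<le> n"
    and g: "g \<in> M" and c: "c < 2 * n" "g c = c" and x: "x < 2 * n" "g x = mirror n x"
  obtains S where "S \<subseteq> {..<n}" "S \<noteq> {}" "S \<noteq> {..<n}" "flip n S \<in> M"
proof -
  interpret perm_group "{0..<2 * n}" M by (rule covers_perm_group[OF cov])
  have gc: "g \<in> central n" using g cov covers_central by blast
  let ?X = "fold_pos n x" and ?C = "fold_pos n c"
  have XC: "?X \<noteq> ?C" "?X < n" "?C < n"
  proof -
    show "?X \<noteq> ?C"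
    proof
      assume "?X = ?C"
      then have "x = c \<or> x = mirror n c" using fold_pos_eq_mirror x c by blast
      then have "g x = x" using c(2) central_mirror[OF gc] by metis
      then show False using x mirror_neq by metis
    qed
  qed (use x c fold_pos_less in auto)
  have "card {?X, ?C} < n" using n by (cases "?X = ?C") auto
  then obtain y where y: "y < n" "y \<notin> {?X, ?C}" using obtain_outside[of "{?X, ?C}"] by blast
  have d: "distinct [?X, ?C, y]" using XC y by auto
  obtain k where k: "k \<in> M" "bar n k = three_cycle ?X ?C y"
    "\<And>u. u < 2 * n \<Longrightarrow> fold_pos n u \<notin> {?X, ?C, y} \<Longrightarrow> k u = u"
    using pointwise_lift[OF cov alt XC(2,3) y(1) d] by metis
  have kc: "k \<in> central n" using k cov covers_central by blast
  have ik: "inv' k \<in> M" "inv' g \<in> M" using inv_mem k g by auto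
  have ic: "inv' k \<in> central n" "inv' g \<in> central n" using ik cov covers_central by blast+
  have bij: "bij k" "bij g" using bij_mem k g by auto
  have cancel: "inv' k (k u) = u" "inv' g (g u) = u" "g (inv' g u) = u" "k (inv' k u) = u" for u
    using bij by (simp_all add: bij_is_inj bij_is_surj surj_f_inv_f)
  \<comment> \<open>Outside the pairs of \<open>x\<close>, \<open>c\<close>, \<open>y\<close>
    and of the image of \<open>y\<close> the commutator acts trivially.\<close>
  define W where "W = bar n g y"
  have gX: "bar n g ?X = ?X" using bar_fold[OF gc x(1)] x fold_mirror by simp
  have gC: "bar n g ?C = ?C" using bar_fold[OF gc c(1)] c by simp
  have injg: "bar n g u = bar n g v \<longleftrightarrow> u = v" for u v
    using permutes_inj[OF bar_permutes[OF gc]] by (auto dest: injD)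
  have W: "W < n" "W \<noteq> ?X" "W \<noteq> ?C" using bar_less[OF gc y(1)] gX gC injg y by (auto simp: W_def) metis+
  have dW: "distinct [?X, W, ?C]" using W XC by auto
  have dy: "distinct [?X, y, ?C]" using d by auto
  define q where "q = g \<circ> inv' k \<circ> inv' g \<circ> k"
  have qM: "q \<in> M" unfolding q_def by (intro comp_mem g ik k)
  have qc: "q \<in> central n" using qM cov covers_central by blast
  have qx: "q x = mirror n x"
  proof -
    have "fold_pos n (k x) = ?C" using bar_fold[OF kc x(1)] k(2) d by (simp add: three_cycle_apply)
    then have "k x = c \<or> k x = mirror n c" using fold_pos_eq_mirror central_less[OF kc] x c by blast
    then have "g (k x) = k x" using c(2) central_mirror[OF gc] by metis
    then have "inv' g (k x) = k x" using cancel by metis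
    then show ?thesis using x(2) by (simp add: q_def cancel)
  qed
  have bq: "bar n q = three_cycle ?X W ?C \<circ> three_cycle ?X ?C y"
  proof -
    have "three_cycle ?X y ?C \<circ> three_cycle ?X ?C y = id"
      using d dy by (auto simp: fun_eq_iff three_cycle_apply)
    moreover have "three_cycle ?X ?C y \<circ> three_cycle ?X y ?C = id"
      using d dy by (auto simp: fun_eq_iff three_cycle_apply)
    ultimately have "inv' (three_cycle ?X ?C y) = three_cycle ?X y ?C" by (metis inv_unique_comp)
    then have bik: "bar n (inv' k) = three_cycle ?X y ?C" using bar_inv[OF kc] k(2) by simp
    note cm = perm_group.comp_mem[OF perm_group_central]
    have "bar n q = bar n g \<circ> bar n (inv' k) \<circ> inv' (bar n g) \<circ> bar n k"
      unfolding q_def using bar_comp[OF cm[OF cm[OF gc ic(1)] ic(2)] kc] bar_comp[OF cm[OF gc ic(1)] ic(2)]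
        bar_comp[OF gc ic(1)] bar_inv[OF gc] by simp
    moreover have "bar n g \<circ> three_cycle ?X y ?C \<circ> inv' (bar n g) = three_cycle ?X W ?C"
      using three_cycle_conj[OF permutes_bij[OF bar_permutes[OF gc]] dy] gX gC W_def by simp
    ultimately show ?thesis using k(2) bik by simp
  qed
  have qfix: "q u = u" if u: "u < 2 * n" "fold_pos n u \<notin> {?X, ?C, y, W}" for u
  proof -
    have ku: "k u = u" using k(3) u by simp
    let ?z = "inv' g u"
    have z: "?z < 2 * n" using central_less[OF ic(2)] u by simp
    have "bar n g (fold_pos n ?z) = fold_pos n u" using bar_fold[OF gc z] cancel by simp
    then have "fold_pos n ?z \<notin> {?X, ?C, y}" using u gX gC W_def by auto
    then have "k ?z = ?z" using k(3) z by simp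
    then have "inv' k ?z = ?z" using cancel by metis
    then show ?thesis using ku cancel by (simp add: q_def)
  qed
  define S where "S = {u. u < n \<and> (q \<circ> q \<circ> q) u \<noteq> u}"
  have q3M: "q \<circ> q \<circ> q \<in> M" by (intro comp_mem qM)
  have q3c: "q \<circ> q \<circ> q \<in> central n" using q3M cov covers_central by blast
  have "bar n (q \<circ> q \<circ> q) = bar n q \<circ> bar n q \<circ> bar n q"
    using bar_comp qc perm_group.comp_mem[OF perm_group_central] by metis
  also have "\<dots> = id"
    unfolding bq by (rule three_cycle_pair_cube[OF d dW])
  finally have fl: "q \<circ> q \<circ> q = flip n S" unfolding S_def by (rule flip_if_bar_id[OF q3c])
  have "(q \<circ> q \<circ> q) x = mirror n x" using qx central_mirror[OF qc] mirror_mirror by simp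
  then have "?X \<in> S" using fl mirror_neq[OF x(1)] by (metis flip_def)
  moreover have sub: "S \<subseteq> {?X, ?C, y, W}"
  proof
    fix u assume u: "u \<in> S"
    show "u \<in> {?X, ?C, y, W}"
    proof (rule ccontr)
      assume "u \<notin> {?X, ?C, y, W}"
      then have "q u = u" using qfix[of u] u by (simp add: S_def fold_pos_id)
      then show False using u by (simp add: S_def)
    qed
  qed
  have "card S \<le> card {?X, ?C, y, W}" by (intro card_mono sub) simp
  then have "card S \<le> 4" using card_length[of "[?X, ?C, y, W]"] by simp
  then have "S \<noteq> {..<n}" using n by auto
  moreover have "S \<subseteq> {..<n}" by (auto simp: S_def)
  moreover have "flip n S \<in> M" using q3M fl by simp
  ultimately show ?thesis using that by blast
qed

definition crossing :: "nat \<Rightarrow> (nat \<Rightarrow> nat) \<Rightarrow> bool" where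
  "crossing n g \<longleftrightarrow> (\<exists>c<2 * n. \<exists>x<2 * n. g c = c \<and> g x = mirror n x)"

lemma crossing_mirror: "crossing n g \<Longrightarrow> crossing n (mirror n \<circ> g)"
  unfolding crossing_def using mirror_mirror by (metis comp_apply)

text \<open>Call \<open>x\<close> selected if some \<open>h\<close> takes \<open>0\<close> to
  \<open>x\<close> and moves no position outside the pairs of \<open>0\<close> and
  \<open>x\<close> and one further pair. If \<open>x\<close> and its mirror image were both
  selected, by \<open>h\<close> and \<open>k\<close> say, then both would fix some position in
  the remaining pairs, and \<open>k\<close> times the inverse of \<open>h\<close> would be a
  crossing. Hence exactly one position of each pair is selected. In the same way, comparing a
  selecting element of \<open>g x\<close> with the conjugate of one of \<open>x\<close> by
  \<open>g\<close> shows that \<open>g\<close> preserves the selection or complements it,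
  according to whether \<open>g 0\<close> is selected. With at least seven pairs there is always
  a position that all elements involved fix.\<close>

lemma invariant_section:
  assumes alt: "contains_alternating {..<n} (folded_group n)" and n: "7 \<le> n"
    and no: "\<And>g. g \<in> shuffle_hull n \<Longrightarrow> \<not> crossing n g"
  obtains F where "F (0::nat)" "\<And>x. x < 2 * n \<Longrightarrow> F (mirror n x) \<longleftrightarrow> \<not> F x"
    "\<And>g x. g \<in> shuffle_hull n \<Longrightarrow> x < 2 * n \<Longrightarrow> F (g x) \<longleftrightarrow> (F x \<longleftrightarrow> F (g 0))"
proof -
  let ?G = "shuffle_hull n"
  interpret perm_group "{0..<2 * n}" ?G by (rule perm_group_hull)
  have cen: "g \<in> ?G \<Longrightarrow> g \<in> central n" for g using hull_subset_central by blast
  define P where "P h x z \<longleftrightarrow> h \<in> ?G \<and> z < n \<and> h 0 = x \<and>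
    (\<forall>y<2 * n. fold_pos n y \<notin> {0, fold_pos n x, z} \<longrightarrow> h y = y)" for h x z
  define F where "F x \<longleftrightarrow> (\<exists>h z. P h x z)" for x
  have f0: "fold_pos n 0 = 0" using n by (simp add: fold_pos_def)
  have F0: "F 0" unfolding F_def P_def using id_mem n f0 by (intro exI[of _ id] exI[of _ 0]) auto
  have mem_mirror: "mirror n \<in> ?G" unfolding shuffle_hull_def by (rule gen_by_incl) simp
  have total: "F x \<or> F (mirror n x)" if x: "x < 2 * n" for x
  proof (cases "fold_pos n x = 0")
    case True
    then have "x = 0 \<or> x = mirror n 0" using fold_pos_eq_mirror[OF x, of 0] f0 n by simp
    then show ?thesis using F0 mirror_mirror by metis
  next
    case False
    have "card {0, fold_pos n x} < n" using n by (auto simp: card_insert_if)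
    then obtain z where z: "z < n" "z \<notin> {0, fold_pos n x}" using obtain_outside[of "{0, fold_pos n x}"] by blast
    have d: "distinct [0, fold_pos n x, z]" using z False by auto
    have "0 < n" using n by simp
    from pointwise_lift[OF covers_hull alt this fold_pos_less[OF x] z(1) d]
    obtain k where k: "k \<in> ?G" "bar n k = three_cycle 0 (fold_pos n x) z"
      "\<And>y. y < 2 * n \<Longrightarrow> fold_pos n y \<notin> {0, fold_pos n x, z} \<Longrightarrow> k y = y" by metis
    have z2: "0 < 2 * n" using n by simp
    have "fold_pos n (k 0) = fold_pos n x"
      using bar_fold[OF cen[OF k(1)] z2] k(2) d f0 by (simp add: three_cycle_apply)
    then have "k 0 = x \<or> k 0 = mirror n x"
      using fold_pos_eq_mirror[OF central_less[OF cen[OF k(1)] z2] x] by blast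
    moreover have "P k (k 0) z" unfolding P_def using k z(1) \<open>fold_pos n (k 0) = fold_pos n x\<close> by auto
    ultimately show ?thesis unfolding F_def by metis
  qed
  \<comment> \<open>Two elements that agree at one position and take another one to mirror
    images compose to a crossing.\<close>
  have clash: False if "h \<in> ?G" "k \<in> ?G" "w < 2 * n" "h u = w" "k u = mirror n w" "c < n" "h c = c" "k c = c" for h k u w c
  proof -
    have m: "k \<circ> inv' h \<in> ?G" using that comp_mem inv_mem by blast
    have "bij h" using that bij_mem by blast
    then have "inv' h w = u" "inv' h c = c" using that by (metis bij_inv_eq_iff)+
    then have "crossing n (k \<circ> inv' h)"
      unfolding crossing_def using that by (intro exI[of _ c] exI[of _ w] conjI) auto
    then show False using no m by blast
  qed
  have excl: "\<not> F (mirror n x)" if x: "x < 2 * n" "F x" for x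
  proof
    assume "F (mirror n x)"
    then obtain h z k w where hk: "P h x z" "P k (mirror n x) w" using x by (auto simp: F_def)
    have "card {0, fold_pos n x, z, w} < n" using n card_length[of "[0, fold_pos n x, z, w]"] by simp
    then obtain c where c: "c < n" "c \<notin> {0, fold_pos n x, z, w}"
      using obtain_outside[of "{0, fold_pos n x, z, w}"] by blast
    have "h c = c" "k c = c" using hk c fold_mirror[OF x(1)] by (auto simp: P_def fold_pos_id)
    then show False using clash[of h k x 0 c] hk x c by (auto simp: P_def)
  qed
  \<comment> \<open>If the mirror image of \<open>g x\<close> were selected instead, by
    \<open>h3\<close>, then \<open>h3\<close> would clash with the product of the conjugate of
    \<open>h\<close> by \<open>g\<close> and \<open>h2\<close>.\<close>
  have main: "F (g x)" if g: "g \<in> ?G" and x: "x < 2 * n" "F x" and g0: "F (g 0)" for g x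
  proof (rule ccontr)
    assume "\<not> F (g x)"
    note gc = cen[OF g]
    have gx: "g x < 2 * n" using central_less[OF gc x(1)] .
    then have "F (mirror n (g x))" using total \<open>\<not> F (g x)\<close> by blast
    then obtain h z h2 z2 h3 z3 where h: "P h x z" and h2: "P h2 (g 0) z2" and h3: "P h3 (mirror n (g x)) z3"
      using x g0 by (auto simp: F_def)
    let ?U = "{0, fold_pos n (g 0), fold_pos n (g x), z2, z3, bar n g z}"
    have "card ?U \<le> 6"
      using card_length[of "[0, fold_pos n (g 0), fold_pos n (g x), z2, z3, bar n g z]"] by simp
    then have "card ?U < n" using n by linarith
    then obtain c where c: "c < n" "c \<notin> ?U" using obtain_outside[of ?U] by blast
    have c2: "c < 2 * n" using c by simp
    let ?k = "g \<circ> h \<circ> inv' g"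
    have hG: "h \<in> ?G" "h2 \<in> ?G" "h3 \<in> ?G" using h h2 h3 by (auto simp: P_def)
    have kG: "?k \<in> ?G" by (rule conj_mem[OF g hG(1)])
    have bij: "bij g" using bij_mem g by blast
    have cancel: "inv' g (g u) = u" "g (inv' g u) = u" for u
      using bij by (simp_all add: bij_is_inj bij_is_surj surj_f_inv_f)
    have fc: "fold_pos n c = c" using c by (simp add: fold_pos_id)
    have h2c: "h2 c = c" using h2 c c2 fc by (auto simp: P_def)
    have h3c: "h3 c = c" using h3 c c2 fc fold_mirror[OF gx] by (auto simp: P_def)
    have ic: "inv' g \<in> central n" using cen inv_mem g by blast
    have z2: "0 < 2 * n" using n by simp
    have dl: "inv' g c < 2 * n" using central_less[OF ic c2] .
    have "bar n g (fold_pos n (inv' g c)) = c" using bar_fold[OF gc dl] cancel fc by simp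
    moreover have "bar n g 0 = fold_pos n (g 0)" using bar_fold[OF gc z2] f0 by simp
    moreover have "bar n g (fold_pos n x) = fold_pos n (g x)" using bar_fold[OF gc x(1)] .
    ultimately have "fold_pos n (inv' g c) \<notin> {0, fold_pos n x, z}"
      using c(2) by (metis insert_iff singletonD)
    then have "h (inv' g c) = inv' g c" using h dl by (auto simp: P_def)
    then have kc: "?k c = c" using cancel by simp
    show False
    proof (rule clash[of "?k \<circ> h2" h3 "g x" 0 c])
      show "(?k \<circ> h2) 0 = g x" using h h2 cancel by (simp add: P_def)
      show "?k \<circ> h2 \<in> ?G" by (rule comp_mem[OF kG hG(2)])
      show "(?k \<circ> h2) c = c" using h2c kc by simp
    qed (use hG h3 h3c c gx in \<open>auto simp: P_def\<close>)
  qed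
  show ?thesis
  proof
    show "F 0" by (rule F0)
    show Fm: "F (mirror n x) \<longleftrightarrow> \<not> F x" if "x < 2 * n" for x using total excl that by blast
    fix g x assume g: "g \<in> ?G" and x: "x < 2 * n"
    note gc = cen[OF g]
    have gx: "g x < 2 * n" "g 0 < 2 * n" using central_less[OF gc] x by auto
    have mg: "mirror n \<circ> g \<in> ?G" by (rule comp_mem[OF mem_mirror g])
    show "F (g x) \<longleftrightarrow> (F x \<longleftrightarrow> F (g 0))"
    proof (cases "F (g 0)")
      case True
      then show ?thesis
        using main[OF g x] main[OF g mirror_less[OF x]] Fm x gx central_mirror[OF gc] by metis
    next
      case False
      then have "F ((mirror n \<circ> g) 0)" using Fm gx by simp
      from main[OF mg x _ this] main[OF mg mirror_less[OF x] _ this]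
      show ?thesis using False Fm x gx central_mirror[OF gc] mirror_mirror by (metis comp_apply)
    qed
  qed
qed

text \<open>The first halves of the in and out shuffles double a number and append a binary
  digit, so \<open>F x\<close> depends on the digits of \<open>x\<close> only. If \<open>F
  1\<close> holds, everything is selected. Otherwise a number is selected if and only if it has
  an even number of binary ones, and the second half of the out shuffle says that
  \<open>y\<close> and \<open>n + y\<close> differ in selection for all \<open>y < n\<close>.
  Let \<open>2^h\<close> be the leading digit of \<open>n\<close>, which is less than
  \<open>n\<close>. Adding \<open>2^h\<close> to \<open>n\<close> only shifts this digit, so
  \<open>n\<close> and \<open>n + 2^h\<close> agree in selection, although \<open>0\<close> and
  \<open>2^h\<close> do not.\<close>

lemma no_invariant_section:
  assumes n: "1 \<le> n" "\<nexists>k. n = 2 ^ k" and F0: "F (0::nat)"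
    and Fm: "\<And>x. x < 2 * n \<Longrightarrow> F (mirror n x) \<longleftrightarrow> \<not> F x"
    and Fo: "\<And>x. x < 2 * n \<Longrightarrow> F (out_shuffle n x) \<longleftrightarrow> F x"
    and Fi: "\<And>x. x < 2 * n \<Longrightarrow> F (in_shuffle n x) \<longleftrightarrow> (F x \<longleftrightarrow> F 1)"
  shows False
proof -
  have ev: "F (2 * x) \<longleftrightarrow> F x" if "x < n" for x using Fo[of x] that out_shuffle_simps(1)[of x n] by simp
  have od: "F (2 * x + 1) \<longleftrightarrow> (F x \<longleftrightarrow> F 1)" if "x < n" for x using Fi[of x] that in_shuffle_simps(1)[of x n] by simp
  have up: "F (n + y) \<longleftrightarrow> (F y \<longleftrightarrow> F 1)" if "y < n" for y
    using Fo[of "n + y"] od[OF that] that out_shuffle_simps(2)[of y n] by simp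
  have F1: "\<not> F 1"
  proof
    assume F1: "F 1"
    have "F x" if "x < 2 * n" for x
      using that
    proof (induction x rule: less_induct)
      case (less x)
      show ?case
      proof (cases "x = 0")
        case False
        show ?thesis
        proof (cases "even x")
          case True
          then obtain y where "x = 2 * y" by blast
          then show ?thesis using less False ev[of y] by auto
        next
          case odd: False
          then obtain y where "x = 2 * y + 1" using oddE by blast
          then show ?thesis using less od[of y] F1 by auto
        qed
      qed (use F0 in simp)
    qed
    then show False using Fm[of 0] F0 mirror_less[of 0 n] n by auto
  qed
  \<comment> \<open>Deleting the leading digit changes the parity of the number of
    ones.\<close>
  have digit: "F (2 ^ h + j) \<longleftrightarrow> \<not> F j" if "j < 2 ^ h" "2 ^ h + j < 2 * n" for h j
    using that
  proof (induction h arbitrary: j)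
    case 0 then show ?case using F0 F1 by simp
  next
    case (Suc h)
    define i where "i = j div 2"
    have i: "i < 2 ^ h" "2 ^ h + i < n" "j = 2 * i \<or> j = 2 * i + 1" using Suc(2,3) by (auto simp: i_def)
    then have IH: "F (2 ^ h + i) \<longleftrightarrow> \<not> F i" using Suc(1)[of i] by simp
    have "i < n" using i by simp
    from i(3) show ?case
    proof
      assume "j = 2 * i"
      then show ?thesis using ev[OF i(2)] ev[OF \<open>i < n\<close>] IH by simp
    next
      assume "j = 2 * i + 1"
      then show ?thesis using od[OF i(2)] od[OF \<open>i < n\<close>] IH F1 by simp
    qed
  qed
  obtain h where h: "2 ^ h \<le> n" "n < 2 ^ (h + 1)"
    using ex_power_ivl1[of 2 n] n by auto
  define j where "j = n - 2 ^ h"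
  have "n \<noteq> 2 ^ h" using n by blast
  then have nj: "n = 2 ^ h + j" "j < 2 ^ h" "2 ^ h < n" using h by (auto simp: j_def)
  have a: "F n \<longleftrightarrow> \<not> F j" using digit[of j h] nj by simp
  have "n + 2 ^ h = 2 ^ (h + 1) + j" using nj by simp
  moreover have "F (2 ^ (h + 1) + j) \<longleftrightarrow> \<not> F j" using digit[of j "h + 1"] nj by simp
  ultimately have b: "F (n + 2 ^ h) \<longleftrightarrow> \<not> F j" by metis
  have c: "\<not> F (2 ^ h)" using digit[of 0 h] nj F0 by simp
  have "\<not> F n" using up[of 0] F0 F1 n by simp
  moreover have "F (n + 2 ^ h)" using up[OF nj(3)] c F1 by simp
  ultimately show False using a b by simp
qed

text \<open>The general argument needs seven pairs; for \<open>n = 5\<close> the out shuffle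
  itself is a crossing.\<close>

lemma crossing_exists:
  assumes alt: "contains_alternating {..<n} (folded_group n)" and n: "5 \<le> n" "n \<noteq> 6" "\<nexists>k. n = 2 ^ k"
  shows "\<exists>g\<in>shuffle_hull n. crossing n g"
proof (cases "n = 5")
  case True
  have "out_shuffle n \<in> shuffle_hull n" by (auto simp: shuffle_hull_def intro: gen_by_incl)
  moreover have "out_shuffle 5 0 = 0" "out_shuffle 5 3 = mirror 5 3"
    by (simp_all add: out_shuffle_def mirror_def)
  then have "crossing n (out_shuffle n)" unfolding True crossing_def by (intro exI[of _ 0] exI[of _ 3] conjI) simp_all
  ultimately show ?thesis by blast
next
  case False
  show ?thesis
  proof (rule ccontr)
    assume "\<not> (\<exists>g\<in>shuffle_hull n. crossing n g)"
    then have no: "\<And>g. g \<in> shuffle_hull n \<Longrightarrow> \<not> crossing n g" by blast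
    have "7 \<le> n" using n False by simp
    from invariant_section[OF alt this no] obtain F where F: "F (0::nat)"
      "\<And>x. x < 2 * n \<Longrightarrow> F (mirror n x) \<longleftrightarrow> \<not> F x"
      "\<And>g x. g \<in> shuffle_hull n \<Longrightarrow> x < 2 * n \<Longrightarrow> F (g x) \<longleftrightarrow> (F x \<longleftrightarrow> F (g 0))" by metis
    have mem: "out_shuffle n \<in> shuffle_hull n" "in_shuffle n \<in> shuffle_hull n"
      by (auto simp: shuffle_hull_def intro: gen_by_incl)
    have "out_shuffle n 0 = 0" "in_shuffle n 0 = 1" using n by (simp_all add: out_shuffle_def in_shuffle_def)
    then show False
      using no_invariant_section[of n F] n F(1,2) F(3)[OF mem(1)] F(3)[OF mem(2)] by simp
  qed
qed

theorem even_flips_mem: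
  assumes cov: "covers n M" and mod: "\<And>g. g \<in> shuffle_hull n \<Longrightarrow> g \<in> M \<or> mirror n \<circ> g \<in> M"
    and n: "5 \<le> n" "n \<noteq> 6" "n \<noteq> 12" "\<nexists>k. n = 2 ^ k"
    and T: "T \<subseteq> {..<n}" "even (card T)"
  shows "flip n T \<in> M"
proof -
  have alt: "contains_alternating {..<n} (folded_group n)" using folded_contains_alternating n by simp
  obtain g where "g \<in> shuffle_hull n" "crossing n g" using crossing_exists[OF alt] n by auto
  then obtain g where g: "g \<in> M" "crossing n g" using mod crossing_mirror by blast
  then obtain c x where cx: "c < 2 * n" "x < 2 * n" "g c = c" "g x = mirror n x" by (auto simp: crossing_def)
  obtain S where "S \<subseteq> {..<n}" "S \<noteq> {}" "S \<noteq> {..<n}" "flip n S \<in> M"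
    using crossing_gives_flip[OF cov alt n(1) g(1) cx(1,3,2,4)] .
  then show ?thesis
    using three_cycle_flips[of n M S T] cov alt n T by (simp add: covers_def)
qed

text \<open>With only three pairs there is no room for crossings; here the square of the right
  shuffle is a flip of two pairs.\<close>

lemma even_flips_mem_3:
  assumes T: "T \<subseteq> {..<3}" "even (card T)"
  shows "flip 3 T \<in> carrier (LR_group 3)"
proof -
  interpret perm_group "{0..<2 * 3}" "carrier (LR_group 3)" by (rule perm_group_LR)
  have r: "right_shuffle 3 \<in> carrier (LR_group 3)" unfolding carrier_LR by (rule gen_by_incl) simp
  have "right_shuffle 3 \<circ> right_shuffle 3 = flip 3 {1, 2}"
  proof (rule deck_ext)
    fix x :: nat assume "x < 2 * 3"
    then have "x = 0 \<or> x = 1 \<or> x = 2 \<or> x = 3 \<or> x = 4 \<or> x = 5" by presburger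
    then show "(right_shuffle 3 \<circ> right_shuffle 3) x = flip 3 {1, 2} x"
      by (elim disjE) (simp_all add: right_shuffle_def flip_def fold_pos_def mirror_def)
  qed (use flip_central central_permutes permutes_compose right_shuffle_permutes in blast)+
  then have "flip 3 {1, 2} \<in> carrier (LR_group 3)" using comp_mem[OF r r] by simp
  moreover have "contains_alternating {..<3} (folded_group 3)"
  proof (rule folded_contains_alternating)
    show "\<nexists>k. (3::nat) = 2 ^ k"
    proof
      assume "\<exists>k. (3::nat) = 2 ^ k"
      then obtain k where "(3::nat) = 2 ^ k" by blast
      then show False by (cases k) (auto, presburger)
    qed
  qed simp_all
  moreover have "{1, 2} \<noteq> {..<3::nat}" by (metis empty_iff insert_iff lessThan_iff one_neq_zero zero_less_numeral zero_neq_numeral)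
  ultimately show ?thesis
    using three_cycle_flips[of 3 "carrier (LR_group 3)" "{1, 2}" T] covers_LR[of 3] T
    by (auto simp: covers_def)
qed

section \<open>Signs\<close>

lemma finite_permutes_permutation: "finite A \<Longrightarrow> p permutes A \<Longrightarrow> permutation p"
  using permutation_permutes by blast

lemma central_permutation: "g \<in> central n \<Longrightarrow> permutation g"
  using central_permutes finite_permutes_permutation by blast

lemma bar_permutation: "g \<in> central n \<Longrightarrow> permutation (bar n g)"
  using bar_permutes finite_permutes_permutation by blast

text \<open>The map from a representative to its mirror pair transports one permutation to the
  other, and signs are invariant under transport.\<close>

lemma sgn_bar_eq_sign_bar:
  assumes g: "g \<in> central n"
  shows "sgn_bar n g = sign (bar n g)"
proof -
  define f where "f = (\<lambda>x. {x, 2 * n - 1 - x})"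
  have im: "f ` {..<n} = sym_pairs n"
  proof
    show "f ` {..<n} \<subseteq> sym_pairs n" by (auto simp: f_def sym_pairs_def)
    show "sym_pairs n \<subseteq> f ` {..<n}"
    proof
      fix s assume "s \<in> sym_pairs n"
      then obtain i where i: "s = {i, 2 * n - 1 - i}" "i < 2 * n" by (auto simp: sym_pairs_def)
      show "s \<in> f ` {..<n}"
      proof (cases "i < n")
        case False
        then have "s = f (2 * n - 1 - i)" "2 * n - 1 - i < n" using i by (auto simp: f_def)
        then show ?thesis by blast
      qed (use i in \<open>auto simp: f_def\<close>)
    qed
  qed
  have inj: "inj_on f {..<n}"
    by (rule inj_onI) (auto simp: f_def doubleton_eq_iff)
  have ff: "f (fold_pos n x) = {x, mirror n x}" if "x < 2 * n" for x
    using that by (auto simp: f_def fold_pos_def mirror_def)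
  have "pair_perm n g = map_permutation {..<n} f (bar n g)"
  proof (rule ext)
    fix s show "pair_perm n g s = map_permutation {..<n} f (bar n g) s"
    proof (cases "s \<in> sym_pairs n")
      case True
      then obtain x where x: "x < n" "s = f x" using im by blast
      have "inv_into {..<n} f s = x" using inj x by simp
      moreover have "f (fold_pos n (g x)) = g ` f x"
        using ff[OF central_less[OF g, of x]] x central_mirror[OF g, of x] by (auto simp: f_def mirror_def)
      ultimately show ?thesis
        using True x by (simp add: pair_perm_def map_permutation_def im bar_def)
    next
      case False
      then show ?thesis by (simp add: pair_perm_def map_permutation_def im)
    qed
  qed
  then show ?thesis
    unfolding sgn_bar_def using sign_map_permutation[OF inj bar_permutes[OF g]] by simp
qed

lemma sign_flip:
  assumes "T \<subseteq> {..<n}"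
  shows "sign (flip n T) = (- 1) ^ card T"
proof -
  have "finite T" using assms finite_subset by blast
  then show ?thesis
    using assms
  proof (induction T rule: finite_induct)
    case empty
    have "flip n {} = id" by (auto simp: flip_def)
    then show ?case by (metis card.empty power_0 sign_id)
  next
    case (insert a T)
    have a: "a < n" using insert by simp
    have "flip n {a} = transpose a (mirror n a)"
    proof (rule ext)
      fix x show "flip n {a} x = transpose a (mirror n a) x"
        using a fold_pos_eq_mirror[of x n a] fold_pos_id[of a n] mirror_mirror[of n a]
        by (cases "x < 2 * n") (auto simp: flip_def transpose_def mirror_def)
    qed
    then have s: "sign (flip n {a}) = -1" using mirror_neq[of a n] a by (simp add: sign_swap_id)
    have "flip n (insert a T) = flip n {a} \<circ> flip n T"
      unfolding flip_flip using insert(2) by (intro arg_cong[of _ _ "flip n"]) auto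
    then have "sign (flip n (insert a T)) = sign (flip n {a}) * sign (flip n T)"
      using sign_compose central_permutation flip_central by metis
    then show ?case using s insert by simp
  qed
qed

text \<open>Squares have sign \<open>1\<close>, so three-cycles of pairs lift to elements of
  \<open>M\<close> with sign \<open>1\<close>, and hence so do all even permutations of the
  pairs. Dividing \<open>g\<close> by such a lift leaves a flip of sign \<open>1\<close>, that
  is, a flip of an even number of pairs.\<close>

lemma even_part_mem:
  assumes cov: "covers n M" and alt: "contains_alternating {..<n} (folded_group n)"
    and flips: "\<And>T. T \<subseteq> {..<n} \<Longrightarrow> even (card T) \<Longrightarrow> flip n T \<in> M"
    and g: "g \<in> central n" "sign g = 1" "sign (bar n g) = 1"
  shows "g \<in> M"
proof -
  interpret perm_group "{0..<2 * n}" M by (rule covers_perm_group[OF cov])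
  note cen = covers_central[OF cov]
  define Q where "Q = {p. \<exists>h\<in>M. sign h = 1 \<and> bar n h = p}"
  have "bar n g \<in> Q"
  proof (rule even_perm_mem)
    show "contains_alternating {..<n} Q"
      unfolding contains_alternating_def
    proof (intro ballI impI)
      fix a b c assume abc: "a \<in> {..<n}" "b \<in> {..<n}" "c \<in> {..<n}" "distinct [a, b, c]"
      then have d: "distinct [a, c, b]" by auto
      have "three_cycle a c b \<in> bar n ` M"
        using cov alt abc d unfolding covers_def contains_alternating_def by auto
      then obtain h where h: "h \<in> M" "bar n h = three_cycle a c b" by auto
      have "bar n (h \<circ> h) = three_cycle a b c"
        using bar_comp[OF cen[OF h(1)] cen[OF h(1)]] h(2) three_cycle_square[OF d] by simp
      moreover have "sign (h \<circ> h) = 1"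
        using sign_compose[OF central_permutation central_permutation, OF cen[OF h(1)] cen[OF h(1)]] by simp
      ultimately show "three_cycle a b c \<in> Q" unfolding Q_def using comp_mem[OF h(1) h(1)] by blast
    qed
    show "id \<in> Q" unfolding Q_def using id_mem bar_id sign_id by blast
    show "p \<circ> q \<in> Q" if "p \<in> Q" "q \<in> Q" for p q
    proof -
      from that obtain h where "h \<in> M" "sign h = 1" "bar n h = p" unfolding Q_def by blast
      moreover from that obtain k where "k \<in> M" "sign k = 1" "bar n k = q" unfolding Q_def by blast
      ultimately have hk: "h \<in> M" "sign h = 1" "bar n h = p" "k \<in> M" "sign k = 1" "bar n k = q" by blast+
      have "sign (h \<circ> k) = 1"
        using sign_compose[OF central_permutation central_permutation, OF cen[OF hk(1)] cen[OF hk(4)]] hk by simp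
      then show ?thesis unfolding Q_def using comp_mem[OF hk(1,4)] bar_comp[OF cen[OF hk(1)] cen[OF hk(4)]] hk by blast
    qed
  qed (use g bar_permutes in auto)
  then obtain h where h: "h \<in> M" "sign h = 1" "bar n h = bar n g" by (auto simp: Q_def)
  have hc: "h \<in> central n" "inv' h \<in> central n" using cen h inv_mem by auto
  let ?k = "g \<circ> inv' h"
  have kc: "?k \<in> central n" using perm_group.comp_mem[OF perm_group_central] g hc by blast
  have "bar n ?k = id"
    using bar_comp[OF g(1) hc(2)] bar_inverse(2)[OF hc(1)] h(3) by simp
  note fl = flip_if_bar_id[OF kc this]
  have "sign ?k = 1"
    using sign_compose[OF central_permutation[OF g(1)] central_permutation[OF hc(2)]]
      sign_inverse[OF central_permutation[OF hc(1)]] g h by simp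
  then have "(- 1 :: int) ^ card {x. x < n \<and> ?k x \<noteq> x} = 1"
    using sign_flip[of "{x. x < n \<and> ?k x \<noteq> x}" n] fl by (metis (no_types, lifting) lessThan_iff mem_Collect_eq subsetI)
  then have "even (card {x. x < n \<and> ?k x \<noteq> x})" by (simp add: minus_one_power_iff split: if_splits)
  then have "?k \<in> M" using flips[of "{x. x < n \<and> ?k x \<noteq> x}"] fl by auto
  moreover have "g = ?k \<circ> h" using bij_mem[OF h(1)] by (simp add: fun_eq_iff bij_is_inj)
  ultimately show ?thesis using comp_mem h by metis
qed

lemma same_signs_mem:
  assumes cov: "covers n M" and even: "\<And>g. g \<in> central n \<Longrightarrow> sign g = 1 \<Longrightarrow> sign (bar n g) = 1 \<Longrightarrow> g \<in> M"
    and g: "g \<in> central n" and h: "h \<in> M" "sign h = sign g" "sign (bar n h) = sign (bar n g)"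
  shows "g \<in> M"
proof -
  interpret perm_group "{0..<2 * n}" M by (rule covers_perm_group[OF cov])
  have hc: "h \<in> central n" "inv' h \<in> central n" using covers_central[OF cov] h inv_mem by auto
  have kc: "g \<circ> inv' h \<in> central n" using perm_group.comp_mem[OF perm_group_central] g hc by blast
  have "sign (g \<circ> inv' h) = 1"
    using sign_compose[OF central_permutation[OF g(1)] central_permutation[OF hc(2)]]
      sign_inverse[OF central_permutation[OF hc(1)]] h by simp
  moreover have "sign (bar n (g \<circ> inv' h)) = 1"
    using sign_compose[OF bar_permutation[OF g(1)] bar_permutation[OF hc(2)]] bar_comp[OF g hc(2)]
      bar_inv[OF hc(1)] sign_inverse[OF bar_permutation[OF hc(1)]] h by simp
  ultimately have "g \<circ> inv' h \<in> M" using even kc by blast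
  moreover have "g = (g \<circ> inv' h) \<circ> h" using bij_mem[OF h(1)] by (simp add: fun_eq_iff bij_is_inj)
  ultimately show ?thesis using comp_mem h by metis
qed

text \<open>Moving one card from position \<open>h\<close> to position \<open>m\<close>. In
  passing from \<open>n\<close> to \<open>n + 1\<close> the out shuffle and \<open>monge
  n\<close> change by such a move, which yields their signs by induction.\<close>

definition drop_card :: "nat \<Rightarrow> nat \<Rightarrow> nat \<Rightarrow> nat" where
  "drop_card h m i = (if i = h then m else if h < i \<and> i \<le> m then i - 1 else i)"

lemma drop_card_sign:
  assumes "h \<le> m"
  shows "permutation (drop_card h m) \<and> sign (drop_card h m) = (- 1) ^ (m - h)"
  using assms
proof (induction m rule: dec_induct)
  case base
  have "drop_card h h = id" by (auto simp: drop_card_def)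
  moreover have "sign (id :: nat \<Rightarrow> nat) = (- 1) ^ (h - h)" by (metis diff_self_eq_0 power_0 sign_id)
  ultimately show ?case using permutation_id by metis
next
  case (step m)
  have eq: "drop_card h (Suc m) = transpose m (Suc m) \<circ> drop_card h m"
    using step(1) by (auto simp: fun_eq_iff drop_card_def transpose_def)
  have IH: "permutation (drop_card h m)" "sign (drop_card h m) = (- 1) ^ (m - h)" using step by blast+
  have "sign (transpose m (Suc m)) = -1" by (simp add: sign_swap_id)
  then have "sign (transpose m (Suc m) \<circ> drop_card h m) = (- 1) ^ (Suc m - h)"
    using sign_compose[OF permutation_swap_id IH(1), of m "Suc m"] IH(2) step(1) by (simp add: Suc_diff_le)
  then show ?case unfolding eq using permutation_compose[OF permutation_swap_id IH(1)] by blast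
qed

lemma permutation_out: "permutation (out_shuffle n)"
  using out_shuffle_permutes finite_permutes_permutation by blast
lemma permutation_monge: "permutation (monge n)"
  using monge_permutes finite_permutes_permutation by blast

lemma sign_out_Suc: "sign (out_shuffle (Suc n)) = sign (out_shuffle n) * (- 1) ^ n"
proof -
  have "out_shuffle (Suc n) = out_shuffle n \<circ> drop_card n (2 * n)"
    by (auto simp: fun_eq_iff out_shuffle_def drop_card_def)
  then show ?thesis using sign_compose[OF permutation_out] drop_card_sign[of n "2 * n"] by simp
qed

lemma sign_monge_Suc: "sign (monge (Suc n)) = sign (monge n) * (- 1) ^ (n div 2)"
proof -
  have "monge (Suc n) x = monge n (drop_card (Suc n div 2) n x)" for x
  proof -
    consider "x < Suc n div 2" | "x = Suc n div 2" | "Suc n div 2 < x" "x \<le> n" | "n < x" by linarith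
    then show ?thesis
    proof cases
      case 1
      then have "2 * x < n" by linarith
      then show ?thesis using 1 by (simp add: monge_def drop_card_def)
    next
      case 2
      have "monge (Suc n) x = n" using 2 by (cases "even n") (auto simp: monge_def elim!: evenE oddE)
      then show ?thesis using 2 by (simp add: monge_def drop_card_def)
    next
      case 3
      then have "\<not> 2 * x < Suc n" "\<not> 2 * (x - 1) < n" by linarith+
      then show ?thesis using 3 by (auto simp: monge_def drop_card_def)
    next
      case 4
      then have "x \<noteq> Suc n div 2" by linarith
      then show ?thesis using 4 by (simp add: monge_def drop_card_def)
    qed
  qed
  then have "monge (Suc n) = monge n \<circ> drop_card (Suc n div 2) n" by auto
  moreover have "n - Suc n div 2 = n div 2" by linarith
  moreover have "Suc n div 2 \<le> n \<or> n = 0" by linarith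
  moreover have "Suc 0 div 2 \<le> 0" by simp
  ultimately show ?thesis using sign_compose[OF permutation_monge] drop_card_sign[of "Suc n div 2" n] by auto
qed

lemma sign_zero_deck: "sign (out_shuffle 0) = 1" "sign (monge 0) = 1"
proof -
  have "out_shuffle 0 = id" "monge 0 = id" by (auto simp: fun_eq_iff out_shuffle_def monge_def)
  then show "sign (out_shuffle 0) = 1" "sign (monge 0) = 1" using sign_id by metis+
qed

lemma signs_mod_4:
  "sign (out_shuffle (4 * k)) = 1 \<and> sign (monge (4 * k)) = 1"
  "sign (out_shuffle (4 * k + 1)) = 1 \<and> sign (monge (4 * k + 1)) = 1"
  "sign (out_shuffle (4 * k + 2)) = - 1 \<and> sign (monge (4 * k + 2)) = 1"
  "sign (out_shuffle (4 * k + 3)) = - 1 \<and> sign (monge (4 * k + 3)) = - 1"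
proof -
  have step: "sign (out_shuffle (4 * k + 1)) = sign (out_shuffle (4 * k))"
      "sign (out_shuffle (4 * k + 2)) = - sign (out_shuffle (4 * k + 1))"
      "sign (out_shuffle (4 * k + 3)) = sign (out_shuffle (4 * k + 2))"
      "sign (out_shuffle (4 * k + 4)) = - sign (out_shuffle (4 * k + 3))"
      "sign (monge (4 * k + 1)) = sign (monge (4 * k))"
      "sign (monge (4 * k + 2)) = sign (monge (4 * k + 1))"
      "sign (monge (4 * k + 3)) = - sign (monge (4 * k + 2))"
      "sign (monge (4 * k + 4)) = - sign (monge (4 * k + 3))" for k
  proof -
    have e: "Suc (4 * k) = 4 * k + 1" "Suc (4 * k + 1) = 4 * k + 2" "Suc (4 * k + 2) = 4 * k + 3"
      "Suc (4 * k + 3) = 4 * k + 4" by simp_all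
    have d: "4 * k div 2 = 2 * k" "(4 * k + 1) div 2 = 2 * k" "(4 * k + 2) div 2 = 2 * k + 1"
      "(4 * k + 3) div 2 = 2 * k + 1" by simp_all
    have p: "(- 1 :: int) ^ (4 * k) = 1" "(- 1 :: int) ^ (4 * k + 1) = - 1" "(- 1 :: int) ^ (4 * k + 2) = 1"
      "(- 1 :: int) ^ (4 * k + 3) = - 1" "(- 1 :: int) ^ (2 * k) = 1" "(- 1 :: int) ^ (2 * k + 1) = - 1"
      by (simp_all add: minus_one_power_iff)
    note o = sign_out_Suc[of "4 * k", unfolded e p] sign_out_Suc[of "4 * k + 1", unfolded e p]
      sign_out_Suc[of "4 * k + 2", unfolded e p] sign_out_Suc[of "4 * k + 3", unfolded e p]
    note m = sign_monge_Suc[of "4 * k", unfolded e d p] sign_monge_Suc[of "4 * k + 1", unfolded e d p]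
      sign_monge_Suc[of "4 * k + 2", unfolded e d p] sign_monge_Suc[of "4 * k + 3", unfolded e d p]
    show "sign (out_shuffle (4 * k + 1)) = sign (out_shuffle (4 * k))"
      "sign (out_shuffle (4 * k + 2)) = - sign (out_shuffle (4 * k + 1))"
      "sign (out_shuffle (4 * k + 3)) = sign (out_shuffle (4 * k + 2))"
      "sign (out_shuffle (4 * k + 4)) = - sign (out_shuffle (4 * k + 3))"
      "sign (monge (4 * k + 1)) = sign (monge (4 * k))"
      "sign (monge (4 * k + 2)) = sign (monge (4 * k + 1))"
      "sign (monge (4 * k + 3)) = - sign (monge (4 * k + 2))"
      "sign (monge (4 * k + 4)) = - sign (monge (4 * k + 3))"
      unfolding o m by simp_all
  qed
  have 0: "sign (out_shuffle (4 * k)) = 1 \<and> sign (monge (4 * k)) = 1"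
  proof (induction k)
    case 0 then show ?case using sign_zero_deck by simp
  next
    case (Suc k)
    have e: "4 * Suc k = 4 * k + 4" by simp
    show ?case unfolding e using Suc step[of k] by simp
  qed
  show "sign (out_shuffle (4 * k)) = 1 \<and> sign (monge (4 * k)) = 1" by (rule 0)
  show "sign (out_shuffle (4 * k + 1)) = 1 \<and> sign (monge (4 * k + 1)) = 1"
    "sign (out_shuffle (4 * k + 2)) = - 1 \<and> sign (monge (4 * k + 2)) = 1"
    "sign (out_shuffle (4 * k + 3)) = - 1 \<and> sign (monge (4 * k + 3)) = - 1"
    using 0 step[of k] by simp_all
qed

lemma permutation_rev_blocks: "permutation (rev_blocks n d)"
  using rev_blocks_permutes finite_permutes_permutation by blast

lemma rev_blocks_outside: "n \<le> x \<Longrightarrow> rev_blocks n d x = x"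
  by (simp add: rev_blocks_def)

lemma sign_rev_two: "sign (rev_blocks n 2) = (- 1) ^ (n div 2)"
proof -
  have ev: "sign (rev_blocks (2 * k) 2) = (- 1) ^ k" for k
  proof (induction k)
    case 0
    have "rev_blocks (2 * 0) 2 = id" by (rule rev_blocks_big) simp
    then show ?case by (metis power_0 sign_id)
  next
    case (Suc k)
    have eq: "rev_blocks (2 * Suc k) 2 = transpose (2 * k) (2 * k + 1) \<circ> rev_blocks (2 * k) 2"
    proof (rule ext)
      fix x :: nat
      have "x < 2 * k \<or> x = 2 * k \<or> x = 2 * k + 1 \<or> 2 * Suc k \<le> x" by auto
      then consider "x < 2 * k" | "x = 2 * k" | "x = 2 * k + 1" | "2 * Suc k \<le> x" by blast
      then show "rev_blocks (2 * Suc k) 2 x = (transpose (2 * k) (2 * k + 1) \<circ> rev_blocks (2 * k) 2) x"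
      proof cases
        case 1
        then have e: "even x \<Longrightarrow> Suc x < 2 * k" by presburger
        have "rev_blocks (2 * k) 2 x < 2 * k" using 1 rev_blocks_less by blast
        then show ?thesis using 1 e by (auto simp: rev_blocks_two transpose_def)
      qed (auto simp: rev_blocks_two rev_blocks_outside transpose_def)
    qed
    have "sign (transpose (2 * k) (2 * k + 1)) = -1" by (simp add: sign_swap_id)
    then show ?case
      unfolding eq sign_compose[OF permutation_swap_id permutation_rev_blocks] Suc by simp
  qed
  show ?thesis
  proof (cases "even n")
    case True then show ?thesis using ev[of "n div 2"] by simp
  next
    case False
    then obtain k where k: "n = 2 * k + 1" using oddE by blast
    have "rev_blocks n 2 = rev_blocks (2 * k) 2"
    proof (rule ext)
      fix x
      have lt: "Suc x < 2 * k" if "even x" "x < 2 * k" using that by presburger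
      show "rev_blocks n 2 x = rev_blocks (2 * k) 2 x"
      proof (cases "x < 2 * k")
        case True then show ?thesis using k lt by (auto simp: rev_blocks_two)
      next
        case False
        then have "x = 2 * k \<or> n \<le> x" using k by linarith
        then show ?thesis using k by (auto simp: rev_blocks_two rev_blocks_outside)
      qed
    qed
    then show ?thesis using ev[of k] k by simp
  qed
qed

lemma sign_mirror: "sign (mirror n) = (- 1) ^ n"
  unfolding mirror_flip using sign_flip[of "{..<n}" n] by simp

lemma sign_in: "sign (in_shuffle n) = (- 1) ^ n * sign (out_shuffle n)"
  unfolding in_out using sign_compose[OF permutation_rev_blocks permutation_out] sign_rev_two[of "2 * n"] by simp

lemma sign_bar_in: "sign (bar n (in_shuffle n)) = (- 1) ^ (n div 2) * sign (monge n)"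
  unfolding bar_in using sign_compose[OF permutation_rev_blocks permutation_monge] sign_rev_two[of n] by simp

lemma sign_in_central: "g \<in> central n \<Longrightarrow> h \<in> central n \<Longrightarrow> sign (g \<circ> h) = sign g * sign h"
  "g \<in> central n \<Longrightarrow> h \<in> central n \<Longrightarrow> sign (bar n (g \<circ> h)) = sign (bar n g) * sign (bar n h)"
  by (simp add: sign_compose central_permutation)
    (metis bar_comp sign_compose bar_permutation)

lemma sign_left_right:
  "sign (left_shuffle n) = (- 1) ^ n * sign (in_shuffle n)" "sign (right_shuffle n) = (- 1) ^ n * sign (out_shuffle n)"
  "sign (bar n (left_shuffle n)) = sign (bar n (in_shuffle n))" "sign (bar n (right_shuffle n)) = sign (monge n)"
proof -
  have c: "in_shuffle n \<in> central n" "out_shuffle n \<in> central n" using shuffles_in_B_group by auto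
  have i: "inv' (in_shuffle n) \<in> central n" "inv' (out_shuffle n) \<in> central n"
    using perm_group.inv_mem[OF perm_group_central] c by auto
  have b: "sign (bar n (mirror n)) = 1" unfolding bar_mirror by (rule sign_id)
  show "sign (left_shuffle n) = (- 1) ^ n * sign (in_shuffle n)" "sign (right_shuffle n) = (- 1) ^ n * sign (out_shuffle n)"
    unfolding shuffle_inverses(1,2) using sign_in_central(1)[OF mirror_central] i c
    by (simp_all add: sign_mirror sign_inverse central_permutation)
  show "sign (bar n (left_shuffle n)) = sign (bar n (in_shuffle n))" "sign (bar n (right_shuffle n)) = sign (monge n)"
    unfolding shuffle_inverses(1,2) using sign_in_central(2)[OF mirror_central] i c b bar_inv
    by (simp_all add: sign_inverse bar_permutation bar_out[symmetric])
qed

section \<open>Flips times lifted permutations\<close>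

text \<open>Carries out \<open>p\<close> in the upper half of the deck and its mirror image in
  the lower half: a section of \<open>bar n\<close> that is a homomorphism.\<close>

definition unfold_perm :: "nat \<Rightarrow> (nat \<Rightarrow> nat) \<Rightarrow> nat \<Rightarrow> nat" where
  "unfold_perm n p x = (if x < n then p x else mirror n (p (mirror n x)))"

lemma unfold_perm_cases:
  assumes p: "p permutes {..<n}"
  shows "x < n \<Longrightarrow> unfold_perm n p x = p x" "x < n \<Longrightarrow> p x < n"
    "x < 2 * n \<Longrightarrow> \<not> x < n \<Longrightarrow> mirror n x < n"
    "\<not> x < 2 * n \<Longrightarrow> unfold_perm n p x = x"
proof -
  show lt: "x < n \<Longrightarrow> p x < n" for x using permutes_in_image[OF p, of x] by simp
  show "\<not> x < 2 * n \<Longrightarrow> unfold_perm n p x = x"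
    using permutes_not_in[OF p, of x] by (simp add: unfold_perm_def mirror_def)
qed (auto simp: unfold_perm_def mirror_def)

lemma unfold_perm_comp:
  assumes "p permutes {..<n}" "q permutes {..<n}"
  shows "unfold_perm n (p \<circ> q) = unfold_perm n p \<circ> unfold_perm n q"
proof (rule ext)
  fix x
  consider "x < n" | "x < 2 * n" "\<not> x < n" | "\<not> x < 2 * n" by linarith
  then show "unfold_perm n (p \<circ> q) x = (unfold_perm n p \<circ> unfold_perm n q) x"
  proof cases
    case 1
    then show ?thesis using unfold_perm_cases[OF assms(2)] by (simp add: unfold_perm_def)
  next
    case 2
    have "q (mirror n x) < n" using unfold_perm_cases(2,3)[OF assms(2)] 2 by simp
    then have "\<not> mirror n (q (mirror n x)) < n" by (simp add: mirror_def)
    then show ?thesis using 2 by (simp add: unfold_perm_def mirror_mirror)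
  next
    case 3
    then show ?thesis using unfold_perm_cases(4)[OF assms(1)] unfold_perm_cases(4)[OF assms(2)]
        unfold_perm_cases(4)[OF permutes_compose[OF assms(2,1)]] by simp
  qed
qed

lemma unfold_perm_id: "unfold_perm n id = id"
  by (auto simp: fun_eq_iff unfold_perm_def mirror_mirror)

lemma unfold_perm_central:
  assumes p: "p permutes {..<n}"
  shows "unfold_perm n p \<in> central n"
  unfolding central_iff
proof
  have lt: "unfold_perm n q x < 2 * n" if "q permutes {..<n}" "x < 2 * n" for q x
  proof (cases "x < n")
    case True then show ?thesis using unfold_perm_cases(2)[OF that(1) True] by (simp add: unfold_perm_def)
  next
    case False
    then have "q (mirror n x) < n" using unfold_perm_cases(2,3)[OF that(1)] that by blast
    then have "mirror n (q (mirror n x)) < 2 * n" by (intro mirror_less) simp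
    then show ?thesis using False by (simp add: unfold_perm_def)
  qed
  have i: "inv' p permutes {..<n}" by (rule permutes_inv[OF p])
  have "unfold_perm n (inv' p) \<circ> unfold_perm n p = id" "unfold_perm n p \<circ> unfold_perm n (inv' p) = id"
    using unfold_perm_comp[OF i p] unfold_perm_comp[OF p i] permutes_inv_o[OF p] unfold_perm_id by metis+
  then show "unfold_perm n p permutes {0..<2 * n}"
    using lt[OF p] lt[OF i] unfold_perm_cases(4)[OF p]
    by (intro bij_imp_permutes bij_betwI[where g = "unfold_perm n (inv' p)"]) (auto simp: fun_eq_iff)
  show "\<forall>x<2 * n. unfold_perm n p (mirror n x) = mirror n (unfold_perm n p x)"
  proof (intro allI impI)
    fix x assume x: "x < 2 * n"
    show "unfold_perm n p (mirror n x) = mirror n (unfold_perm n p x)"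
    proof (cases "x < n")
      case True
      then have "\<not> mirror n x < n" by (simp add: mirror_def)
      then show ?thesis using True by (simp add: unfold_perm_def mirror_mirror)
    next
      case False
      then have "mirror n x < n" using x by (simp add: mirror_def)
      then show ?thesis using False by (simp add: unfold_perm_def mirror_mirror)
    qed
  qed
qed

lemma bar_unfold_perm:
  assumes "p permutes {..<n}"
  shows "bar n (unfold_perm n p) = p"
  using unfold_perm_cases(1,2)[OF assms] permutes_not_in[OF assms]
  by (auto simp: fun_eq_iff bar_def fold_pos_id)

text \<open>Each transposition is carried out twice, once in either half.\<close>

lemma sign_unfold_perm:
  assumes "p permutes {..<n}"
  shows "sign (unfold_perm n p) = 1"
  using assms finite_lessThan[of n]
proof (induction p rule: permutes_induct)
  case id then show ?case unfolding unfold_perm_id by (rule sign_id)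
next
  case (swap a b p)
  have t: "transpose a b permutes {..<n}" using swap permutes_swap_id by metis
  have pp: "p permutes {..<n}" and IH: "sign (unfold_perm n p) = 1" and ab: "a \<noteq> b" using swap by blast+
  have "unfold_perm n (transpose a b) = transpose a b \<circ> transpose (mirror n a) (mirror n b)"
  proof (rule ext)
    fix x
    have *: "a < n" "b < n" using swap by auto
    then have **: "\<not> mirror n a < n" "\<not> mirror n b < n" by (simp_all add: mirror_def)
    show "unfold_perm n (transpose a b) x = (transpose a b \<circ> transpose (mirror n a) (mirror n b)) x"
      using * ** mirror_mirror[of n] by (auto simp: unfold_perm_def transpose_def; metis)
  qed
  moreover have "mirror n a \<noteq> mirror n b" using ab mirror_mirror by metis
  ultimately have "sign (unfold_perm n (transpose a b)) = 1"
    using ab by (simp add: sign_compose permutation_swap_id sign_swap_id)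
  then show ?case
    using unfold_perm_comp[OF t pp] IH
      sign_in_central(1)[OF unfold_perm_central[OF t] unfold_perm_central[OF pp]] by (metis mult_1)
qed

lemma central_decomposition:
  assumes g: "g \<in> central n"
  shows "\<exists>T\<subseteq>{..<n}. g = flip n T \<circ> unfold_perm n (bar n g)"
proof -
  let ?u = "unfold_perm n (bar n g)"
  have u: "?u \<in> central n" using unfold_perm_central[OF bar_permutes[OF g]] .
  have i: "inv' ?u \<in> central n" using perm_group.inv_mem[OF perm_group_central u] .
  have k: "g \<circ> inv' ?u \<in> central n" using perm_group.comp_mem[OF perm_group_central g i] .
  have "bar n (g \<circ> inv' ?u) = id"
    using bar_comp[OF g i] bar_inverse(2)[OF u] bar_unfold_perm[OF bar_permutes[OF g]] by simp
  then obtain T where T: "T \<subseteq> {..<n}" "g \<circ> inv' ?u = flip n T"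
    using flip_if_bar_id[OF k] by (metis (no_types, lifting) lessThan_iff mem_Collect_eq subsetI)
  have "g = (g \<circ> inv' ?u) \<circ> ?u"
    using permutes_bij[OF central_permutes[OF u]] by (simp add: fun_eq_iff bij_is_inj)
  then show ?thesis using T by metis
qed

lemma card_central: "card (central n) = fact n * 2 ^ n"
proof -
  let ?D = "Pow {..<n} \<times> {p. p permutes {..<n}}"
  let ?f = "\<lambda>(T, p). flip n T \<circ> unfold_perm n p"
  have "bij_betw ?f ?D (central n)"
  proof (rule bij_betw_imageI)
    show "inj_on ?f ?D"
    proof (rule inj_onI, clarify)
      fix T p U q assume TU: "T \<subseteq> {..<n}" "U \<subseteq> {..<n}" and pq: "p permutes {..<n}" "q permutes {..<n}"
        and eq: "flip n T \<circ> unfold_perm n p = flip n U \<circ> unfold_perm n q"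
      have "bar n (flip n V \<circ> unfold_perm n r) = r" if "r permutes {..<n}" for V r
        using bar_comp[OF flip_central unfold_perm_central[OF that]] bar_flip bar_unfold_perm[OF that] by simp
      then have p: "p = q" using eq pq by metis
      have "flip n T y = flip n U y" for y
        using fun_cong[OF eq, of "inv' (unfold_perm n p) y"] p
          permutes_bij[OF central_permutes[OF unfold_perm_central[OF pq(1)]]]
        by (simp add: bij_is_surj surj_f_inv_f)
      then have "x \<in> T \<longleftrightarrow> x \<in> U" if "x < n" for x
      proof -
        have "flip n V x = x \<longleftrightarrow> x \<notin> V" for V
          using that mirror_neq[of x n] by (simp add: flip_def fold_pos_id)
        then show ?thesis using \<open>\<And>y. flip n T y = flip n U y\<close> by metis
      qed
      then show "T = U \<and> p = q" using p TU by blast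
    qed
    show "?f ` ?D = central n"
    proof
      show "?f ` ?D \<subseteq> central n"
        using perm_group.comp_mem[OF perm_group_central flip_central unfold_perm_central] by auto
      show "central n \<subseteq> ?f ` ?D"
      proof
        fix g assume g: "g \<in> central n"
        then obtain T where "T \<subseteq> {..<n}" "g = flip n T \<circ> unfold_perm n (bar n g)"
          using central_decomposition by blast
        then show "g \<in> ?f ` ?D" using bar_permutes[OF g] by (intro image_eqI[of _ _ "(T, bar n g)"]) auto
      qed
    qed
  qed
  then have "card (central n) = card ?D" using bij_betw_same_card by metis
  then show ?thesis by (simp add: card_cartesian_product card_Pow card_permutations)
qed

text \<open>Composition with the involution \<open>t\<close> exchanges the elements of value
  \<open>1\<close> with those of value \<open>- 1\<close>.\<close>

lemma half_card:
  fixes \<chi> :: "('a \<Rightarrow> 'a) \<Rightarrow> int"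
  assumes fin: "finite A" and \<chi>: "\<And>g. g \<in> A \<Longrightarrow> \<chi> g = 1 \<or> \<chi> g = - 1"
    and t: "\<And>g. g \<in> A \<Longrightarrow> t \<circ> g \<in> A" "\<And>g. g \<in> A \<Longrightarrow> \<chi> (t \<circ> g) = - \<chi> g" "\<And>x. t (t x) = x"
  shows "2 * card {g \<in> A. \<chi> g = 1} = card A"
proof -
  have tt: "t \<circ> (t \<circ> g) = g" for g using t(3) by auto
  have "bij_betw ((\<circ>) t) {g \<in> A. \<chi> g = 1} {g \<in> A. \<chi> g = - 1}"
  proof (rule bij_betwI[where g = "(\<circ>) t"])
    show "(\<circ>) t \<in> {g \<in> A. \<chi> g = - 1} \<rightarrow> {g \<in> A. \<chi> g = 1}" using t(1,2) by force
  qed (use t(1,2) tt in auto)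
  then have e: "card {g \<in> A. \<chi> g = 1} = card {g \<in> A. \<chi> g = - 1}" by (rule bij_betw_same_card)
  have u: "{g \<in> A. \<chi> g = 1} \<union> {g \<in> A. \<chi> g = - 1} = A" using \<chi> by auto
  have "card ({g \<in> A. \<chi> g = 1} \<union> {g \<in> A. \<chi> g = - 1}) =
      card {g \<in> A. \<chi> g = 1} + card {g \<in> A. \<chi> g = - 1}"
  proof (rule card_Un_disjoint)
    show "finite {g \<in> A. \<chi> g = 1}" "finite {g \<in> A. \<chi> g = - 1}" using fin by simp_all
    show "{g \<in> A. \<chi> g = 1} \<inter> {g \<in> A. \<chi> g = - 1} = {}"
    proof (rule equals0I)
      fix g assume "g \<in> {g \<in> A. \<chi> g = 1} \<inter> {g \<in> A. \<chi> g = - 1}"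
      then have "(1::int) = - 1" by (metis (mono_tags, lifting) Int_iff mem_Collect_eq)
      then show False by simp
    qed
  qed
  then have "card A = card {g \<in> A. \<chi> g = - 1} + card {g \<in> A. \<chi> g = - 1}" unfolding u e .
  then show ?thesis unfolding e by linarith
qed

lemma card_sign_bar_kernel:
  assumes "2 \<le> n"
  shows "2 * card {g \<in> central n. sign (bar n g) = 1} = fact n * 2 ^ n"
  unfolding card_central[symmetric]
proof (rule half_card[where t = "unfold_perm n (transpose 0 1)"])
  have p: "transpose 0 1 permutes {..<n}" using assms by (intro permutes_swap_id) auto
  note c = unfold_perm_central[OF p]
  show "finite (central n)" using perm_group.finite_mem[OF perm_group_central] .
  show "sign (bar n g) = 1 \<or> sign (bar n g) = - 1" for g using sign_cases by blast
  show "g \<in> central n \<Longrightarrow> unfold_perm n (transpose 0 1) \<circ> g \<in> central n" for g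
    using perm_group.comp_mem[OF perm_group_central c] .
  show "g \<in> central n \<Longrightarrow> sign (bar n (unfold_perm n (transpose 0 1) \<circ> g)) = - sign (bar n g)" for g
    using sign_in_central(2)[OF c] bar_unfold_perm[OF p] by (simp add: sign_swap_id)
  have "unfold_perm n (transpose 0 1) \<circ> unfold_perm n (transpose 0 1) = unfold_perm n id"
    using unfold_perm_comp[OF p p] by simp
  then show "unfold_perm n (transpose 0 1) (unfold_perm n (transpose 0 1) x) = x" for x
    unfolding unfold_perm_id by (metis comp_apply id_apply)
qed

lemma card_both_kernel:
  assumes "2 \<le> n"
  shows "2 * card {g \<in> central n. sign (bar n g) = 1 \<and> sign g = 1} = card {g \<in> central n. sign (bar n g) = 1}"
proof -
  have "2 * card {g \<in> {g \<in> central n. sign (bar n g) = 1}. sign g = 1} = card {g \<in> central n. sign (bar n g) = 1}"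
  proof (rule half_card[where t = "flip n {0}"])
    show "finite {g \<in> central n. sign (bar n g) = 1}" using perm_group.finite_mem[OF perm_group_central] by simp
    show "sign g = 1 \<or> sign g = - 1" for g :: "nat \<Rightarrow> nat" using sign_cases by blast
    fix g assume g: "g \<in> {g \<in> central n. sign (bar n g) = 1}"
    show "flip n {0} \<circ> g \<in> {g \<in> central n. sign (bar n g) = 1}"
      using g perm_group.comp_mem[OF perm_group_central flip_central] bar_comp[OF flip_central] bar_flip by auto
    show "sign (flip n {0} \<circ> g) = - sign g"
      using g sign_in_central(1)[OF flip_central] sign_flip[of "{0}" n] assms by auto
  qed (rule flip_involution)
  then show ?thesis by (simp add: conj_assoc)
qed

lemma not_power_of_two:
  assumes "n mod 4 \<noteq> 0" "n \<noteq> 1" "n \<noteq> 2"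
  shows "\<nexists>k. (n::nat) = 2 ^ k"
proof
  assume "\<exists>k. n = 2 ^ k"
  then obtain k where k: "n = 2 ^ k" by blast
  consider "k = 0" | "k = 1" | j where "k = j + 2" by (metis One_nat_def add_2_eq_Suc' not0_implies_Suc)
  then show False using k assms by cases (auto simp: power_add)
qed

section \<open>Decks outside the exceptional sizes\<close>

definition bar_kernel :: "nat \<Rightarrow> (nat \<Rightarrow> nat) set" where
  "bar_kernel n = {g \<in> central n. sign (bar n g) = 1}"
definition both_kernel :: "nat \<Rightarrow> (nat \<Rightarrow> nat) set" where
  "both_kernel n = {g \<in> central n. sign (bar n g) = 1 \<and> sign g = 1}"

lemma kernels_eq:
  "kernel (B_group n) sign_img (sgn_bar n) = bar_kernel n"
  "kernel (B_group n) sign_img sign \<inter> kernel (B_group n) sign_img (sgn_bar n) = both_kernel n"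
  by (auto simp: kernel_def bar_kernel_def both_kernel_def sign_img_def sgn_bar_eq_sign_bar)

lemma sign_bar_id: "sign (bar n id) = 1" unfolding bar_id by (rule sign_id)

lemma perm_group_bar_kernel: "perm_group {0..<2 * n} (bar_kernel n)"
proof
  show "id \<in> bar_kernel n"
    unfolding bar_kernel_def using perm_group.id_mem[OF perm_group_central] sign_bar_id by blast
  fix p q assume "p \<in> bar_kernel n" "q \<in> bar_kernel n"
  then show "p \<circ> q \<in> bar_kernel n"
    unfolding bar_kernel_def using perm_group.comp_mem[OF perm_group_central] sign_in_central(2) by auto
qed (auto simp: bar_kernel_def central_permutes)

lemma perm_group_both_kernel: "perm_group {0..<2 * n} (both_kernel n)"
proof
  show "id \<in> both_kernel n"
    unfolding both_kernel_def using perm_group.id_mem[OF perm_group_central] sign_bar_id sign_id by blast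
  fix p q assume "p \<in> both_kernel n" "q \<in> both_kernel n"
  then show "p \<circ> q \<in> both_kernel n"
    unfolding both_kernel_def using perm_group.comp_mem[OF perm_group_central] sign_in_central by auto
qed (auto simp: both_kernel_def central_permutes)

lemma group_records:
  "LR_group n = (deck_group n) \<lparr>carrier := carrier (LR_group n)\<rparr>"
  "IO_group n = (deck_group n) \<lparr>carrier := carrier (IO_group n)\<rparr>"
  "B_group n = (deck_group n) \<lparr>carrier := carrier (B_group n)\<rparr>"
  by (simp_all add: LR_group_def IO_group_def subgroup_generated_def B_group_def)

lemma group_eqI:
  "carrier (LR_group n) = carrier (IO_group n) \<Longrightarrow> LR_group n = IO_group n"
  "carrier (IO_group n) = central n \<Longrightarrow> IO_group n = B_group n"
  "carrier (LR_group n) = central n \<Longrightarrow> LR_group n = B_group n"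
  by (metis group_records)+

text \<open>Such a group is determined by the values that the two sign homomorphisms take on it.\<close>

definition ample :: "nat \<Rightarrow> (nat \<Rightarrow> nat) set \<Rightarrow> bool" where
  "ample n M \<longleftrightarrow> covers n M \<and> both_kernel n \<subseteq> M"

lemma ample_IO:
  assumes "5 \<le> n" "n \<noteq> 6" "n \<noteq> 12" "\<nexists>k. n = 2 ^ k"
  shows "ample n (carrier (IO_group n))"
proof -
  have alt: "contains_alternating {..<n} (folded_group n)" using folded_contains_alternating assms by simp
  show ?thesis
    unfolding ample_def both_kernel_def
    using covers_IO even_part_mem[OF covers_IO alt even_flips_mem[OF covers_IO hull_IO assms]] by blast
qed

lemma ample_LR:
  assumes "5 \<le> n \<or> n = 3" "n \<noteq> 6" "n \<noteq> 12" "\<nexists>k. n = 2 ^ k"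
  shows "ample n (carrier (LR_group n))"
proof -
  have alt: "contains_alternating {..<n} (folded_group n)" using folded_contains_alternating assms by auto
  have "flip n T \<in> carrier (LR_group n)" if "T \<subseteq> {..<n}" "even (card T)" for T
    using that even_flips_mem[OF covers_LR hull_LR] even_flips_mem_3 assms by blast
  then show ?thesis
    unfolding ample_def both_kernel_def using covers_LR even_part_mem[OF covers_LR alt] by blast
qed

lemma ample_both:
  assumes "ample n M" "M \<subseteq> both_kernel n"
  shows "M = both_kernel n"
  using assms by (auto simp: ample_def)

lemma ample_same_signs:
  assumes "ample n M" "g \<in> central n" "h \<in> M" "sign h = sign g" "sign (bar n h) = sign (bar n g)"
  shows "g \<in> M"
  using same_signs_mem[of n M g h] assms by (auto simp: ample_def both_kernel_def)

lemma ample_bar: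
  assumes M: "ample n M" "M \<subseteq> bar_kernel n" and a: "a \<in> M" "sign a = - 1"
  shows "M = bar_kernel n"
proof
  show "bar_kernel n \<subseteq> M"
  proof
    fix g assume g: "g \<in> bar_kernel n"
    show "g \<in> M"
    proof (cases "sign g = 1")
      case True
      then show ?thesis using g M(1) by (auto simp: ample_def bar_kernel_def both_kernel_def)
    next
      case False
      then have "sign g = - 1" using sign_cases by blast
      then show ?thesis using ample_same_signs[OF M(1) _ a(1)] a M(2) g by (auto simp: bar_kernel_def)
    qed
  qed
qed (rule M(2))

lemma ample_full:
  assumes M: "ample n M" and a: "a \<in> M" "sign a = - 1" "sign (bar n a) = 1" and b: "b \<in> M" "sign (bar n b) = - 1"
  shows "M = central n"
proof
  show cen: "M \<subseteq> central n" using M by (auto simp: ample_def covers_def)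
  have pg: "perm_group {0..<2 * n} M" using M by (auto simp: ample_def covers_def)
  show "central n \<subseteq> M"
  proof
    fix g assume g: "g \<in> central n"
    have ab: "a \<circ> b \<in> M" using perm_group.comp_mem[OF pg] a b by blast
    have sab: "sign (a \<circ> b) = - sign b" "sign (bar n (a \<circ> b)) = - 1"
      using sign_in_central[of a n b] a b cen by auto
    have idM: "id \<in> M" using perm_group.id_mem[OF pg] .
    show "g \<in> M"
    proof (cases "sign (bar n g) = 1")
      case True
      then show ?thesis
        using ample_same_signs[OF M g idM] ample_same_signs[OF M g a(1)] a sign_cases[of g] sign_id sign_bar_id[of n]
        by metis
    next
      case False
      then have "sign (bar n g) = - 1" using sign_cases by blast
      then show ?thesis
        using ample_same_signs[OF M g b(1)] ample_same_signs[OF M g ab] b sab sign_cases[of g] sign_cases[of b]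
        by (metis minus_minus)
    qed
  qed
qed

lemma shuffle_mem:
  "left_shuffle n \<in> carrier (LR_group n)" "right_shuffle n \<in> carrier (LR_group n)"
  "in_shuffle n \<in> carrier (IO_group n)" "out_shuffle n \<in> carrier (IO_group n)"
  by (auto simp: carrier_LR carrier_IO intro: gen_by_incl)

lemma shuffle_central:
  "left_shuffle n \<in> central n" "right_shuffle n \<in> central n" "in_shuffle n \<in> central n" "out_shuffle n \<in> central n"
  using shuffles_in_B_group by auto

lemma card_kernels:
  assumes "2 \<le> n"
  shows "card (bar_kernel n) = fact n * 2 ^ (n - 1)" "card (both_kernel n) = fact n * 2 ^ (n - 2)"
proof -
  obtain j where j: "n = j + 2" using assms by (metis add.commute le_Suc_ex)
  show "card (bar_kernel n) = fact n * 2 ^ (n - 1)"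
    using card_sign_bar_kernel[OF assms] unfolding bar_kernel_def[symmetric] by (simp add: j)
  then show "card (both_kernel n) = fact n * 2 ^ (n - 2)"
    using card_both_kernel[OF assms] unfolding bar_kernel_def[symmetric] both_kernel_def[symmetric] by (simp add: j)
qed

theorem shuffle_group_0_mod_4:
  assumes "n mod 4 = 0" "n > 12" "\<nexists>k. n = 2 ^ k"
  shows "LR_group n = IO_group n \<and> carrier (LR_group n) = both_kernel n \<and> order (LR_group n) = fact n * 2 ^ (n - 2)"
proof -
  obtain k where k: "n = 4 * k" using assms(1) by auto
  have s: "sign (out_shuffle n) = 1" "sign (monge n) = 1" using signs_mod_4(1)[of k] k by auto
  have e: "even n" "even (n div 2)" using k by auto
  have si: "sign (in_shuffle n) = 1" "sign (bar n (in_shuffle n)) = 1" using s e by (simp_all add: sign_in sign_bar_in)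
  have "carrier (LR_group n) \<subseteq> both_kernel n"
    unfolding carrier_LR
    by (rule perm_group.gen_by_subset[OF perm_group_both_kernel])
      (use s si e shuffle_central sign_left_right in \<open>auto simp: both_kernel_def\<close>)
  then have LR: "carrier (LR_group n) = both_kernel n" using ample_both ample_LR assms by auto
  have "carrier (IO_group n) \<subseteq> both_kernel n"
    unfolding carrier_IO
    by (rule perm_group.gen_by_subset[OF perm_group_both_kernel])
      (use s si e shuffle_central bar_out in \<open>auto simp: both_kernel_def\<close>)
  then have "carrier (IO_group n) = both_kernel n" using ample_both ample_IO assms by auto
  then show ?thesis using LR group_eqI card_kernels assms by (simp add: order_def)
qed

theorem shuffle_group_1_mod_4:
  assumes "n mod 4 = 1" "n > 1"
  shows "LR_group n = IO_group n \<and> carrier (LR_group n) = bar_kernel n \<and> order (LR_group n) = fact n * 2 ^ (n - 1)"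
proof -
  obtain k where k: "n = 4 * k + 1" using assms(1) by (metis mult_div_mod_eq)
  have s: "sign (out_shuffle n) = 1" "sign (monge n) = 1" using signs_mod_4(2)[of k] k by auto
  have e: "odd n" "even (n div 2)" using k by auto
  have si: "sign (in_shuffle n) = - 1" "sign (bar n (in_shuffle n)) = 1" using s e by (simp_all add: sign_in sign_bar_in)
  have "n \<noteq> 6" "n \<noteq> 12" "n mod 4 \<noteq> 0" "n \<noteq> 1" "n \<noteq> 2" using assms by auto
  moreover have "5 \<le> n" using assms k by (cases "k = 0") auto
  ultimately have n: "5 \<le> n" "n \<noteq> 6" "n \<noteq> 12" "\<nexists>k. n = 2 ^ k" using not_power_of_two[of n] by blast+
  have subLR: "carrier (LR_group n) \<subseteq> bar_kernel n"
    unfolding carrier_LR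
    by (rule perm_group.gen_by_subset[OF perm_group_bar_kernel])
      (use s si e shuffle_central sign_left_right in \<open>auto simp: bar_kernel_def\<close>)
  have LR: "carrier (LR_group n) = bar_kernel n"
    by (rule ample_bar[OF ample_LR subLR shuffle_mem(2)]) (use n s e sign_left_right in auto)
  have subIO: "carrier (IO_group n) \<subseteq> bar_kernel n"
    unfolding carrier_IO
    by (rule perm_group.gen_by_subset[OF perm_group_bar_kernel])
      (use s si e shuffle_central bar_out in \<open>auto simp: bar_kernel_def\<close>)
  have "carrier (IO_group n) = bar_kernel n"
    by (rule ample_bar[OF ample_IO subIO shuffle_mem(3)]) (use n si in auto)
  then show ?thesis using LR group_eqI card_kernels n by (simp add: order_def)
qed

theorem shuffle_group_2_mod_4:
  assumes "n mod 4 = 2" "n > 6"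
  shows "LR_group n = IO_group n \<and> IO_group n = B_group n \<and> order (LR_group n) = fact n * 2 ^ n"
proof -
  obtain k where k: "n = 4 * k + 2" using assms(1) by (metis mult_div_mod_eq)
  have s: "sign (out_shuffle n) = - 1" "sign (monge n) = 1" using signs_mod_4(3)[of k] k by auto
  have e: "even n" "odd (n div 2)" using k by auto
  have si: "sign (in_shuffle n) = - 1" "sign (bar n (in_shuffle n)) = - 1" using s e by (simp_all add: sign_in sign_bar_in)
  have "n \<noteq> 6" "n \<noteq> 12" "n mod 4 \<noteq> 0" "n \<noteq> 1" "n \<noteq> 2" using assms by auto
  moreover have "5 \<le> n" using assms k by (cases "k = 0") auto
  ultimately have n: "5 \<le> n" "n \<noteq> 6" "n \<noteq> 12" "\<nexists>k. n = 2 ^ k" using not_power_of_two[of n] by blast+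
  have LR: "carrier (LR_group n) = central n"
    by (rule ample_full[OF ample_LR shuffle_mem(2) _ _ shuffle_mem(1)]) (use n s si e sign_left_right in auto)
  have IO: "carrier (IO_group n) = central n"
    by (rule ample_full[OF ample_IO shuffle_mem(4) _ _ shuffle_mem(3)]) (use n s si e bar_out in auto)
  show ?thesis using LR IO group_eqI card_central by (simp add: order_def)
qed

text \<open>The two signs agree on the in shuffle and on the out shuffle, which confines the
  group of these shuffles to a proper subgroup; on the left shuffle the two signs differ.\<close>

theorem shuffle_group_3_mod_4:
  assumes "n mod 4 = 3"
  shows "LR_group n = B_group n \<and> order (LR_group n) = fact n * 2 ^ n"
proof -
  obtain k where k: "n = 4 * k + 3" using assms(1) by (metis mult_div_mod_eq)
  have s: "sign (out_shuffle n) = - 1" "sign (monge n) = - 1" using signs_mod_4(4)[of k] k by auto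
  have "n = 2 * (2 * k + 1) + 1" using k by simp
  then have "n div 2 = 2 * k + 1" "odd n" by presburger+
  then have e: "odd n" "odd (n div 2)" by auto
  have si: "sign (in_shuffle n) = 1" "sign (bar n (in_shuffle n)) = 1" using s e by (simp_all add: sign_in sign_bar_in)
  have "n \<noteq> 6" "n \<noteq> 12" "n mod 4 \<noteq> 0" "n \<noteq> 1" "n \<noteq> 2" using assms by auto
  moreover have "5 \<le> n \<or> n = 3" using k by (cases "k = 0") auto
  ultimately have n: "5 \<le> n \<or> n = 3" "n \<noteq> 6" "n \<noteq> 12" "\<nexists>k. n = 2 ^ k" using not_power_of_two[of n] by blast+
  have "carrier (LR_group n) = central n"
    by (rule ample_full[OF ample_LR shuffle_mem(1) _ _ shuffle_mem(2)]) (use n s si e sign_left_right in auto)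
  then show ?thesis using group_eqI card_central by (simp add: order_def)
qed

section \<open>Internal semidirect products\<close>

text \<open>The factors are given by embeddings \<open>\<alpha>\<close> and
  \<open>\<beta>\<close>, and \<open>act h\<close> is conjugation by \<open>\<beta> h\<close>
  transported along \<open>\<alpha>\<close>. It is restricted to the carrier of \<open>N\<close>
  because automorphisms are extensional functions.\<close>

lemma semidirect_criterion:
  fixes G :: "('c \<Rightarrow> 'c) monoid" and N :: "'a monoid" and H :: "'b monoid"
  assumes M: "perm_group A M" and G: "carrier G = M" "\<And>p q. p \<otimes>\<^bsub>G\<^esub> q = p \<circ> q"
    and N: "group N" and H: "group H"
    and \<alpha>: "\<And>x. x \<in> carrier N \<Longrightarrow> \<alpha> x \<in> M" "\<And>x y. x \<in> carrier N \<Longrightarrow> y \<in> carrier N \<Longrightarrow> \<alpha> (x \<otimes>\<^bsub>N\<^esub> y) = \<alpha> x \<circ> \<alpha> y"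
      "inj_on \<alpha> (carrier N)"
    and \<beta>: "\<And>h. h \<in> carrier H \<Longrightarrow> \<beta> h \<in> M" "\<And>h k. h \<in> carrier H \<Longrightarrow> k \<in> carrier H \<Longrightarrow> \<beta> (h \<otimes>\<^bsub>H\<^esub> k) = \<beta> h \<circ> \<beta> k"
    and triv: "\<And>x h. x \<in> carrier N \<Longrightarrow> h \<in> carrier H \<Longrightarrow> \<alpha> x = \<beta> h \<Longrightarrow> h = \<one>\<^bsub>H\<^esub>"
    and normal: "\<And>x h. x \<in> carrier N \<Longrightarrow> h \<in> carrier H \<Longrightarrow> \<exists>y\<in>carrier N. \<beta> h \<circ> \<alpha> x = \<alpha> y \<circ> \<beta> h"
    and cover: "\<And>g. g \<in> M \<Longrightarrow> \<exists>x\<in>carrier N. \<exists>h\<in>carrier H. g = \<alpha> x \<circ> \<beta> h"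
  shows "iso_to_semidirect_product G N H"
proof -
  interpret perm_group A M by (rule M)
  interpret N: group N by (rule N)
  interpret H: group H by (rule H)
  have cancel: "p = q" if "p \<circ> \<beta> h = q \<circ> \<beta> h" "h \<in> carrier H" for p q h
  proof -
    have "\<beta> h \<circ> inv' (\<beta> h) = id" using bij_mem[OF \<beta>(1)[OF that(2)]] bij_is_surj surj_iff by blast
    moreover have "p \<circ> (\<beta> h \<circ> inv' (\<beta> h)) = q \<circ> (\<beta> h \<circ> inv' (\<beta> h))"
      using that(1) by (simp add: o_assoc)
    ultimately show ?thesis by simp
  qed
  have inj: "x = y" if "\<alpha> x = \<alpha> y" "x \<in> carrier N" "y \<in> carrier N" for x y
    using \<alpha>(3) that by (auto dest: inj_onD)
  define act where "act h x = (THE y. y \<in> carrier N \<and> \<beta> h \<circ> \<alpha> x = \<alpha> y \<circ> \<beta> h)" for h x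
  have actI: "act h x = y" if "h \<in> carrier H" "y \<in> carrier N" "\<beta> h \<circ> \<alpha> x = \<alpha> y \<circ> \<beta> h" for h x y
    unfolding act_def
  proof (rule the_equality)
    show "y \<in> carrier N \<and> \<beta> h \<circ> \<alpha> x = \<alpha> y \<circ> \<beta> h" using that by blast
    fix z assume z: "z \<in> carrier N \<and> \<beta> h \<circ> \<alpha> x = \<alpha> z \<circ> \<beta> h"
    then have "\<alpha> z \<circ> \<beta> h = \<alpha> y \<circ> \<beta> h" using that(3) by simp
    then have "\<alpha> z = \<alpha> y" by (rule cancel[OF _ that(1)])
    then show "z = y" using inj z that(2) by blast
  qed
  have act: "act h x \<in> carrier N" "\<beta> h \<circ> \<alpha> x = \<alpha> (act h x) \<circ> \<beta> h"
    if hx: "h \<in> carrier H" "x \<in> carrier N" for h x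
  proof -
    obtain y where y: "y \<in> carrier N" "\<beta> h \<circ> \<alpha> x = \<alpha> y \<circ> \<beta> h" using normal[OF hx(2,1)] by blast
    have "act h x = y" by (rule actI[OF hx(1) y])
    then show "act h x \<in> carrier N" "\<beta> h \<circ> \<alpha> x = \<alpha> (act h x) \<circ> \<beta> h" using y by simp_all
  qed
  have act_mult: "act h (x \<otimes>\<^bsub>N\<^esub> y) = act h x \<otimes>\<^bsub>N\<^esub> act h y"
    if "h \<in> carrier H" "x \<in> carrier N" "y \<in> carrier N" for h x y
  proof (rule actI)
    have "\<beta> h \<circ> \<alpha> (x \<otimes>\<^bsub>N\<^esub> y) = (\<beta> h \<circ> \<alpha> x) \<circ> \<alpha> y" using \<alpha>(2) that by (simp add: comp_assoc)
    also have "\<dots> = \<alpha> (act h x) \<circ> (\<beta> h \<circ> \<alpha> y)" using act(2) that by (simp add: comp_assoc)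
    also have "\<dots> = (\<alpha> (act h x) \<circ> \<alpha> (act h y)) \<circ> \<beta> h" using act(2) that by (simp add: comp_assoc)
    finally show "\<beta> h \<circ> \<alpha> (x \<otimes>\<^bsub>N\<^esub> y) = \<alpha> (act h x \<otimes>\<^bsub>N\<^esub> act h y) \<circ> \<beta> h"
      using \<alpha>(2) act(1) that by simp
  qed (use that act(1) in auto)
  have act_comp: "act (h \<otimes>\<^bsub>H\<^esub> k) x = act h (act k x)"
    if "h \<in> carrier H" "k \<in> carrier H" "x \<in> carrier N" for h k x
  proof (rule actI)
    have "\<beta> (h \<otimes>\<^bsub>H\<^esub> k) \<circ> \<alpha> x = \<beta> h \<circ> (\<beta> k \<circ> \<alpha> x)" using \<beta>(2) that by (simp add: comp_assoc)
    also have "\<dots> = (\<beta> h \<circ> \<alpha> (act k x)) \<circ> \<beta> k" using act(2) that by (simp add: comp_assoc)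
    also have "\<dots> = \<alpha> (act h (act k x)) \<circ> (\<beta> h \<circ> \<beta> k)" using act that by (simp add: comp_assoc)
    finally show "\<beta> (h \<otimes>\<^bsub>H\<^esub> k) \<circ> \<alpha> x = \<alpha> (act h (act k x)) \<circ> \<beta> (h \<otimes>\<^bsub>H\<^esub> k)"
      using \<beta>(2) that by simp
  qed (use that act(1) in auto)
  have "\<beta> \<one>\<^bsub>H\<^esub> \<circ> \<beta> \<one>\<^bsub>H\<^esub> = id \<circ> \<beta> \<one>\<^bsub>H\<^esub>" using \<beta>(2)[of "\<one>\<^bsub>H\<^esub>" "\<one>\<^bsub>H\<^esub>"] by simp
  then have \<beta>1: "\<beta> \<one>\<^bsub>H\<^esub> = id" by (rule cancel) simp
  have act_one: "act \<one>\<^bsub>H\<^esub> x = x" if "x \<in> carrier N" for x by (rule actI) (use that \<beta>1 in auto)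
  define \<theta> where "\<theta> h = (\<lambda>x\<in>carrier N. act h x)" for h
  have \<theta>Bij: "\<theta> h \<in> Bij (carrier N)" if "h \<in> carrier H" for h
  proof -
    have "bij_betw (act h) (carrier N) (carrier N)"
      by (rule bij_betwI[where g = "act (inv\<^bsub>H\<^esub> h)"])
        (use that act(1) act_comp[symmetric] act_one in auto)
    then show ?thesis unfolding Bij_def \<theta>_def by (simp add: bij_betw_restrict_eq)
  qed
  have \<theta>auto: "\<theta> h \<in> auto N" if "h \<in> carrier H" for h
    unfolding auto_def using \<theta>Bij[OF that] act act_mult that by (auto simp: hom_def \<theta>_def)
  have \<theta>hom: "\<theta> \<in> hom H (AutoGroup N)"
    unfolding hom_def
  proof (intro CollectI conjI ballI funcsetI)
    fix h assume "h \<in> carrier H"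
    then show "\<theta> h \<in> carrier (AutoGroup N)" using \<theta>auto by (simp add: AutoGroup_def)
  next
    fix h k assume hk: "h \<in> carrier H" "k \<in> carrier H"
    have "\<theta> (h \<otimes>\<^bsub>H\<^esub> k) = compose (carrier N) (\<theta> h) (\<theta> k)"
      using hk act_comp act by (auto simp: \<theta>_def compose_def restrict_def)
    then show "\<theta> (h \<otimes>\<^bsub>H\<^esub> k) = \<theta> h \<otimes>\<^bsub>AutoGroup N\<^esub> \<theta> k"
      using \<theta>Bij hk by (simp add: AutoGroup_def BijGroup_def)
  qed
  let ?S = "semidirect_product N H \<theta>"
  define \<psi> where "\<psi> = (\<lambda>(x, h). \<alpha> x \<circ> \<beta> h)"
  have carS: "carrier ?S = carrier N \<times> carrier H" by (simp add: semidirect_product_def)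
  have multS: "(x, h) \<otimes>\<^bsub>?S\<^esub> (y, k) = (x \<otimes>\<^bsub>N\<^esub> \<theta> h y, h \<otimes>\<^bsub>H\<^esub> k)" for x h y k
    by (simp add: semidirect_product_def)
  have closed: "u \<otimes>\<^bsub>?S\<^esub> v \<in> carrier ?S" if "u \<in> carrier ?S" "v \<in> carrier ?S" for u v
    using that act(1) by (cases u; cases v) (auto simp: carS multS \<theta>_def)
  have \<psi>mult: "\<psi> (u \<otimes>\<^bsub>?S\<^esub> v) = \<psi> u \<circ> \<psi> v" if "u \<in> carrier ?S" "v \<in> carrier ?S" for u v
  proof -
    obtain x h y k where uv: "u = (x, h)" "v = (y, k)" by (cases u; cases v) auto
    then have c: "x \<in> carrier N" "h \<in> carrier H" "y \<in> carrier N" "k \<in> carrier H" using that by (auto simp: carS)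
    have "\<psi> (u \<otimes>\<^bsub>?S\<^esub> v) = \<alpha> x \<circ> (\<alpha> (act h y) \<circ> \<beta> h) \<circ> \<beta> k"
      using c \<alpha>(2) \<beta>(2) act(1) by (simp add: uv multS \<psi>_def \<theta>_def comp_assoc)
    also have "\<dots> = \<alpha> x \<circ> (\<beta> h \<circ> \<alpha> y) \<circ> \<beta> k" using act(2) c by simp
    finally show ?thesis by (simp add: uv \<psi>_def comp_assoc)
  qed
  have \<psi>inj: "inj_on \<psi> (carrier ?S)"
  proof (rule inj_onI)
    fix u v assume uv: "u \<in> carrier ?S" "v \<in> carrier ?S" "\<psi> u = \<psi> v"
    obtain x h y k where e: "u = (x, h)" "v = (y, k)" by (cases u; cases v) auto
    have c: "x \<in> carrier N" "h \<in> carrier H" "y \<in> carrier N" "k \<in> carrier H" using uv e by (auto simp: carS)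
    have eq: "\<alpha> x \<circ> \<beta> h = \<alpha> y \<circ> \<beta> k" using uv e by (simp add: \<psi>_def)
    let ?y = "inv\<^bsub>N\<^esub> y" and ?h = "inv\<^bsub>H\<^esub> h"
    have "\<alpha> \<one>\<^bsub>N\<^esub> \<circ> \<alpha> \<one>\<^bsub>N\<^esub> = \<alpha> \<one>\<^bsub>N\<^esub>" using \<alpha>(2)[of "\<one>\<^bsub>N\<^esub>" "\<one>\<^bsub>N\<^esub>"] by simp
    moreover have "bij (\<alpha> \<one>\<^bsub>N\<^esub>)" using bij_mem \<alpha>(1) by simp
    ultimately have \<alpha>1: "\<alpha> \<one>\<^bsub>N\<^esub> = id" by (metis bij_is_surj comp_assoc comp_id surj_iff)
    have "\<alpha> ?y \<circ> (\<alpha> x \<circ> \<beta> h) \<circ> \<beta> ?h = \<alpha> ?y \<circ> (\<alpha> y \<circ> \<beta> k) \<circ> \<beta> ?h" using eq by simp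
    then have "(\<alpha> ?y \<circ> \<alpha> x) \<circ> (\<beta> h \<circ> \<beta> ?h) = (\<alpha> ?y \<circ> \<alpha> y) \<circ> (\<beta> k \<circ> \<beta> ?h)" by (simp add: comp_assoc)
    then have "\<alpha> (?y \<otimes>\<^bsub>N\<^esub> x) = \<beta> (k \<otimes>\<^bsub>H\<^esub> ?h)"
      using c \<alpha>(2)[symmetric] \<beta>(2)[symmetric] \<alpha>1 \<beta>1 by simp
    then have "k \<otimes>\<^bsub>H\<^esub> ?h = \<one>\<^bsub>H\<^esub>"
      using triv[of "?y \<otimes>\<^bsub>N\<^esub> x" "k \<otimes>\<^bsub>H\<^esub> ?h"] c by auto
    then have kh: "k = h" using c H.inv_solve_right' by (metis H.inv_closed H.inv_equality H.inv_inv)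
    then have "\<alpha> x = \<alpha> y" using eq cancel c by blast
    then show "u = v" using inj c kh e by simp
  qed
  have \<psi>im: "\<psi> ` carrier ?S = M"
  proof
    show "\<psi> ` carrier ?S \<subseteq> M" using comp_mem \<alpha>(1) \<beta>(1) by (auto simp: carS \<psi>_def)
    show "M \<subseteq> \<psi> ` carrier ?S"
    proof
      fix g assume "g \<in> M"
      then obtain x h where "x \<in> carrier N" "h \<in> carrier H" "g = \<alpha> x \<circ> \<beta> h" using cover by blast
      then show "g \<in> \<psi> ` carrier ?S" by (intro image_eqI[of _ _ "(x, h)"]) (auto simp: \<psi>_def carS)
    qed
  qed
  define \<gamma> where "\<gamma> = inv_into (carrier ?S) \<psi>"
  have \<gamma>: "\<gamma> (\<psi> u) = u" if "u \<in> carrier ?S" for u using \<psi>inj that by (simp add: \<gamma>_def)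
  have bb: "bij_betw \<psi> (carrier ?S) M" using \<psi>inj \<psi>im by (simp add: bij_betw_def)
  have "\<gamma> \<in> iso G ?S"
    unfolding iso_def hom_def
  proof (intro CollectI conjI ballI funcsetI)
    show "bij_betw \<gamma> (carrier G) (carrier ?S)" unfolding \<gamma>_def G(1) using bij_betw_inv_into[OF bb] .
    fix p assume p: "p \<in> carrier G"
    then obtain u where u: "u \<in> carrier ?S" "p = \<psi> u" using \<psi>im G by blast
    then show "\<gamma> p \<in> carrier ?S" using \<gamma> by simp
    fix q assume "q \<in> carrier G"
    then obtain v where v: "v \<in> carrier ?S" "q = \<psi> v" using \<psi>im G by blast
    have "p \<otimes>\<^bsub>G\<^esub> q = \<psi> (u \<otimes>\<^bsub>?S\<^esub> v)" using \<psi>mult u v G(2) by simp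
    then show "\<gamma> (p \<otimes>\<^bsub>G\<^esub> q) = \<gamma> p \<otimes>\<^bsub>?S\<^esub> \<gamma> q" using \<gamma> closed u v by simp
  qed
  then show ?thesis unfolding iso_to_semidirect_product_def is_iso_def using \<theta>hom by blast
qed

lemma LR_mult: "p \<otimes>\<^bsub>LR_group n\<^esub> q = p \<circ> q"
  by (simp add: LR_group_def deck_group_def)

lemma group_Z2_power: "group (Z2_power k)"
  unfolding Z2_power_def by (intro product_group) (rule group_integer_mod_group)

lemma Z2_power_simps:
  "carrier (Z2_power k) = {..<k} \<rightarrow>\<^sub>E {0, 1}"
  "x \<otimes>\<^bsub>Z2_power k\<^esub> y = (\<lambda>i\<in>{..<k}. (x i + y i) mod 2)"
proof -
  have "{0..<2::int} = {0, 1}" by auto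
  then show "carrier (Z2_power k) = {..<k} \<rightarrow>\<^sub>E {0, 1}"
    by (simp add: Z2_power_def carrier_integer_mod_group)
  show "x \<otimes>\<^bsub>Z2_power k\<^esub> y = (\<lambda>i\<in>{..<k}. (x i + y i) mod 2)"
    by (simp add: Z2_power_def product_group_def integer_mod_group_def)
qed

lemma Z2_power_val: "x \<in> carrier (Z2_power k) \<Longrightarrow> i < k \<Longrightarrow> x i = 0 \<or> x i = 1"
  unfolding Z2_power_simps by (auto simp: PiE_iff)

lemma Z2_power_eqI:
  assumes "x \<in> carrier (Z2_power k)" "y \<in> carrier (Z2_power k)" "\<And>i. i < k \<Longrightarrow> x i = 1 \<longleftrightarrow> y i = 1"
  shows "x = y"
proof (rule PiE_ext[of x "{..<k}" "\<lambda>_. {0, 1}" y])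
  fix i assume "i \<in> {..<k}"
  then show "x i = y i" using Z2_power_val[OF assms(1), of i] Z2_power_val[OF assms(2), of i] assms(3)[of i] by auto
qed (use assms in \<open>simp_all add: Z2_power_simps\<close>)

lemma Z2_power_mult_one:
  assumes "x \<in> carrier (Z2_power k)" "y \<in> carrier (Z2_power k)" "i < k"
  shows "(x \<otimes>\<^bsub>Z2_power k\<^esub> y) i = 1 \<longleftrightarrow> (x i = 1) \<noteq> (y i = 1)"
  using Z2_power_val[OF assms(1,3)] Z2_power_val[OF assms(2,3)] assms(3) by (auto simp: Z2_power_simps)

section \<open>Decks of size a power of two\<close>

unbundle bit_operations_syntax

definition xor_perm :: "nat \<Rightarrow> nat \<Rightarrow> nat \<Rightarrow> nat" where
  "xor_perm k v x = (if x < 2 ^ k then v XOR x else x)"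

lemma xor_less: "a < 2 ^ k \<Longrightarrow> b < 2 ^ k \<Longrightarrow> a XOR b < (2 ^ k :: nat)"
  by (metis take_bit_nat_eq_self take_bit_nat_less_exp take_bit_xor)

lemma xor_perm_comp: "v < 2 ^ k \<Longrightarrow> w < 2 ^ k \<Longrightarrow> xor_perm k v \<circ> xor_perm k w = xor_perm k (v XOR w)"
  by (auto simp: fun_eq_iff xor_perm_def xor_less xor.assoc)

lemma mask_xor: "x < 2 ^ k \<Longrightarrow> (2 ^ k - 1) XOR x = 2 ^ k - 1 - (x :: nat)"
proof (induction k arbitrary: x)
  case (Suc k)
  obtain q where "(2::nat) ^ k = Suc q" using gr0_implies_Suc[of "2 ^ k"] by auto
  then have d: "(2 ^ Suc k - 1) div 2 = (2 ^ k - 1 :: nat)" "odd (2 ^ Suc k - 1 :: nat)" by auto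
  have "x div 2 < 2 ^ k" using Suc.prems by simp
  then have IH: "(2 ^ k - 1) XOR (x div 2) = 2 ^ k - 1 - x div 2" by (rule Suc.IH)
  have "(2 ^ Suc k - 1) XOR x = of_bool (even x) + 2 * ((2 ^ k - 1) XOR (x div 2))"
    by (subst xor_rec) (simp only: d, simp)
  also have "\<dots> = 2 ^ Suc k - 1 - x" unfolding IH using Suc.prems by (cases "even x") (auto elim!: evenE oddE)
  finally show ?case .
qed simp

text \<open>Positions are bit vectors of length \<open>k\<close>. The out shuffle rotates the
  bits, the in shuffle rotates them and inverts the lowest one, and the mirror inverts all of
  them.\<close>

locale binary_deck =
  fixes k n :: nat
  assumes k: "0 < k" and n: "2 * n = 2 ^ k"
begin

lemma one_less: "1 < (2::nat) ^ k"
  using one_less_power[of "2::nat" k] k by simp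

lemma n_pow: "n = 2 ^ (k - 1)"
  using n k by (cases k) auto

abbreviation rot where "rot \<equiv> out_shuffle n"

lemma rot_eq: "x < 2 ^ k \<Longrightarrow> rot x = 2 * (x mod n) + x div n"
proof -
  assume x: "x < 2 ^ k"
  have n0: "0 < n" by (simp add: n_pow)
  show ?thesis
  proof (cases "x < n")
    case False
    then have "x mod n = x - n" "x div n = 1" using x n n0
      by (simp_all add: le_mod_geq le_div_geq)
    then show ?thesis using False x n by (simp add: out_shuffle_def)
  qed (use x n in \<open>simp add: out_shuffle_def\<close>)
qed

lemma rot_bits: "x < 2 ^ k \<Longrightarrow> bit (rot x) 0 = bit x (k - 1)" "x < 2 ^ k \<Longrightarrow> bit (rot x) (Suc i) \<longleftrightarrow> i < k - 1 \<and> bit x i"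
proof -
  assume x: "x < 2 ^ k"
  have d: "x div n < 2" using x n by (simp add: less_mult_imp_div_less)
  have "bit x (k - 1) \<longleftrightarrow> odd (x div n)" by (simp add: bit_iff_odd n_pow)
  then show "bit (rot x) 0 = bit x (k - 1)" using d rot_eq[OF x] by (simp add: bit_0)
  have "rot x div 2 = take_bit (k - 1) x" using rot_eq[OF x] d by (simp add: take_bit_eq_mod n_pow)
  then show "bit (rot x) (Suc i) \<longleftrightarrow> i < k - 1 \<and> bit x i" by (simp add: bit_Suc bit_take_bit_iff)
qed

lemma rot_xor: "x < 2 ^ k \<Longrightarrow> y < 2 ^ k \<Longrightarrow> rot (x XOR y) = rot x XOR rot y"
proof (rule bit_eqI)
  fix i assume xy: "x < 2 ^ k" "y < 2 ^ k"
  show "bit (rot (x XOR y)) i \<longleftrightarrow> bit (rot x XOR rot y) i"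
    using rot_bits[OF xy(1)] rot_bits[OF xy(2)] rot_bits[OF xor_less[OF xy]]
    by (cases i) (auto simp: bit_xor_iff)
qed

lemma rot_less: "x < 2 ^ k \<Longrightarrow> rot x < 2 ^ k"
  using permutes_in_image[OF out_shuffle_permutes, of n x] n by simp

lemma rot_pow_less: "x < 2 ^ k \<Longrightarrow> (rot ^^ j) x < 2 ^ k"
  by (induction j) (auto simp: rot_less)

lemma rot_pow_xor: "x < 2 ^ k \<Longrightarrow> y < 2 ^ k \<Longrightarrow> (rot ^^ j) (x XOR y) = (rot ^^ j) x XOR (rot ^^ j) y"
  by (induction j) (auto simp: rot_xor rot_pow_less)

lemma bit_rot_pow: "x < 2 ^ k \<Longrightarrow> i < k \<Longrightarrow> bit ((rot ^^ j) x) ((i + j) mod k) = bit x i"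
proof (induction j)
  case (Suc j)
  let ?i = "(i + j) mod k" and ?y = "(rot ^^ j) x"
  have y: "?y < 2 ^ k" using rot_pow_less Suc by simp
  have "?i < k" using k by simp
  have "bit (rot ?y) (Suc ?i mod k) = bit ?y ?i"
  proof (cases "Suc ?i = k")
    case True
    then have "?i = k - 1" by simp
    then show ?thesis using rot_bits(1)[OF y] True by simp
  next
    case False
    then have "Suc ?i < k" using \<open>?i < k\<close> by simp
    then have "Suc ?i mod k = Suc ?i" "?i < k - 1" by (rule mod_less, linarith)
    then show ?thesis using rot_bits(2)[OF y, of ?i] by simp
  qed
  then show ?case using Suc by (simp add: mod_Suc_eq)
qed simp

lemma less_pow_bit: "x < 2 ^ k \<Longrightarrow> bit x i \<Longrightarrow> i < (k::nat)" for x :: nat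
  by (metis bit_take_bit_iff take_bit_nat_eq_self)

lemma rot_pow_k: "rot ^^ k = id"
proof (rule ext)
  fix x show "(rot ^^ k) x = id x"
  proof (cases "x < 2 ^ k")
    case True
    show ?thesis
    proof (rule bit_eqI)
      fix i show "bit ((rot ^^ k) x) i \<longleftrightarrow> bit (id x) i"
      proof (cases "i < k")
        case i: True then show ?thesis using bit_rot_pow[OF True i, of k] by simp
      next
        case False
        then show ?thesis using less_pow_bit[OF True] less_pow_bit[OF rot_pow_less[OF True]] by auto
      qed
    qed
  next
    case False
    have "(rot ^^ j) x = x" for j using False n by (induction j) (auto simp: out_shuffle_def)
    then show ?thesis by simp
  qed
qed

lemma rot_pow_one: "j < k \<Longrightarrow> (rot ^^ j) 1 = 2 ^ j"
proof (induction j)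
  case (Suc j)
  have "(2::nat) ^ j < n" unfolding n_pow using Suc by (intro power_strict_increasing) auto
  then show ?case using Suc by (simp add: out_shuffle_def)
qed simp

lemma rot_pow_mod: "rot ^^ (j mod k) = rot ^^ j"
proof -
  have "rot ^^ j = (rot ^^ k) ^^ (j div k) \<circ> rot ^^ (j mod k)"
    by (metis funpow_add funpow_mult mult_div_mod_eq)
  then show ?thesis unfolding rot_pow_k by simp
qed

lemma xor_perm_permutes: "v < 2 ^ k \<Longrightarrow> xor_perm k v permutes {0..<2 * n}"
  unfolding n
  by (rule bij_imp_permutes, rule bij_betwI[where g = "xor_perm k v"])
    (auto simp: xor_perm_def xor_less xor.assoc[symmetric])

lemma rot_conj_xor:
  assumes "v < 2 ^ k"
  shows "rot ^^ j \<circ> xor_perm k v = xor_perm k ((rot ^^ j) v) \<circ> rot ^^ j"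
proof (rule ext)
  fix x show "(rot ^^ j \<circ> xor_perm k v) x = (xor_perm k ((rot ^^ j) v) \<circ> rot ^^ j) x"
  proof (cases "x < 2 ^ k")
    case True
    then show ?thesis using assms rot_pow_xor rot_pow_less by (simp add: xor_perm_def)
  next
    case False
    have "(rot ^^ j) x = x" using False n by (induction j) (auto simp: out_shuffle_def)
    then show ?thesis using False by (simp add: xor_perm_def)
  qed
qed

lemma mirror_xor: "mirror n = xor_perm k (2 ^ k - 1)"
  using mask_xor[of _ k] by (auto simp: fun_eq_iff mirror_def n xor_perm_def)

lemma in_rot: "in_shuffle n = xor_perm k 1 \<circ> rot"
proof (rule deck_ext)
  note one = one_less
  show "xor_perm k 1 \<circ> rot permutes {0..<2 * n}"
    by (rule permutes_compose[OF out_shuffle_permutes xor_perm_permutes[OF one]])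
  fix x assume x: "x < 2 * n"
  have "rot x < 2 ^ k" using x n rot_less by simp
  then have r: "(xor_perm k 1 \<circ> rot) x = 1 XOR rot x" by (simp add: xor_perm_def)
  show "in_shuffle n x = (xor_perm k 1 \<circ> rot) x"
  proof -
    have "1 XOR a = (if even a then Suc a else a - 1)" for a :: nat using one_xor_eq[of a] by simp
    then show ?thesis unfolding r using x by (cases "x < n") (auto simp: in_shuffle_def out_shuffle_def)
  qed
qed (rule in_shuffle_permutes)

definition affine :: "(nat \<Rightarrow> nat) set" where
  "affine = {xor_perm k v \<circ> rot ^^ j | v j. v < 2 ^ k}"

lemma affineI: "v < 2 ^ k \<Longrightarrow> xor_perm k v \<circ> rot ^^ j \<in> affine"
  unfolding affine_def by blast

lemma rot_pow_affine: "rot ^^ j \<in> affine"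
proof -
  have "rot ^^ j = xor_perm k 0 \<circ> rot ^^ j" by (auto simp: xor_perm_def)
  then show ?thesis using affineI[of 0 j] by simp
qed

lemma perm_group_affine: "perm_group {0..<2 * n} affine"
proof
  have rp: "rot ^^ j permutes {0..<2 * n}" for j
    by (rule permutes_funpow[OF out_shuffle_permutes])
  show "p permutes {0..<2 * n}" if "p \<in> affine" for p
    using that permutes_compose[OF rp xor_perm_permutes] by (auto simp: affine_def)
  show "id \<in> affine" using rot_pow_affine[of 0] unfolding funpow_0 id_def[symmetric] by (simp only: funpow.simps)
  fix p q assume "p \<in> affine" "q \<in> affine"
  then obtain v i w j where e: "p = xor_perm k v \<circ> rot ^^ i" "v < 2 ^ k" "q = xor_perm k w \<circ> rot ^^ j" "w < 2 ^ k"
    unfolding affine_def by blast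
  have "p \<circ> q = xor_perm k v \<circ> (rot ^^ i \<circ> xor_perm k w) \<circ> rot ^^ j" by (simp add: e comp_assoc)
  also have "\<dots> = (xor_perm k v \<circ> xor_perm k ((rot ^^ i) w)) \<circ> (rot ^^ i \<circ> rot ^^ j)"
    unfolding rot_conj_xor[OF e(4)] by (simp add: comp_assoc)
  also have "\<dots> = xor_perm k (v XOR (rot ^^ i) w) \<circ> rot ^^ (i + j)"
    using xor_perm_comp[OF e(2) rot_pow_less[OF e(4)]] by (simp add: funpow_add)
  finally show "p \<circ> q \<in> affine" unfolding affine_def using xor_less[OF e(2) rot_pow_less[OF e(4)]] by blast
qed simp

lemma hull_subset_affine: "shuffle_hull n \<subseteq> affine"
  unfolding shuffle_hull_def
proof (rule perm_group.gen_by_subset[OF perm_group_affine])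
  note one = one_less
  have 1: "rot \<in> affine" using rot_pow_affine[of 1] by simp
  have "in_shuffle n = xor_perm k 1 \<circ> rot ^^ 1" unfolding in_rot by simp
  then have 2: "in_shuffle n \<in> affine" unfolding affine_def using one by blast
  have "mirror n = xor_perm k (2 ^ k - 1) \<circ> rot ^^ 0" unfolding mirror_xor by simp
  then have 3: "mirror n \<in> affine" unfolding affine_def by fastforce
  show "{in_shuffle n, rot, mirror n} \<subseteq> affine" using 1 2 3 by blast
qed

text \<open>Rotations, possibly followed by the mirror, conjugate the inversion of one bit to
  the inversion of the next. The inversions of single bits generate all translations, among them
  the mirror, so that the rotation itself is in \<open>M\<close>.\<close>

lemma affine_subset:
  assumes M: "perm_group {0..<2 * n} M" and x1: "xor_perm k 1 \<in> M" and r: "rot \<in> M \<or> mirror n \<circ> rot \<in> M"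
  shows "affine \<subseteq> M"
proof -
  interpret perm_group "{0..<2 * n}" M by (rule M)
  have step: "xor_perm k (rot v) \<in> M" if "xor_perm k v \<in> M" "v < 2 ^ k" for v
    using r
  proof
    assume r: "rot \<in> M"
    have "rot \<circ> xor_perm k v = xor_perm k (rot v) \<circ> rot" using rot_conj_xor[OF that(2), of 1] by simp
    then have "rot \<circ> xor_perm k v \<circ> inv' rot = xor_perm k (rot v) \<circ> (rot \<circ> inv' rot)" by (simp add: comp_assoc)
    also have "\<dots> = xor_perm k (rot v)" using bij_mem[OF r] by (simp add: bij_is_surj surj_iff[THEN iffD1])
    finally show ?thesis using conj_mem[OF r that(1)] by simp
  next
    let ?m = "mirror n \<circ> rot"
    assume r: "?m \<in> M"
    have m: "2 ^ k - 1 < (2::nat) ^ k" by simp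
    have "?m \<circ> xor_perm k v = mirror n \<circ> (xor_perm k (rot v) \<circ> rot)"
      using rot_conj_xor[OF that(2), of 1] by (simp add: comp_assoc)
    also have "\<dots> = (mirror n \<circ> xor_perm k (rot v)) \<circ> rot" by (simp add: comp_assoc)
    also have "mirror n \<circ> xor_perm k (rot v) = xor_perm k (rot v) \<circ> mirror n"
      unfolding mirror_xor using xor_perm_comp[OF m rot_less[OF that(2)]] xor_perm_comp[OF rot_less[OF that(2)] m]
      by (simp add: xor.commute)
    finally have "?m \<circ> xor_perm k v = xor_perm k (rot v) \<circ> ?m" by (simp only: comp_assoc)
    then have "?m \<circ> xor_perm k v \<circ> inv' ?m = xor_perm k (rot v) \<circ> (?m \<circ> inv' ?m)" by (metis comp_assoc)
    also have "?m \<circ> inv' ?m = id" using bij_mem[OF r] bij_is_surj surj_iff by blast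
    finally have e: "?m \<circ> xor_perm k v \<circ> inv' ?m = xor_perm k (rot v) \<circ> id" .
    show ?thesis using conj_mem[OF r that(1)] unfolding e comp_id .
  qed
  have pow: "xor_perm k (2 ^ j) \<in> M" if "j < k" for j
    using that
  proof (induction j)
    case 0 then show ?case using x1 by simp
  next
    case (Suc j)
    have "(2::nat) ^ j < 2 ^ k" using Suc by simp
    moreover have "rot (2 ^ j) = 2 ^ Suc j" using rot_pow_one[of j] rot_pow_one[of "Suc j"] Suc by simp
    ultimately show ?case using step Suc by fastforce
  qed
  have all: "v < 2 ^ j \<Longrightarrow> xor_perm k v \<in> M" if "j \<le> k" for j v
    using that
  proof (induction j arbitrary: v)
    case 0
    have "xor_perm k 0 = id" by (auto simp: xor_perm_def)
    then show ?case using 0 id_mem by (metis less_one power_0)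
  next
    case (Suc j)
    have j: "(2::nat) ^ j < 2 ^ k" using Suc by simp
    have t: "take_bit j v < 2 ^ j" by simp
    then have tk: "take_bit j v < 2 ^ k" using j by linarith
    have tM: "xor_perm k (take_bit j v) \<in> M" using Suc.IH[OF t] Suc.prems by simp
    have eq: "v = take_bit j v XOR (if bit v j then 2 ^ j else 0)"
    proof (rule bit_eqI)
      fix i
      have "\<not> bit v i" if "i > j" 
        using Suc.prems(1) that by (metis bit_take_bit_iff not_less_eq take_bit_nat_eq_self)
      then show "bit v i \<longleftrightarrow> bit (take_bit j v XOR (if bit v j then 2 ^ j else 0)) i"
        by (cases i j rule: linorder_cases) (auto simp: bit_xor_iff bit_take_bit_iff bit_exp_iff)
    qed
    show ?case
    proof (cases "bit v j")
      case True
      have e: "xor_perm k v = xor_perm k (take_bit j v) \<circ> xor_perm k (2 ^ j)"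
        using eq True xor_perm_comp[OF tk j] by simp
      have "j < k" using Suc.prems by simp
      then show ?thesis unfolding e by (intro comp_mem tM pow)
    next
      case False
      then show ?thesis using eq tM by simp
    qed
  qed
  have "xor_perm k (2 ^ k - 1) \<in> M" using all[of k "2 ^ k - 1"] by simp
  then have "mirror n \<in> M" unfolding mirror_xor .
  then have "mirror n \<circ> (mirror n \<circ> rot) \<in> M" if "mirror n \<circ> rot \<in> M" using comp_mem that by blast
  moreover have "mirror n \<circ> (mirror n \<circ> rot) = rot" by (auto simp: mirror_mirror)
  ultimately have "rot \<in> M" using r by metis
  then show ?thesis unfolding affine_def using all[of k] comp_mem funpow_mem by auto
qed

lemma carriers_affine: "carrier (LR_group n) = affine" "carrier (IO_group n) = affine"
proof -
  note one = one_less
  have b: "bij rot" using out_shuffle_permutes permutes_bij by blast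
  have io: "in_shuffle n \<circ> inv' rot = xor_perm k 1"
  proof -
    have "in_shuffle n \<circ> inv' rot = xor_perm k 1 \<circ> (rot \<circ> inv' rot)" unfolding in_rot by (simp add: comp_assoc)
    then show ?thesis using b by (simp add: bij_is_surj surj_iff[THEN iffD1])
  qed
  interpret IO: perm_group "{0..<2 * n}" "carrier (IO_group n)" by (rule perm_group_IO)
  interpret LR: perm_group "{0..<2 * n}" "carrier (LR_group n)" by (rule perm_group_LR)
  have "xor_perm k 1 \<in> carrier (IO_group n)"
    unfolding io[symmetric] using IO.comp_mem IO.inv_mem shuffle_mem by blast
  then have "affine \<subseteq> carrier (IO_group n)" using affine_subset[OF perm_group_IO] shuffle_mem by blast
  then show "carrier (IO_group n) = affine" using IO_subset_hull hull_subset_affine by blast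
  have "inv' (left_shuffle n) \<circ> right_shuffle n = xor_perm k 1"
    unfolding shuffle_inverses(4) shuffle_inverses(1) io[symmetric]
    using central_mirror[OF shuffle_central(3)] by (auto simp: fun_eq_iff mirror_mirror)
  then have "xor_perm k 1 \<in> carrier (LR_group n)" using LR.comp_mem LR.inv_mem shuffle_mem by metis
  moreover have "mirror n \<circ> rot \<in> carrier (LR_group n)"
    unfolding shuffle_inverses(3)[symmetric] using LR.inv_mem shuffle_mem by blast
  ultimately have "affine \<subseteq> carrier (LR_group n)" using affine_subset[OF perm_group_LR] by blast
  then show "carrier (LR_group n) = affine" using LR_subset_hull hull_subset_affine by blast
qed

definition bits_nat :: "(nat \<Rightarrow> int) \<Rightarrow> nat" where
  "bits_nat f = horner_sum of_bool 2 (map (\<lambda>i. f i = 1) [0..<k])"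

lemma bits_nat_less: "bits_nat f < 2 ^ k"
  using horner_sum_of_bool_2_less[of "map (\<lambda>i. f i = 1) [0..<k]"] by (simp add: bits_nat_def)

lemma bit_bits_nat: "bit (bits_nat f) i \<longleftrightarrow> i < k \<and> f i = 1"
  by (auto simp: bits_nat_def bit_horner_sum_bit_iff)

theorem binary_shuffle_group:
  "LR_group n = IO_group n \<and> iso_to_semidirect_product (LR_group n) (Z2_power k) (integer_mod_group k)"
proof
  show "LR_group n = IO_group n" using carriers_affine group_eqI by metis
  have zk: "carrier (integer_mod_group k) = {0..<int k}" using k by (simp add: carrier_integer_mod_group)
  show "iso_to_semidirect_product (LR_group n) (Z2_power k) (integer_mod_group k)"
  proof (rule semidirect_criterion[OF perm_group_affine carriers_affine(1) LR_mult group_Z2_power group_integer_mod_group,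
        where \<alpha> = "\<lambda>f. xor_perm k (bits_nat f)" and \<beta> = "\<lambda>j. rot ^^ nat j"])
    fix x y assume xy: "x \<in> carrier (Z2_power k)" "y \<in> carrier (Z2_power k)"
    have "bits_nat (x \<otimes>\<^bsub>Z2_power k\<^esub> y) = bits_nat x XOR bits_nat y"
      by (rule bit_eqI) (auto simp: bit_xor_iff bit_bits_nat Z2_power_mult_one[OF xy])
    then show "xor_perm k (bits_nat (x \<otimes>\<^bsub>Z2_power k\<^esub> y)) = xor_perm k (bits_nat x) \<circ> xor_perm k (bits_nat y)"
      using xor_perm_comp[OF bits_nat_less bits_nat_less] by simp
  next
    fix x
    have "xor_perm k (bits_nat x) = xor_perm k (bits_nat x) \<circ> rot ^^ 0" by simp
    then show "xor_perm k (bits_nat x) \<in> affine" unfolding affine_def using bits_nat_less by blast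
  next
    show "inj_on (\<lambda>f. xor_perm k (bits_nat f)) (carrier (Z2_power k))"
    proof (rule inj_onI)
      fix x y assume xy: "x \<in> carrier (Z2_power k)" "y \<in> carrier (Z2_power k)"
        and eq: "xor_perm k (bits_nat x) = xor_perm k (bits_nat y)"
      have "bits_nat x = bits_nat y" using fun_cong[OF eq, of 0] by (simp add: xor_perm_def)
      then show "x = y" using bit_bits_nat by (intro Z2_power_eqI[OF xy]) metis
    qed
  next
    fix h
    show "rot ^^ nat h \<in> affine" by (rule rot_pow_affine)
  next
    fix h j assume hj: "h \<in> carrier (integer_mod_group k)" "j \<in> carrier (integer_mod_group k)"
    have "nat (h \<otimes>\<^bsub>integer_mod_group k\<^esub> j) = (nat h + nat j) mod k"
      using hj k unfolding zk by (simp add: integer_mod_group_def nat_mod_distrib nat_add_distrib)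
    then show "rot ^^ nat (h \<otimes>\<^bsub>integer_mod_group k\<^esub> j) = rot ^^ nat h \<circ> rot ^^ nat j"
      by (simp add: rot_pow_mod funpow_add)
  next
    fix x h assume x: "x \<in> carrier (Z2_power k)" and h: "h \<in> carrier (integer_mod_group k)"
      and eq: "xor_perm k (bits_nat x) = rot ^^ nat h"
    note one = one_less
    have "(rot ^^ j) 0 = 0" for j by (induction j) (auto simp: out_shuffle_def n_pow)
    then have "bits_nat x = 0" using fun_cong[OF eq, of 0] by (simp add: xor_perm_def)
    then have "(rot ^^ nat h) 1 = 1" using fun_cong[OF eq, of 1] one by (simp add: xor_perm_def)
    moreover have "nat h < k" using h unfolding zk by auto
    ultimately have "(2::nat) ^ nat h = 1" using rot_pow_one by metis
    then have "nat h = 0" by simp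
    then show "h = \<one>\<^bsub>integer_mod_group k\<^esub>" using h unfolding zk by (simp add: integer_mod_group_def)
  next
    have surj: "\<exists>y\<in>carrier (Z2_power k). bits_nat y = v" if "v < 2 ^ k" for v
    proof
      show "(\<lambda>i\<in>{..<k}. of_bool (bit v i)) \<in> carrier (Z2_power k)" by (auto simp: Z2_power_simps)
      show "bits_nat (\<lambda>i\<in>{..<k}. of_bool (bit v i)) = v"
        using less_pow_bit[OF that] by (intro bit_eqI) (auto simp: bit_bits_nat)
    qed
    {
      fix x h
      obtain y where "y \<in> carrier (Z2_power k)" "bits_nat y = (rot ^^ nat h) (bits_nat x)"
        using surj rot_pow_less[OF bits_nat_less] by blast
      then show "\<exists>y\<in>carrier (Z2_power k). rot ^^ nat h \<circ> xor_perm k (bits_nat x) = xor_perm k (bits_nat y) \<circ> rot ^^ nat h"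
        using rot_conj_xor[OF bits_nat_less] by metis
    }
    fix g assume "g \<in> affine"
    then obtain v j where g: "g = xor_perm k v \<circ> rot ^^ j" "v < 2 ^ k" unfolding affine_def by blast
    obtain y where y: "y \<in> carrier (Z2_power k)" "bits_nat y = v" using surj g by blast
    have "int (j mod k) \<in> carrier (integer_mod_group k)" unfolding zk using k by simp
    moreover have "g = xor_perm k (bits_nat y) \<circ> rot ^^ nat (int (j mod k))" using g y by (simp add: rot_pow_mod)
    ultimately show "\<exists>x\<in>carrier (Z2_power k). \<exists>h\<in>carrier (integer_mod_group k). g = xor_perm k (bits_nat x) \<circ> rot ^^ nat h"
      using y by blast
  qed
qed

end

section \<open>Splitting off the flips\<close>

lemma mirror_mem_eq_hull:
  assumes "M \<subseteq> shuffle_hull n" "perm_group {0..<2 * n} M" "mirror n \<in> M"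
    and mod: "\<And>g. g \<in> shuffle_hull n \<Longrightarrow> g \<in> M \<or> mirror n \<circ> g \<in> M"
  shows "M = shuffle_hull n"
proof
  show "shuffle_hull n \<subseteq> M"
  proof
    fix g assume g: "g \<in> shuffle_hull n"
    have "mirror n \<circ> (mirror n \<circ> g) = g" by (auto simp: mirror_mirror)
    then show "g \<in> M" using mod[OF g] perm_group.comp_mem[OF assms(2,3)] by metis
  qed
qed (rule assms(1))

lemma mirror_even_flip:
  assumes "even n" "\<And>T. T \<subseteq> {..<n} \<Longrightarrow> even (card T) \<Longrightarrow> flip n T \<in> M"
  shows "mirror n \<in> M"
  unfolding mirror_flip using assms by simp

text \<open>If \<open>M\<close> lacks the flip of \<open>S\<close>, it contains the flip of the
  complement. Either of them, composed with its conjugate by a lift of \<open>p\<close>, gives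
  the flip of the same set.\<close>

lemma flip_difference_mem:
  assumes cov: "covers n M" and mod: "\<And>g. g \<in> shuffle_hull n \<Longrightarrow> g \<in> M \<or> mirror n \<circ> g \<in> M"
    and S: "flip n S \<in> shuffle_hull n" "S \<subseteq> {..<n}" and p: "p \<in> folded_group n"
  shows "flip n ((S - p ` S) \<union> (p ` S - S)) \<in> M"
proof -
  interpret perm_group "{0..<2 * n}" M by (rule covers_perm_group[OF cov])
  obtain g where g: "g \<in> M" "p = bar n g" using p cov by (auto simp: covers_def)
  have gc: "g \<in> central n" using covers_central[OF cov g(1)] .
  have diff: "flip n ((U - p ` U) \<union> (p ` U - U)) \<in> M" if "flip n U \<in> M" "U \<subseteq> {..<n}" for U
    using comp_mem[OF that(1) conj_mem[OF g(1) that(1)]] unfolding flip_conj[OF gc that(2)] flip_flip g(2) .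
  show ?thesis
    using mod[OF S(1)]
  proof
    assume "mirror n \<circ> flip n S \<in> M"
    then have c: "flip n ({..<n} - S) \<in> M" using S(2) unfolding mirror_flip flip_flip by (simp add: Diff_eq_empty_iff[THEN iffD2])
    have "p permutes {..<n}" using g bar_permutes[OF gc] by simp
    then have "p ` ({..<n} - S) = {..<n} - p ` S" using permutes_image[of p] permutes_inj[of p] by (simp add: image_set_diff)
    moreover have "p ` S \<subseteq> {..<n}" using S(2) permutes_image[OF \<open>p permutes {..<n}\<close>] by blast
    ultimately have "(({..<n} - S) - p ` ({..<n} - S)) \<union> (p ` ({..<n} - S) - ({..<n} - S)) = (S - p ` S) \<union> (p ` S - S)"
      using S(2) by auto
    then show ?thesis using diff[OF c] by simp
  qed (use diff S in blast)
qed

text \<open>The flips are the kernel of \<open>bar n\<close>, and the lifts \<open>unfold_perm n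
  p\<close> form a complement when they belong to the group. The map \<open>T\<close> identifies
  \<open>N\<close> with the flips, and \<open>C\<close> identifies \<open>H\<close> with the
  folded group.\<close>

lemma shuffle_group_splits:
  fixes N :: "'a monoid" and H :: "'b monoid"
  assumes N: "group N" and H: "group H"
    and T: "\<And>x. x \<in> carrier N \<Longrightarrow> T x \<subseteq> {..<n} \<and> flip n (T x) \<in> carrier (LR_group n)" "inj_on T (carrier N)"
      "\<And>x y. x \<in> carrier N \<Longrightarrow> y \<in> carrier N \<Longrightarrow> T (x \<otimes>\<^bsub>N\<^esub> y) = (T x - T y) \<union> (T y - T x)"
      "\<And>S. S \<subseteq> {..<n} \<Longrightarrow> flip n S \<in> carrier (LR_group n) \<Longrightarrow> \<exists>x\<in>carrier N. T x = S"
    and C: "bij_betw C (carrier H) (folded_group n)"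
      "\<And>h k. h \<in> carrier H \<Longrightarrow> k \<in> carrier H \<Longrightarrow> C (h \<otimes>\<^bsub>H\<^esub> k) = C h \<circ> C k"
    and unf: "\<And>p. p \<in> folded_group n \<Longrightarrow> unfold_perm n p \<in> carrier (LR_group n)"
  shows "iso_to_semidirect_product (LR_group n) N H"
proof -
  let ?M = "carrier (LR_group n)"
  interpret perm_group "{0..<2 * n}" ?M by (rule perm_group_LR)
  interpret F: perm_group "{..<n}" "folded_group n" by (rule perm_group_folded)
  interpret H: group H by (rule H)
  have Cm: "C h \<in> folded_group n" if "h \<in> carrier H" for h using C(1) that by (auto simp: bij_betw_def)
  have Cp: "C h permutes {..<n}" if "h \<in> carrier H" for h using Cm[OF that] by (rule F.permutes)
  have C1: "C \<one>\<^bsub>H\<^esub> = id"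
  proof -
    have e: "C \<one>\<^bsub>H\<^esub> \<circ> C \<one>\<^bsub>H\<^esub> = C \<one>\<^bsub>H\<^esub>" using C(2)[of "\<one>\<^bsub>H\<^esub>" "\<one>\<^bsub>H\<^esub>"] by simp
    have b: "bij (C \<one>\<^bsub>H\<^esub>)" using F.bij_mem[OF Cm] by simp
    have "C \<one>\<^bsub>H\<^esub> (C \<one>\<^bsub>H\<^esub> x) = C \<one>\<^bsub>H\<^esub> x" for x using fun_cong[OF e, of x] by simp
    then have "C \<one>\<^bsub>H\<^esub> x = x" for x using bij_is_inj[OF b] by (auto dest: injD)
    then show ?thesis by auto
  qed
  have flip_inj: "S = U" if "flip n S = flip n U" "S \<subseteq> {..<n}" "U \<subseteq> {..<n}" for S U
  proof -
    have "x \<in> V \<longleftrightarrow> flip n V x \<noteq> x" if "x < n" for x V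
      using that mirror_neq[of x n] by (simp add: flip_def fold_pos_id)
    then show ?thesis using that by (metis lessThan_iff subset_antisym subset_iff)
  qed
  show ?thesis
  proof (rule semidirect_criterion[OF perm_group_LR refl LR_mult N H,
        where \<alpha> = "\<lambda>x. flip n (T x)" and \<beta> = "\<lambda>h. unfold_perm n (C h)"])
    show "inj_on (\<lambda>x. flip n (T x)) (carrier N)"
      using T(1,2) flip_inj by (meson inj_onI inj_onD)
  next
    fix x y assume "x \<in> carrier N" "y \<in> carrier N"
    then show "flip n (T (x \<otimes>\<^bsub>N\<^esub> y)) = flip n (T x) \<circ> flip n (T y)" unfolding flip_flip T(3)[OF \<open>x \<in> carrier N\<close> \<open>y \<in> carrier N\<close>] by simp
  next
    fix h k assume hk: "h \<in> carrier H" "k \<in> carrier H"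
    show "unfold_perm n (C (h \<otimes>\<^bsub>H\<^esub> k)) = unfold_perm n (C h) \<circ> unfold_perm n (C k)"
      unfolding C(2)[OF hk] by (rule unfold_perm_comp[OF Cp Cp]) (use hk in auto)
  next
    fix x h assume xh: "x \<in> carrier N" "h \<in> carrier H" "flip n (T x) = unfold_perm n (C h)"
    have "C h = id" using bar_unfold_perm[OF Cp[OF xh(2)]] xh(3) bar_flip by metis
    then show "h = \<one>\<^bsub>H\<^esub>" using C1 C(1) xh(2) unfolding bij_betw_def by (metis H.one_closed inj_onD)
  next
    fix x h assume xh: "x \<in> carrier N" "h \<in> carrier H"
    let ?u = "unfold_perm n (C h)"
    have uM: "?u \<in> ?M" using unf Cm xh by blast
    have uc: "?u \<in> central n" using unfold_perm_central[OF Cp[OF xh(2)]] .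
    have "?u \<circ> flip n (T x) \<circ> inv' ?u = flip n (bar n ?u ` T x)" by (rule flip_conj[OF uc]) (use T(1) xh in auto)
    moreover from this have "flip n (bar n ?u ` T x) \<in> ?M" using conj_mem[OF uM] T(1)[OF xh(1)] by metis
    moreover have "bar n ?u ` T x \<subseteq> {..<n}" using T(1)[OF xh(1)] bar_less[OF uc] by auto
    ultimately obtain y where y: "y \<in> carrier N" "?u \<circ> flip n (T x) \<circ> inv' ?u = flip n (T y)" using T(4) by metis
    have "?u \<circ> flip n (T x) = (?u \<circ> flip n (T x) \<circ> inv' ?u) \<circ> ?u"
      using bij_mem[OF uM] by (simp add: fun_eq_iff bij_is_inj)
    then show "\<exists>y\<in>carrier N. ?u \<circ> flip n (T x) = flip n (T y) \<circ> ?u" using y by metis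
  next
    fix g assume g: "g \<in> ?M"
    have gc: "g \<in> central n" using LR_subset_central g by blast
    have "bar n g \<in> folded_group n" using covers_LR g by (auto simp: covers_def)
    then obtain h where h: "h \<in> carrier H" "bar n g = C h" using C(1) by (auto simp: bij_betw_def)
    obtain S where S: "S \<subseteq> {..<n}" "g = flip n S \<circ> unfold_perm n (C h)" using central_decomposition[OF gc] h by auto
    have uM: "unfold_perm n (C h) \<in> ?M" using unf Cm h by blast
    have "flip n S = g \<circ> inv' (unfold_perm n (C h))"
      unfolding S(2) using bij_mem[OF uM] by (simp add: fun_eq_iff bij_is_surj surj_f_inv_f)
    then have "flip n S \<in> ?M" using comp_mem[OF g inv_mem[OF uM]] by simp
    then show "\<exists>x\<in>carrier N. \<exists>h\<in>carrier H. g = flip n (T x) \<circ> unfold_perm n (C h)" using T(4) S h by metis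
  qed (use T(1) unf Cm in auto)
qed

section \<open>Counting by stabilizers\<close>

definition transitive_on :: "'a set \<Rightarrow> ('a \<Rightarrow> 'a) set \<Rightarrow> bool" where
  "transitive_on A M \<longleftrightarrow> (\<forall>x\<in>A. \<forall>y\<in>A. \<exists>g\<in>M. g x = y)"

definition fixing :: "'a \<Rightarrow> ('a \<Rightarrow> 'a) set \<Rightarrow> ('a \<Rightarrow> 'a) set" where
  "fixing a M = {g \<in> M. g a = a}"

lemma perm_group_fixing:
  assumes "perm_group A M"
  shows "perm_group (A - {a}) (fixing a M)"
proof -
  interpret perm_group A M by (rule assms)
  show ?thesis
  proof
    show "p permutes A - {a}" if "p \<in> fixing a M" for p
      using that permutes by (auto simp: fixing_def intro: permutes_superset)
  qed (use finite_points id_mem comp_mem in \<open>auto simp: fixing_def\<close>)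
qed

lemma (in perm_group) transitive_from:
  assumes "\<And>y. y \<in> A \<Longrightarrow> \<exists>g\<in>M. g x = y"
  shows "transitive_on A M"
  unfolding transitive_on_def
proof (intro ballI)
  fix y z assume "y \<in> A" "z \<in> A"
  then obtain g h where gh: "g \<in> M" "g x = y" "h \<in> M" "h x = z" using assms by metis
  have "inv' g y = x" using bij_mem[OF gh(1)] gh(2) by (metis bij_inv_eq_iff)
  then have "(h \<circ> inv' g) y = z" using gh by simp
  then show "\<exists>g\<in>M. g y = z" using comp_mem[OF gh(3) inv_mem[OF gh(1)]] by blast
qed

lemma transitive_extend:
  assumes M: "perm_group A M" and a: "a \<in> A" and t: "t \<in> M" "t a \<noteq> a" and tr: "transitive_on (A - {a}) (fixing a M)"
  shows "transitive_on A M"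
proof -
  interpret perm_group A M by (rule M)
  have ta: "t a \<in> A - {a}" using permutes_in_image[OF permutes[OF t(1)], of a] a t by simp
  show ?thesis
  proof (rule transitive_from[of a])
    fix y assume y: "y \<in> A"
    show "\<exists>g\<in>M. g a = y"
    proof (cases "y = a")
      case True then show ?thesis using id_mem by (intro bexI[of _ id]) simp_all
    next
      case False
      then obtain g where g: "g \<in> M" "g (t a) = y" using tr ta y unfolding transitive_on_def fixing_def by blast
      then show ?thesis using comp_mem[OF g(1) t(1)] by (intro bexI[of _ "g \<circ> t"]) simp_all
    qed
  qed
qed

text \<open>A choice of elements taking \<open>a\<close> to each point identifies
  \<open>M\<close> with the product of \<open>A\<close> and the stabilizer of \<open>a\<close>.\<close>

lemma card_transitive:
  assumes M: "perm_group A M" and a: "a \<in> A" and tr: "transitive_on A M"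
  shows "card M = card A * card (fixing a M)"
proof -
  interpret perm_group A M by (rule M)
  define r where "r y = (SOME g. g \<in> M \<and> g a = y)" for y
  have r: "r y \<in> M \<and> r y a = y" if "y \<in> A" for y
  proof -
    have "\<exists>g. g \<in> M \<and> g a = y" using tr a that by (auto simp: transitive_on_def)
    then show ?thesis unfolding r_def by (rule someI_ex)
  qed
  have inA: "g a \<in> A" if "g \<in> M" for g using permutes_in_image[OF permutes[OF that], of a] a by simp
  have ri: "inv' (r y) (r y x) = x" "r y (inv' (r y) x) = x" if "y \<in> A" for x y
    using bij_mem[of "r y"] r[OF that] by (simp_all add: bij_is_inj bij_is_surj surj_f_inv_f)
  have "bij_betw (\<lambda>(y, g). r y \<circ> g) (A \<times> fixing a M) M"
  proof (rule bij_betwI[where g = "\<lambda>g. (g a, inv' (r (g a)) \<circ> g)"])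
    show "(\<lambda>(y, g). r y \<circ> g) \<in> A \<times> fixing a M \<rightarrow> M" using r comp_mem by (auto simp: fixing_def)
    show "(\<lambda>g. (g a, inv' (r (g a)) \<circ> g)) \<in> M \<rightarrow> A \<times> fixing a M"
    proof
      fix g assume g: "g \<in> M"
      have "inv' (r (g a)) (g a) = a" using ri(1)[OF inA[OF g], of a] r[OF inA[OF g]] by simp
      moreover have "inv' (r (g a)) \<circ> g \<in> M" using comp_mem inv_mem r[OF inA[OF g]] g by blast
      ultimately show "(g a, inv' (r (g a)) \<circ> g) \<in> A \<times> fixing a M" using inA[OF g] by (simp add: fixing_def)
    qed
    show "(\<lambda>g. (g a, inv' (r (g a)) \<circ> g)) ((\<lambda>(y, g). r y \<circ> g) u) = u" if u: "u \<in> A \<times> fixing a M" for u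
    proof -
      obtain y g where e: "u = (y, g)" "y \<in> A" "g \<in> M" "g a = a" using u by (auto simp: fixing_def)
      then have "(r y \<circ> g) a = y" using r by simp
      moreover have "inv' (r y) \<circ> (r y \<circ> g) = g" using ri(1)[OF e(2)] by auto
      ultimately show ?thesis using e(1) by simp
    qed
    show "(\<lambda>(y, g). r y \<circ> g) ((\<lambda>g. (g a, inv' (r (g a)) \<circ> g)) g) = g" if "g \<in> M" for g
      using ri(2)[OF inA[OF that]] by auto
  qed
  then show ?thesis using bij_betw_same_card by (metis card_cartesian_product)
qed

text \<open>Commuting with \<open>w\<close>, the permutation \<open>g\<close> preserves the set
  of fixed points of \<open>w\<close>, which is a single point.\<close>

lemma commuting_fixes:
  assumes comm: "\<And>x. x \<in> A \<Longrightarrow> g (w x) = w (g x)" and g: "\<And>x. x \<in> A \<Longrightarrow> g x \<in> A"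
    and w: "x0 \<in> A" "w x0 = x0" "\<And>x. x \<in> A \<Longrightarrow> w x = x \<Longrightarrow> x = x0"
  shows "g x0 = x0"
  using assms by metis

section \<open>Twelve cards\<close>

definition perm_of :: "nat list \<Rightarrow> nat \<Rightarrow> nat" where
  "perm_of xs x = (if x < length xs then xs ! x else x)"

lemma perm_of_permutes:
  assumes "distinct xs" "\<forall>y\<in>set xs. y < length xs"
  shows "perm_of xs permutes {..<length xs}"
proof (rule bij_imp_permutes)
  have "inj_on (perm_of xs) {..<length xs}"
    using assms(1) by (auto simp: inj_on_def perm_of_def nth_eq_iff_index_eq)
  moreover have "perm_of xs ` {..<length xs} \<subseteq> {..<length xs}" using assms(2) by (auto simp: perm_of_def)
  ultimately show "bij_betw (perm_of xs) {..<length xs} {..<length xs}"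
    by (simp add: bij_betw_def endo_inj_surj)
qed (simp add: perm_of_def)

lemma less_6_cases: "x < (6::nat) \<Longrightarrow> x = 0 \<or> x = Suc 0 \<or> x = 2 \<or> x = 3 \<or> x = 4 \<or> x = 5" by presburger

lemma perm_eq_6:
  fixes p q :: "nat \<Rightarrow> nat"
  assumes "p permutes {..<6}" "q permutes {..<6}" "p 0 = q 0" "p (Suc 0) = q (Suc 0)" "p 2 = q 2" "p 3 = q 3" "p 4 = q 4" "p 5 = q 5"
  shows "p = q"
  using assms less_6_cases by (intro permutes_eqI[of p 6 q]) metis+

lemma monge_6: "monge 6 0 = 0" "monge 6 (Suc 0) = 2" "monge 6 2 = 4" "monge 6 3 = 5" "monge 6 4 = 3" "monge 6 5 = Suc 0"
  by (simp_all add: monge_def)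

lemma rev_two_6: "rev_blocks 6 2 0 = Suc 0" "rev_blocks 6 2 (Suc 0) = 0" "rev_blocks 6 2 2 = 3" "rev_blocks 6 2 3 = 2"
  "rev_blocks 6 2 4 = 5" "rev_blocks 6 2 5 = 4"
  by (simp_all add: rev_blocks_def)

text \<open>Five perfect matchings of six points without common edges, that is, a
  one-factorization of the complete graph. The folded group permutes them, which makes it the
  symmetric group of degree five in its transitive action on six points. The entry at index
  \<open>0\<close> only serves to let \<open>matching i\<close> exchange \<open>0\<close> and
  \<open>i\<close>.\<close>

definition matching :: "nat \<Rightarrow> nat \<Rightarrow> nat" where
  "matching i = perm_of ([[0, 1, 2, 3, 4, 5], [1, 0, 5, 4, 3, 2], [2, 4, 0, 5, 1, 3], [3, 2, 1, 0, 5, 4], [4, 5, 3, 2, 0, 1], [5, 3, 4, 1, 2, 0]] ! i)"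

lemma matching_table:
  "matching (Suc 0) = perm_of [1, 0, 5, 4, 3, 2]" "matching 2 = perm_of [2, 4, 0, 5, 1, 3]"
  "matching 3 = perm_of [3, 2, 1, 0, 5, 4]" "matching 4 = perm_of [4, 5, 3, 2, 0, 1]"
  "matching 5 = perm_of [5, 3, 4, 1, 2, 0]"
  by (simp_all add: matching_def)

lemma five_cases: "i \<in> {1..5::nat} \<Longrightarrow> i = Suc 0 \<or> i = 2 \<or> i = 3 \<or> i = 4 \<or> i = 5"
  by (simp, presburger)

lemma matching_zero:
  assumes "i \<in> {1..5}"
  shows "matching i 0 = i"
  using five_cases[OF assms] by (elim disjE) (simp_all add: matching_table perm_of_def)

lemma perm_of_permutes_length:
  "length xs = n \<Longrightarrow> distinct xs \<Longrightarrow> \<forall>y\<in>set xs. y < n \<Longrightarrow> perm_of xs permutes {..<n}"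
  using perm_of_permutes by blast

lemma matching_permutes:
  assumes "i \<in> {1..5}"
  shows "matching i permutes {..<6}"
  using five_cases[OF assms]
  by (elim disjE) (simp_all only: matching_table, (rule perm_of_permutes_length; simp)+)

definition carries :: "(nat \<Rightarrow> nat) \<Rightarrow> (nat \<Rightarrow> nat) \<Rightarrow> bool" where
  "carries g t \<longleftrightarrow> t permutes {1..5} \<and> (\<forall>i\<in>{1..5}. g \<circ> matching i = matching (t i) \<circ> g)"

lemma carries_comp:
  assumes "carries g t" "carries h u"
  shows "carries (g \<circ> h) (t \<circ> u)"
  unfolding carries_def
proof (intro conjI ballI)
  show "t \<circ> u permutes {1..5}" using assms permutes_compose unfolding carries_def by blast
  fix i :: nat assume i: "i \<in> {1..5}"
  have ui: "u i \<in> {1..5}" using assms(2) permutes_in_image[of u "{1..5}" i] i unfolding carries_def by blast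
  have "g \<circ> h \<circ> matching i = g \<circ> (matching (u i) \<circ> h)" using assms(2) i by (simp add: carries_def comp_assoc)
  also have "\<dots> = (g \<circ> matching (u i)) \<circ> h" by (simp add: comp_assoc)
  also have "\<dots> = matching (t (u i)) \<circ> g \<circ> h" using assms(1) ui by (simp add: carries_def)
  finally show "g \<circ> h \<circ> matching i = matching ((t \<circ> u) i) \<circ> (g \<circ> h)" by (simp add: comp_assoc)
qed

lemma perm_of_permutes_5:
  assumes "length xs = 6" "xs ! 0 = 0" "distinct xs" "\<forall>y\<in>set xs. y < 6"
  shows "perm_of xs permutes {1..5}"
proof (rule permutes_superset)
  show "perm_of xs permutes {..<6}" using perm_of_permutes[of xs] assms by simp
  fix x :: nat assume "x \<in> {..<6} - {1..5}"
  then have "x = 0" by auto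
  then show "perm_of xs x = x" using assms by (simp add: perm_of_def)
qed

lemma carries_monge: "carries (monge 6) (perm_of [0, 2, 4, 5, 3, 1])"
  unfolding carries_def
proof (intro conjI ballI)
  show "perm_of [0, 2, 4, 5, 3, 1] permutes {1..5}"
    by (rule perm_of_permutes_5) (auto simp: less_Suc_eq)
  fix i :: nat assume i: "i \<in> {1..5}"
  have ti: "perm_of [0, 2, 4, 5, 3, 1] i \<in> {1..5}" using five_cases[OF i] by (elim disjE) (simp_all add: perm_of_def)
  show "monge 6 \<circ> matching i = matching (perm_of [0, 2, 4, 5, 3, 1] i) \<circ> monge 6"
  proof (rule perm_eq_6)
    show "monge 6 \<circ> matching i permutes {..<6}" by (rule permutes_compose[OF matching_permutes[OF i] monge_permutes])
    show "matching (perm_of [0, 2, 4, 5, 3, 1] i) \<circ> monge 6 permutes {..<6}"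
      by (rule permutes_compose[OF monge_permutes matching_permutes[OF ti]])
  qed (use five_cases[OF i] in \<open>elim disjE; simp add: matching_table perm_of_def monge_6\<close>)+
qed

lemma carries_rev_two: "carries (rev_blocks 6 2) (perm_of [0, 1, 5, 3, 4, 2])"
  unfolding carries_def
proof (intro conjI ballI)
  show "perm_of [0, 1, 5, 3, 4, 2] permutes {1..5}"
    by (rule perm_of_permutes_5) (auto simp: less_Suc_eq)
  fix i :: nat assume i: "i \<in> {1..5}"
  have ti: "perm_of [0, 1, 5, 3, 4, 2] i \<in> {1..5}" using five_cases[OF i] by (elim disjE) (simp_all add: perm_of_def)
  show "rev_blocks 6 2 \<circ> matching i = matching (perm_of [0, 1, 5, 3, 4, 2] i) \<circ> rev_blocks 6 2"
  proof (rule perm_eq_6)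
    show "rev_blocks 6 2 \<circ> matching i permutes {..<6}" by (rule permutes_compose[OF matching_permutes[OF i] rev_blocks_permutes])
    show "matching (perm_of [0, 1, 5, 3, 4, 2] i) \<circ> rev_blocks 6 2 permutes {..<6}"
      by (rule permutes_compose[OF rev_blocks_permutes matching_permutes[OF ti]])
  qed (use five_cases[OF i] in \<open>elim disjE; simp add: matching_table perm_of_def rev_two_6\<close>)+
qed

lemma carries_exists: "g \<in> folded_group 6 \<Longrightarrow> \<exists>t. carries g t"
  unfolding folded_group_def
proof (induction rule: gen_by.induct)
  case gen_id
  have "carries id id" unfolding carries_def using permutes_id by auto
  then show ?case by blast
next
  case (gen_step f g)
  then show ?case using carries_comp carries_monge carries_rev_two by blast
qed

lemma carries_unique:
  assumes g: "g permutes {..<6}" and t: "carries g t" and u: "carries g u"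
  shows "t = u"
proof (rule ext)
  fix i show "t i = u i"
  proof (cases "i \<in> {1..5}")
    case True
    have b: "g (inv' g x) = x" for x using permutes_bij[OF g] by (simp add: bij_is_surj surj_f_inv_f)
    have "matching (t i) \<circ> g = matching (u i) \<circ> g" using t u True by (simp add: carries_def)
    then have "matching (t i) 0 = matching (u i) 0" using b[of 0] by (metis comp_apply)
    moreover have "t permutes {1..5}" "u permutes {1..5}" using t u by (simp_all add: carries_def)
    then have "t i \<in> {1..5}" "u i \<in> {1..5}" using True by (simp_all only: permutes_in_image)
    ultimately show ?thesis using matching_zero by metis
  next
    case False
    then show ?thesis using t u unfolding carries_def by (metis permutes_not_in)
  qed
qed

lemma commutes_with_matchings:
  assumes e: "e permutes {..<6}" and comm: "\<And>i. i \<in> {1..5} \<Longrightarrow> e \<circ> matching i = matching i \<circ> e"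
  shows "e = id"
proof -
  have c: "e (matching i x) = matching i (e x)" if "i \<in> {1..5}" for i x
    using fun_cong[OF comm[OF that], of x] by simp
  \<comment> \<open>the product of four of the matchings moves every point but 3\<close>
  define w where "w = matching 4 \<circ> matching 3 \<circ> matching 2 \<circ> matching (Suc 0)"
  have wt: "w 0 = Suc 0" "w (Suc 0) = 5" "w 2 = 4" "w 3 = 3" "w 4 = 0" "w 5 = 2"
    by (simp_all add: w_def matching_table perm_of_def)
  have "e 3 = 3"
  proof (rule commuting_fixes[of "{..<6}" e w])
    show "e (w x) = w (e x)" for x by (simp add: w_def c)
    show "e x \<in> {..<6}" if "x \<in> {..<6}" for x using permutes_in_image[OF e] that by blast
    show "x = 3" if "x \<in> {..<6}" "w x = x" for x using less_6_cases[of x] that wt by auto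
  qed (use wt in auto)
  then have "e (matching i 3) = matching i 3" if "i \<in> {1..5}" for i using c[OF that] by simp
  from this[of 1] this[of 2] this[of 3] this[of 4] this[of 5]
  have "e 4 = 4" "e 5 = 5" "e 0 = 0" "e 2 = 2" "e (Suc 0) = Suc 0" by (simp_all add: matching_table perm_of_def)
  then show ?thesis using \<open>e 3 = 3\<close> by (intro perm_eq_6[OF e permutes_id]) simp_all
qed

text \<open>The quotient of two elements with the same action commutes with all five matchings.\<close>

lemma carries_inj:
  assumes g: "g permutes {..<6}" "carries g t" and h: "h permutes {..<6}" "carries h t"
  shows "g = h"
proof -
  have b: "inv' h \<circ> h = id" "h \<circ> inv' h = id" using permutes_inv_o[OF h(1)] by auto
  have "inv' h \<circ> g = id"
  proof (rule commutes_with_matchings)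
    show "inv' h \<circ> g permutes {..<6}" by (rule permutes_compose[OF g(1) permutes_inv[OF h(1)]])
    fix i :: nat assume i: "i \<in> {1..5}"
    have hi: "h \<circ> matching i = matching (t i) \<circ> h" and gi: "g \<circ> matching i = matching (t i) \<circ> g"
      using g h i by (auto simp: carries_def)
    have "inv' h \<circ> g \<circ> matching i = inv' h \<circ> (matching (t i) \<circ> (h \<circ> inv' h) \<circ> g)"
      using gi b by (simp add: comp_assoc)
    also have "\<dots> = inv' h \<circ> (matching (t i) \<circ> h) \<circ> (inv' h \<circ> g)" by (simp add: comp_assoc)
    also have "\<dots> = (inv' h \<circ> h) \<circ> (matching i \<circ> (inv' h \<circ> g))" unfolding hi[symmetric] by (simp only: comp_assoc)
    finally show "inv' h \<circ> g \<circ> matching i = matching i \<circ> (inv' h \<circ> g)" using b by simp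
  qed
  then have "h \<circ> (inv' h \<circ> g) = h" by simp
  then show ?thesis using b by (simp add: o_assoc)
qed

text \<open>The group is transitive, the stabilizer of \<open>0\<close> is transitive on the
  other five points, and in it that of \<open>3\<close> is transitive on the remaining four.\<close>

lemma card_folded_6: "120 \<le> card (folded_group 6)"
proof -
  let ?F = "folded_group 6" and ?A = "{..<6::nat}"
  let ?M1 = "fixing 0 ?F"
  let ?M2 = "fixing 3 ?M1"
  have P0: "perm_group ?A ?F" by (rule perm_group_folded)
  have P1: "perm_group (?A - {0}) ?M1" by (rule perm_group_fixing[OF P0])
  have P2: "perm_group (?A - {0} - {3}) ?M2" by (rule perm_group_fixing[OF P1])
  interpret perm_group ?A ?F by (rule P0)
  interpret P2: perm_group "?A - {0} - {3}" ?M2 by (rule P2)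
  define u where "u = rev_blocks 6 2 \<circ> monge 6 \<circ> monge 6 \<circ> rev_blocks 6 2 \<circ> monge 6 \<circ> rev_blocks 6 2"
  have ut: "u 0 = 0" "u (Suc 0) = 5" "u 2 = 4" "u 3 = 3" "u 4 = Suc 0" "u 5 = 2"
    by (simp_all add: u_def monge_6 rev_two_6)
  have "u \<in> ?F" unfolding u_def by (intro comp_mem monge_in_folded rev_two_in_folded)
  then have u: "u \<in> ?M2" using ut by (simp add: fixing_def)
  have t2: "transitive_on (?A - {0} - {3}) ?M2"
  proof (rule P2.transitive_from[of "Suc 0"])
    fix y :: nat assume "y \<in> ?A - {0} - {3}"
    then have "y = Suc 0 \<or> y = 2 \<or> y = 4 \<or> y = 5" using less_6_cases[of y] by auto
    then show "\<exists>g\<in>?M2. g (Suc 0) = y"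
    proof (elim disjE)
      assume "y = Suc 0" then show ?thesis by (intro bexI[of _ id] P2.id_mem) simp
    next
      assume "y = 2" then show ?thesis using ut by (intro bexI[of _ "u \<circ> u"] P2.comp_mem u) simp
    next
      assume "y = 4" then show ?thesis using ut by (intro bexI[of _ "u \<circ> u \<circ> u"] P2.comp_mem u) simp
    next
      assume "y = 5" then show ?thesis using ut u by (intro bexI[of _ u]) simp
    qed
  qed
  have m1: "monge 6 \<in> ?M1" using monge_in_folded monge_6 by (simp add: fixing_def)
  have t1: "transitive_on (?A - {0}) ?M1" by (rule transitive_extend[OF P1 _ m1 _ t2]) (simp_all add: monge_6)
  have t0: "transitive_on ?A ?F"
    by (rule transitive_extend[OF P0 _ rev_two_in_folded _ t1]) (simp_all add: rev_two_6)
  have "card ?F = 6 * card ?M1" using card_transitive[OF P0 _ t0, of 0] by simp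
  moreover have "card ?M1 = 5 * card ?M2" using card_transitive[OF P1 _ t1, of 3] by simp
  moreover have "card ?M2 = 4 * card (fixing (Suc 0) ?M2)" using card_transitive[OF P2 _ t2, of "Suc 0"] by simp
  moreover have "id \<in> fixing (Suc 0) ?M2" using P2.id_mem by (simp add: fixing_def)
  then have "1 \<le> card (fixing (Suc 0) ?M2)"
    using P2.finite_mem by (metis (no_types, lifting) One_nat_def Suc_leI card_gt_0_iff empty_iff fixing_def finite_subset mem_Collect_eq subsetI)
  ultimately show ?thesis by simp
qed

text \<open>The action on the matchings is faithful, and by its order the group exhausts the
  symmetric group.\<close>

lemma folded_6_iso:
  obtains C where "bij_betw C (carrier (sym_group 5)) (folded_group 6)"
    "\<And>h k. h \<in> carrier (sym_group 5) \<Longrightarrow> k \<in> carrier (sym_group 5) \<Longrightarrow> C (h \<otimes>\<^bsub>sym_group 5\<^esub> k) = C h \<circ> C k"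
proof -
  let ?F = "folded_group 6" and ?S = "carrier (sym_group 5)"
  interpret perm_group "{..<6}" ?F by (rule perm_group_folded)
  have S: "?S = {p. p permutes {1..5}}" by (auto simp: sym_group_def)
  define \<psi> where "\<psi> g = (SOME t. carries g t)" for g
  have \<psi>: "carries g (\<psi> g)" if "g \<in> ?F" for g
    unfolding \<psi>_def using carries_exists[OF that] by (rule someI_ex)
  have inj: "inj_on \<psi> ?F"
    by (rule inj_onI) (metis \<psi> carries_inj permutes)
  have sub: "\<psi> ` ?F \<subseteq> ?S" using \<psi> unfolding S carries_def by blast
  have fS: "finite ?S" unfolding S by (rule finite_permutations) simp
  have "card ?S = 120" unfolding S using card_permutations[of "{1..5::nat}" 5] by (simp add: fact_numeral)
  then have "card ?S \<le> card (\<psi> ` ?F)" using card_folded_6 card_image[OF inj] by simp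
  then have im: "\<psi> ` ?F = ?S" using card_seteq[OF fS sub] by blast
  have hom: "\<psi> (g \<circ> h) = \<psi> g \<circ> \<psi> h" if "g \<in> ?F" "h \<in> ?F" for g h
    by (rule carries_unique[OF permutes[OF comp_mem[OF that]] \<psi>[OF comp_mem[OF that]] carries_comp[OF \<psi>[OF that(1)] \<psi>[OF that(2)]]])
  define C where "C = inv_into ?F \<psi>"
  have bb: "bij_betw \<psi> ?F ?S" using inj im by (simp add: bij_betw_def)
  have bC: "bij_betw C ?S ?F" unfolding C_def by (rule bij_betw_inv_into[OF bb])
  have C: "\<psi> (C h) = h" "C h \<in> ?F" if "h \<in> ?S" for h
    using that bC bij_betw_inv_into_right[OF bb that] unfolding C_def by (auto simp: bij_betw_def)
  have "C (h \<otimes>\<^bsub>sym_group 5\<^esub> k) = C h \<circ> C k" if "h \<in> ?S" "k \<in> ?S" for h k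
  proof -
    have "\<psi> (C h \<circ> C k) = h \<otimes>\<^bsub>sym_group 5\<^esub> k" using hom C that by (simp add: sym_group_mult)
    then have "C (h \<otimes>\<^bsub>sym_group 5\<^esub> k) = C (\<psi> (C h \<circ> C k))" by simp
    also have "\<dots> = C h \<circ> C k" unfolding C_def[of] by (rule inv_into_f_f[OF inj]) (use comp_mem C that in \<open>auto simp: C_def\<close>)
    finally show ?thesis .
  qed
  then show ?thesis using that bC by blast
qed

definition one_positions :: "nat \<Rightarrow> (nat \<Rightarrow> int) \<Rightarrow> nat set" where
  "one_positions k x = {i. i < k \<and> x i = 1}"

lemma one_positions_mult:
  assumes "x \<in> carrier (Z2_power k)" "y \<in> carrier (Z2_power k)"
  shows "one_positions k (x \<otimes>\<^bsub>Z2_power k\<^esub> y) = (one_positions k x - one_positions k y) \<union> (one_positions k y - one_positions k x)"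
  using Z2_power_mult_one[OF assms] by (auto simp: one_positions_def)

lemma one_positions_inj: "inj_on (one_positions k) (carrier (Z2_power k))"
  by (rule inj_onI) (auto intro!: Z2_power_eqI simp: one_positions_def)

lemma one_positions_surj:
  assumes "S \<subseteq> {..<k}"
  obtains x where "x \<in> carrier (Z2_power k)" "one_positions k x = S"
proof
  show "(\<lambda>i\<in>{..<k}. of_bool (i \<in> S)) \<in> carrier (Z2_power k)" by (auto simp: Z2_power_simps)
  show "one_positions k (\<lambda>i\<in>{..<k}. of_bool (i \<in> S)) = S" using assms by (auto simp: one_positions_def)
qed

text \<open>A lift of \<open>p\<close> in \<open>M\<close> differs from \<open>unfold_perm n
  p\<close> by a flip.\<close>

lemma unfold_perm_mem:
  assumes cov: "covers n M" and p: "p \<in> folded_group n"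
    and flips: "\<And>S g. S \<subseteq> {..<n} \<Longrightarrow> g \<in> M \<Longrightarrow> g = flip n S \<circ> unfold_perm n p \<Longrightarrow> flip n S \<in> M"
  shows "unfold_perm n p \<in> M"
proof -
  interpret perm_group "{0..<2 * n}" M by (rule covers_perm_group[OF cov])
  have "p \<in> bar n ` M" using cov p by (simp add: covers_def)
  then obtain g where g: "g \<in> M" "bar n g = p" by blast
  obtain S where S: "S \<subseteq> {..<n}" "g = flip n S \<circ> unfold_perm n p"
    using central_decomposition[OF covers_central[OF cov g(1)]] g(2) by auto
  have "flip n S \<circ> g = unfold_perm n p" unfolding S(2) by (simp add: fun_eq_iff flip_involution)
  then show ?thesis using comp_mem[OF flips[OF S(1) g(1) S(2)] g(1)] by simp
qed

lemma flip_5_in_IO: "flip 6 {5} \<in> carrier (IO_group 6)"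
proof -
  interpret perm_group "{0..<2 * 6}" "carrier (IO_group 6)" by (rule perm_group_IO)
  define g where "g = in_shuffle 6 \<circ> in_shuffle 6 \<circ> in_shuffle 6 \<circ> in_shuffle 6 \<circ> out_shuffle 6"
  have g: "g \<in> carrier (IO_group 6)" unfolding g_def by (intro comp_mem shuffle_mem)
  have "g \<circ> g \<circ> g \<circ> g \<circ> g = flip 6 {5}"
  proof (rule deck_ext)
    show "g \<circ> g \<circ> g \<circ> g \<circ> g permutes {0..<2 * 6}" by (intro permutes comp_mem g)
    show "flip 6 {5} permutes {0..<2 * 6}" by (rule central_permutes[OF flip_central])
    fix x :: nat assume "x < 2 * 6"
    then have "x = 0 \<or> x = Suc 0 \<or> x = 2 \<or> x = 3 \<or> x = 4 \<or> x = 5 \<or> x = 6 \<or> x = 7 \<or> x = 8 \<or> x = 9 \<or> x = 10 \<or> x = 11"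
      by presburger
    then show "(g \<circ> g \<circ> g \<circ> g \<circ> g) x = flip 6 {5} x"
      by (elim disjE) (simp_all add: g_def in_shuffle_def out_shuffle_def flip_def fold_pos_def mirror_def)
  qed
  then show ?thesis using comp_mem g by metis
qed

text \<open>The flip of the pair of \<open>5\<close> and its image under the reversal link
  \<open>5\<close> with \<open>0\<close>; this yields all flips of an even number of pairs,
  hence the mirror and the equality of both groups, and together with the flip of a single pair
  all flips.\<close>

theorem shuffle_group_6:
  "LR_group 6 = IO_group 6 \<and> iso_to_semidirect_product (LR_group 6) (Z2_power 6) (sym_group 5)"
proof -
  have f5: "flip 6 {5} \<in> shuffle_hull 6" using flip_5_in_IO IO_subset_hull by blast
  have ev: "flip 6 T \<in> M"
    if M: "covers 6 M" "\<And>g. g \<in> shuffle_hull 6 \<Longrightarrow> g \<in> M \<or> mirror 6 \<circ> g \<in> M" and T: "T \<subseteq> {..<6}" "even (card T)" for M T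
  proof -
    have "flip 6 (({5} - rev_blocks 6 6 ` {5}) \<union> (rev_blocks 6 6 ` {5} - {5})) \<in> M"
      by (rule flip_difference_mem[OF M f5 _ rev_whole_in_folded]) auto
    moreover have "rev_blocks 6 6 5 = 0" by (simp add: rev_blocks_def)
    ultimately have "flip_linked 6 M 5 0" by (simp add: flip_linked_def insert_commute)
    from flip_linked_sym[OF flip_linked_act[OF M(1) monge_in_folded this]] have "flip_linked 6 M 0 1" by (simp add: monge_6)
    then show ?thesis using even_flips_from_zero_one[OF M(1) _ T] by blast
  qed
  note evIO = ev[OF covers_IO hull_IO] and evLR = ev[OF covers_LR hull_LR]
  have IO: "carrier (IO_group 6) = shuffle_hull 6"
    by (rule mirror_mem_eq_hull[OF IO_subset_hull perm_group_IO mirror_even_flip hull_IO]) (use evIO in auto)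
  have LR: "carrier (LR_group 6) = shuffle_hull 6"
    by (rule mirror_mem_eq_hull[OF LR_subset_hull perm_group_LR mirror_even_flip hull_LR]) (use evLR in auto)
  interpret perm_group "{0..<2 * 6}" "carrier (LR_group 6)" by (rule perm_group_LR)
  have all: "flip 6 T \<in> carrier (LR_group 6)" if T: "T \<subseteq> {..<6}" for T
  proof (cases "even (card T)")
    case True then show ?thesis using evLR T by blast
  next
    case False
    let ?U = "if 5 \<in> T then T - {5} else insert 5 T"
    have fin: "finite T" using T finite_subset by blast
    have "even (card ?U)"
    proof (cases "5 \<in> T")
      case True
      then have "card T = Suc (card (T - {5}))" using fin by (metis card.remove)
      then show ?thesis using False True by simp
    qed (use False fin in simp)
    moreover have "?U \<subseteq> {..<6}" using T by auto
    ultimately have "flip 6 ?U \<in> carrier (LR_group 6)" using evLR by blast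
    moreover have "flip 6 T = flip 6 {5} \<circ> flip 6 ?U"
      unfolding flip_flip by (intro arg_cong[of _ _ "flip 6"]) auto
    ultimately show ?thesis using comp_mem f5 LR by metis
  qed
  obtain C where C: "bij_betw C (carrier (sym_group 5)) (folded_group 6)"
    "\<And>h k. h \<in> carrier (sym_group 5) \<Longrightarrow> k \<in> carrier (sym_group 5) \<Longrightarrow> C (h \<otimes>\<^bsub>sym_group 5\<^esub> k) = C h \<circ> C k"
    by (rule folded_6_iso) blast
  have "iso_to_semidirect_product (LR_group 6) (Z2_power 6) (sym_group 5)"
  proof (rule shuffle_group_splits[where T = "one_positions 6" and C = C])
    show "group (Z2_power 6)" by (rule group_Z2_power)
    show "group (sym_group 5)" by (rule sym_group_is_group)
    show "one_positions 6 x \<subseteq> {..<6} \<and> flip 6 (one_positions 6 x) \<in> carrier (LR_group 6)" for x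
      using all[of "one_positions 6 x"] by (auto simp: one_positions_def)
    show "\<exists>x\<in>carrier (Z2_power 6). one_positions 6 x = S" if "S \<subseteq> {..<6}" for S using one_positions_surj[OF that] by metis
    show "unfold_perm 6 p \<in> carrier (LR_group 6)" if "p \<in> folded_group 6" for p
      by (rule unfold_perm_mem[OF covers_LR that]) (rule all)
  qed (rule one_positions_inj one_positions_mult C; assumption)+
  then show ?thesis using group_eqI(1) IO LR by simp
qed

section \<open>The Mathieu group on twelve mirror pairs\<close>

text \<open>Products of permutations given by lists, evaluated as lists. Membership of such a
  product in a group is then a computation with lists.\<close>

definition word :: "nat \<Rightarrow> nat list list \<Rightarrow> nat list" where
  "word n ps = foldr (\<lambda>p q. map ((!) p) q) ps [0..<n]"

lemma perm_of_map: "f permutes {..<n} \<Longrightarrow> perm_of (map f [0..<n]) = f"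
  by (rule ext) (simp add: perm_of_def permutes_not_in)

lemma perm_of_word_mem:
  assumes M: "perm_group {..<n} M" and ps: "\<And>p. p \<in> set ps \<Longrightarrow> perm_of p \<in> M \<and> length p = n"
  shows "perm_of (word n ps) \<in> M"
proof -
  interpret perm_group "{..<n}" M by (rule M)
  have "perm_of (word n ps) \<in> M \<and> length (word n ps) = n"
    using ps
  proof (induction ps)
    case Nil
    have "perm_of (word n []) = id" by (rule ext) (simp add: perm_of_def word_def)
    then have "perm_of (word n []) \<in> M" using id_mem by (simp only:)
    then show ?case by (simp add: word_def)
  next
    case (Cons p ps)
    let ?q = "word n ps"
    have q: "perm_of ?q \<in> M" "length ?q = n" and p: "perm_of p \<in> M" "length p = n" using Cons by simp_all
    have w: "word n (p # ps) = map ((!) p) ?q" by (simp add: word_def)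
    have "perm_of (word n (p # ps)) = perm_of p \<circ> perm_of ?q"
    proof (rule ext)
      fix x show "perm_of (word n (p # ps)) x = (perm_of p \<circ> perm_of ?q) x"
      proof (cases "x < n")
        case True
        then have "perm_of ?q x < n" using permutes_in_image[OF permutes[OF q(1)], of x] by simp
        then show ?thesis using True p q by (simp add: w perm_of_def)
      qed (use p q in \<open>simp add: w perm_of_def\<close>)
    qed
    then have "perm_of (word n (p # ps)) \<in> M" using comp_mem[OF p(1) q(1)] by (simp only:)
    then show ?case using q w by simp
  qed
  then show ?thesis ..
qed

abbreviation "monge_list \<equiv> [0, 2, 4, 6, 8, 10, 11, 9, 7, 5, 3, 1]"
abbreviation "swap_list \<equiv> [1, 0, 3, 2, 5, 4, 7, 6, 9, 8, 11, 10]"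

lemma monge_12: "monge 12 = perm_of monge_list"
proof -
  have "map (monge 12) [0..<12] = monge_list" by code_simp
  then show ?thesis using perm_of_map[OF monge_permutes] by metis
qed

lemma rev_two_12: "rev_blocks 12 2 = perm_of swap_list"
proof -
  have "map (rev_blocks 12 2) [0..<12] = swap_list" by code_simp
  then show ?thesis using perm_of_map[OF rev_blocks_permutes] by metis
qed

lemma folded_12_word:
  assumes "set ps \<subseteq> {monge_list, swap_list}"
  shows "perm_of (word 12 ps) \<in> folded_group 12"
  by (rule perm_of_word_mem[OF perm_group_folded])
    (use assms monge_in_folded[of 12] rev_two_in_folded[of 12] in \<open>auto simp: monge_12 rev_two_12\<close>)

text \<open>The hexads of a Steiner system: every five points lie in exactly one of them.\<close>

definition hexads :: "nat list list" where
  "hexads =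
    [[0,1,2,3,4,11], [0,1,2,3,5,10], [0,1,2,3,6,9], [0,1,2,3,7,8], [0,1,2,4,5,9], [0,1,2,4,6,8],
     [0,1,2,4,7,10], [0,1,2,5,6,7], [0,1,2,5,8,11], [0,1,2,6,10,11], [0,1,2,7,9,11], [0,1,2,8,9,10],
     [0,1,3,4,5,8], [0,1,3,4,6,7], [0,1,3,4,9,10], [0,1,3,5,6,11], [0,1,3,5,7,9], [0,1,3,6,8,10],
     [0,1,3,7,10,11], [0,1,3,8,9,11], [0,1,4,5,6,10], [0,1,4,5,7,11], [0,1,4,6,9,11], [0,1,4,7,8,9],
     [0,1,4,8,10,11], [0,1,5,6,8,9], [0,1,5,7,8,10], [0,1,5,9,10,11], [0,1,6,7,8,11],
     [0,1,6,7,9,10], [0,2,3,4,5,7], [0,2,3,4,6,10], [0,2,3,4,8,9], [0,2,3,5,6,8], [0,2,3,5,9,11],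
     [0,2,3,6,7,11], [0,2,3,7,9,10], [0,2,3,8,10,11], [0,2,4,5,6,11], [0,2,4,5,8,10], [0,2,4,6,7,9],
     [0,2,4,7,8,11], [0,2,4,9,10,11], [0,2,5,6,9,10], [0,2,5,7,8,9], [0,2,5,7,10,11],
     [0,2,6,7,8,10], [0,2,6,8,9,11], [0,3,4,5,6,9], [0,3,4,5,10,11], [0,3,4,6,8,11], [0,3,4,7,8,10],
     [0,3,4,7,9,11], [0,3,5,6,7,10], [0,3,5,7,8,11], [0,3,5,8,9,10], [0,3,6,7,8,9], [0,3,6,9,10,11],
     [0,4,5,6,7,8], [0,4,5,7,9,10], [0,4,5,8,9,11], [0,4,6,7,10,11], [0,4,6,8,9,10], [0,5,6,7,9,11],
     [0,5,6,8,10,11], [0,7,8,9,10,11], [1,2,3,4,5,6], [1,2,3,4,7,9], [1,2,3,4,8,10], [1,2,3,5,7,11],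
     [1,2,3,5,8,9], [1,2,3,6,7,10], [1,2,3,6,8,11], [1,2,3,9,10,11], [1,2,4,5,7,8], [1,2,4,5,10,11],
     [1,2,4,6,7,11], [1,2,4,6,9,10], [1,2,4,8,9,11], [1,2,5,6,8,10], [1,2,5,6,9,11], [1,2,5,7,9,10],
     [1,2,6,7,8,9], [1,2,7,8,10,11], [1,3,4,5,7,10], [1,3,4,5,9,11], [1,3,4,6,8,9], [1,3,4,6,10,11],
     [1,3,4,7,8,11], [1,3,5,6,7,8], [1,3,5,6,9,10], [1,3,5,8,10,11], [1,3,6,7,9,11], [1,3,7,8,9,10],
     [1,4,5,6,7,9], [1,4,5,6,8,11], [1,4,5,8,9,10], [1,4,6,7,8,10], [1,4,7,9,10,11],
     [1,5,6,7,10,11], [1,5,7,8,9,11], [1,6,8,9,10,11], [2,3,4,5,8,11], [2,3,4,5,9,10],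
     [2,3,4,6,7,8], [2,3,4,6,9,11], [2,3,4,7,10,11], [2,3,5,6,7,9], [2,3,5,6,10,11], [2,3,5,7,8,10],
     [2,3,6,8,9,10], [2,3,7,8,9,11], [2,4,5,6,7,10], [2,4,5,6,8,9], [2,4,5,7,9,11], [2,4,6,8,10,11],
     [2,4,7,8,9,10], [2,5,6,7,8,11], [2,5,8,9,10,11], [2,6,7,9,10,11], [3,4,5,6,7,11],
     [3,4,5,6,8,10], [3,4,5,7,8,9], [3,4,6,7,9,10], [3,4,8,9,10,11], [3,5,6,8,9,11],
     [3,5,7,9,10,11], [3,6,7,8,10,11], [4,5,6,9,10,11], [4,5,7,8,10,11], [4,6,7,8,9,11],
     [5,6,7,8,9,10]]"

lemma hexads_monge: "list_all (\<lambda>h. List.member hexads (sort (map ((!) monge_list) h))) hexads"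
  by code_simp

lemma hexads_swap: "list_all (\<lambda>h. List.member hexads (sort (map ((!) swap_list) h))) hexads"
  by code_simp

lemma folded_12_wordI:
  "word 12 ps = p \<Longrightarrow> set ps \<subseteq> {monge_list, swap_list} \<Longrightarrow> perm_of p \<in> folded_group 12"
  using folded_12_word by blast

lemma hexads_less: "list_all (list_all (\<lambda>x. x < 12)) hexads"
  by code_simp

lemma hexads_image:
  assumes p: "list_all (\<lambda>h. List.member hexads (sort (map ((!) p) h))) hexads" and l: "length p = 12" and S: "S \<in> set ` set hexads"
  shows "perm_of p ` S \<in> set ` set hexads"
proof -
  obtain h where h: "h \<in> set hexads" "S = set h" using S by blast
  have "\<forall>x\<in>set h. x < 12" using hexads_less h(1) by (simp add: list_all_iff)
  then have "perm_of p ` S = set (sort (map ((!) p) h))" using l h(2) by (auto simp: perm_of_def)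
  moreover have "sort (map ((!) p) h) \<in> set hexads" using p h(1) by (simp add: list_all_iff)
  ultimately show ?thesis by blast
qed

lemma folded_hexads: "g \<in> folded_group 12 \<Longrightarrow> S \<in> set ` set hexads \<Longrightarrow> g ` S \<in> set ` set hexads"
  unfolding folded_group_def
proof (induction arbitrary: S rule: gen_by.induct)
  case gen_id
  then show ?case by (simp add: image_ident)
next
  case (gen_step f g)
  have "f ` (g ` S) \<in> set ` set hexads"
    using gen_step.hyps(1) hexads_image[OF hexads_monge _ gen_step.IH[OF gen_step.prems]]
      hexads_image[OF hexads_swap _ gen_step.IH[OF gen_step.prems]] monge_12 rev_two_12 by auto
  then show ?case unfolding image_comp .
qed

text \<open>A set \<open>Q\<close> of four points lies in four hexads, and what these have
  outside \<open>Q\<close> forms a perfect matching \<open>m\<close> of the other eight points.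
  The list \<open>m\<close> gives the partner of each point outside \<open>Q\<close>.\<close>

definition matched :: "nat list \<Rightarrow> nat list \<Rightarrow> bool" where
  "matched Q m \<longleftrightarrow>
     list_all (\<lambda>x. List.member Q x \<or> m ! x \<noteq> x \<and> \<not> List.member Q (m ! x) \<and> List.member hexads (sort (x # m ! x # Q))) [0..<12] \<and>
     list_all (\<lambda>h. list_all (List.member h) Q \<longrightarrow>
       list_all (\<lambda>x. List.member Q x \<or> list_all (\<lambda>y. List.member Q y \<or> y = x \<or> y = m ! x) h) h) hexads"

lemma matched_lists:
  "matched [1, 2, 4, 5] [9, 1, 2, 6, 4, 5, 3, 8, 7, 0, 11, 10]"
  "matched [0, 2, 4, 5] [0, 9, 2, 7, 4, 5, 11, 3, 10, 1, 8, 6]"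
  "matched [0, 1, 2, 4] [0, 1, 2, 11, 4, 9, 8, 10, 6, 5, 7, 3]"
  "matched [0, 1, 2, 5] [0, 1, 2, 10, 9, 5, 7, 6, 11, 4, 3, 8]"
  "matched [0, 1, 4, 5] [0, 1, 9, 8, 4, 5, 10, 11, 3, 2, 6, 7]"
  by code_simp+

text \<open>An element of the folded group that fixes \<open>Q\<close> pointwise permutes the
  hexads through \<open>Q\<close> and hence the pairs of the matching.\<close>

lemma matched_commutes:
  assumes m: "matched Q m" and g: "g \<in> folded_group 12" "\<forall>q\<in>set Q. g q = q" and x: "x < 12" "x \<notin> set Q"
  shows "g (m ! x) = m ! (g x)"
proof -
  interpret perm_group "{..<12}" "folded_group 12" by (rule perm_group_folded)
  have inj: "inj g" using bij_mem[OF g(1)] by (rule bij_is_inj)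
  have gQ: "g ` set Q = set Q" using g(2) by (auto simp: image_iff)
  have out: "g y \<notin> set Q" if "y \<notin> set Q" for y using gQ that inj by (metis image_iff injD)
  have mx: "m ! x \<noteq> x" "m ! x \<notin> set Q" "sort (x # m ! x # Q) \<in> set hexads"
    using m x by (auto simp: matched_def list_all_iff)
  have "g ` set (sort (x # m ! x # Q)) \<in> set ` set hexads" by (rule folded_hexads[OF g(1)]) (use mx in blast)
  then obtain h where h: "h \<in> set hexads" "set h = g ` set (sort (x # m ! x # Q))" by auto
  have hs: "set h = insert (g x) (insert (g (m ! x)) (set Q))" unfolding h(2) set_sort list.simps(15) image_insert gQ by (rule refl)
  have "\<forall>u\<in>set h. u \<in> set Q \<or> (\<forall>v\<in>set h. v \<in> set Q \<or> v = u \<or> v = m ! u)"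
    using m h(1) hs unfolding matched_def list_all_iff List.member_iff by blast
  then have "g (m ! x) = g x \<or> g (m ! x) = m ! (g x)" using hs out[OF x(2)] out[OF mx(2)] by blast
  then show ?thesis using inj mx(1) by (metis injD)
qed

lemma less_12_cases:
  "x < (12::nat) \<Longrightarrow> x = 0 \<or> x = Suc 0 \<or> x = 2 \<or> x = 3 \<or> x = 4 \<or> x = 5 \<or> x = 6 \<or> x = 7 \<or> x = 8 \<or> x = 9 \<or> x = 10 \<or> x = 11"
  by presburger

text \<open>The point \<open>9\<close> completes the five points to a hexad and is therefore
  fixed as well. On the remaining six points \<open>g\<close> commutes with five matchings. The
  product of four of them has \<open>8\<close> as its only fixed point, so \<open>g\<close>
  fixes \<open>8\<close>, and the matchings lead from \<open>8\<close> to the other five points.\<close>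

lemma fixing_five_trivial:
  assumes g: "g \<in> folded_group 12" and fx: "g 0 = 0" "g (Suc 0) = Suc 0" "g 2 = 2" "g 4 = 4" "g 5 = 5"
  shows "g = id"
proof -
  interpret perm_group "{..<12}" "folded_group 12" by (rule perm_group_folded)
  have fixed: "\<forall>q\<in>set [1, 2, 4, 5]. g q = q" "\<forall>q\<in>set [0, 2, 4, 5]. g q = q" "\<forall>q\<in>set [0, 1, 2, 4]. g q = q" "\<forall>q\<in>set [0, 1, 2, 5]. g q = q" "\<forall>q\<in>set [0, 1, 4, 5]. g q = q"
    using fx by simp_all
  note c = matched_commutes[OF matched_lists(1) g fixed(1)]
    matched_commutes[OF matched_lists(2) g fixed(2)]
    matched_commutes[OF matched_lists(3) g fixed(3)]
    matched_commutes[OF matched_lists(4) g fixed(4)]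
    matched_commutes[OF matched_lists(5) g fixed(5)]
  let ?A = "{3, 6, 7, 8, 10, 11} :: nat set"
  have g9: "g 9 = 9" using c(1)[of 0] fx(1) by simp
  define m1 m2 m3 m4 where m: "m1 = perm_of [9, 1, 2, 6, 4, 5, 3, 8, 7, 0, 11, 10]" "m2 = perm_of [0, 9, 2, 7, 4, 5, 11, 3, 10, 1, 8, 6]" "m3 = perm_of [0, 1, 2, 11, 4, 9, 8, 10, 6, 5, 7, 3]" "m4 = perm_of [0, 1, 2, 10, 9, 5, 7, 6, 11, 4, 3, 8]"
  have gA: "g x \<in> ?A" if "x \<in> ?A" for x
  proof -
    have "x < 12" using that by auto
    then have gx: "g x < 12" using permutes_in_image[OF permutes[OF g], of x] by simp
    moreover have ne: "g x \<noteq> y" if "g y = y" "x \<noteq> y" for y using bij_is_inj[OF bij_mem[OF g]] that by (metis injD)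
    then have "g x \<noteq> 0" "g x \<noteq> Suc 0" "g x \<noteq> 2" "g x \<noteq> 4" "g x \<noteq> 5" "g x \<noteq> 9" 
      using ne[OF fx(1)] ne[OF fx(2)] ne[OF fx(3)] ne[OF fx(4)] ne[OF fx(5)] ne[OF g9] that by auto
    ultimately show ?thesis using less_12_cases[OF gx] by (elim disjE) simp_all
  qed
  have mA: "m1 x \<in> ?A" "m2 x \<in> ?A" "m3 x \<in> ?A" "m4 x \<in> ?A" if "x \<in> ?A" for x
    using that by (auto simp: m perm_of_def)
  have l: "x < 12" if "x \<in> ?A" for x using that by auto
  have cm: "g (m1 x) = m1 (g x)" "g (m2 x) = m2 (g x)" "g (m3 x) = m3 (g x)" "g (m4 x) = m4 (g x)" if x: "x \<in> ?A" for x
  proof -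
    have out: "x \<notin> set [1, 2, 4, 5]" "x \<notin> set [0, 2, 4, 5]" "x \<notin> set [0, 1, 2, 4]" "x \<notin> set [0, 1, 2, 5]"
      using x by auto
    have ms: "m1 y = [9, 1, 2, 6, 4, 5, 3, 8, 7, 0, 11, 10] ! y" "m2 y = [0, 9, 2, 7, 4, 5, 11, 3, 10, 1, 8, 6] ! y" "m3 y = [0, 1, 2, 11, 4, 9, 8, 10, 6, 5, 7, 3] ! y" "m4 y = [0, 1, 2, 10, 9, 5, 7, 6, 11, 4, 3, 8] ! y" if "y < 12" for y
      using that by (simp_all add: m perm_of_def)
    show "g (m1 x) = m1 (g x)" using c(1)[OF l[OF x] out(1)] unfolding ms(1)[OF l[OF x]] ms(1)[OF l[OF gA[OF x]]] .
    show "g (m2 x) = m2 (g x)" using c(2)[OF l[OF x] out(2)] unfolding ms(2)[OF l[OF x]] ms(2)[OF l[OF gA[OF x]]] .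
    show "g (m3 x) = m3 (g x)" using c(3)[OF l[OF x] out(3)] unfolding ms(3)[OF l[OF x]] ms(3)[OF l[OF gA[OF x]]] .
    show "g (m4 x) = m4 (g x)" using c(4)[OF l[OF x] out(4)] unfolding ms(4)[OF l[OF x]] ms(4)[OF l[OF gA[OF x]]] .
  qed
  have "g 8 = 8"
  proof (rule commuting_fixes[of ?A g "\<lambda>x. m4 (m3 (m2 (m1 x)))"])
    show "g (m4 (m3 (m2 (m1 x)))) = m4 (m3 (m2 (m1 (g x))))" if "x \<in> ?A" for x
      using cm mA that by metis
    show "g x \<in> ?A" if "x \<in> ?A" for x by (rule gA[OF that])
    show "x = 8" if "x \<in> ?A" "m4 (m3 (m2 (m1 x))) = x" for x using that by (auto simp: m perm_of_def)
  qed (simp_all add: m perm_of_def)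
  moreover from this have "g 7 = 7" "g 10 = 10" "g 6 = 6" "g 11 = 11" "g 3 = 3"
    using c(1)[of 8] c(2)[of 8] c(3)[of 8] c(4)[of 8] c(5)[of 8] by simp_all
  ultimately have "g x = x" if "x < 12" for x using less_12_cases[OF that] fx g9 by (elim disjE) simp_all
  then show ?thesis by (intro permutes_eqI[OF permutes[OF g] permutes_id]) simp
qed

text \<open>These elements fix the points \<open>0\<close> and \<open>1\<close> and, in this
  order, more and more of \<open>5\<close> and \<open>4\<close>; they make the successive point
  stabilizers transitive.\<close>

lemma folded_12_chain:
  "perm_of [0, 1, 10, 8, 7, 2, 11, 6, 3, 4, 9, 5] \<in> folded_group 12"
  "perm_of [0, 1, 2, 11, 6, 5, 9, 4, 3, 7, 8, 10] \<in> folded_group 12"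
  "perm_of [0, 1, 6, 7, 4, 5, 9, 8, 11, 10, 2, 3] \<in> folded_group 12"
  "perm_of [0, 1, 11, 6, 4, 5, 8, 2, 10, 7, 3, 9] \<in> folded_group 12"
proof -
  show "perm_of [0, 1, 10, 8, 7, 2, 11, 6, 3, 4, 9, 5] \<in> folded_group 12"
    by (rule folded_12_wordI[of "[monge_list, swap_list, monge_list, monge_list, monge_list, swap_list, monge_list, swap_list, monge_list]"]) (code_simp, simp)
  show "perm_of [0, 1, 2, 11, 6, 5, 9, 4, 3, 7, 8, 10] \<in> folded_group 12"
    by (rule folded_12_wordI[of "[monge_list, swap_list, monge_list, swap_list, monge_list, swap_list, monge_list, monge_list, swap_list, monge_list, monge_list]"]) (code_simp, simp)
  show "perm_of [0, 1, 6, 7, 4, 5, 9, 8, 11, 10, 2, 3] \<in> folded_group 12"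
    by (rule folded_12_wordI[of "[swap_list, monge_list, monge_list, swap_list, monge_list, monge_list, monge_list, monge_list, monge_list, monge_list, monge_list, swap_list, monge_list, swap_list, monge_list]"]) (code_simp, simp)
  show "perm_of [0, 1, 11, 6, 4, 5, 8, 2, 10, 7, 3, 9] \<in> folded_group 12"
    by (rule folded_12_wordI[of "[monge_list, monge_list, monge_list, swap_list, monge_list, swap_list, monge_list, monge_list, monge_list, monge_list, monge_list, monge_list, monge_list, swap_list]"]) (code_simp, simp)
qed

text \<open>The group is sharply five-fold transitive: the order is \<open>12 \<cdot> 11 \<cdot>
  10 \<cdot> 9 \<cdot> 8\<close>.\<close>

lemma card_folded_12: "card (folded_group 12) = 95040"
proof -
  let ?F = "folded_group 12" and ?A = "{..<12::nat}"
  let ?M1 = "fixing 0 ?F" and ?A1 = "?A - {0}"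
  let ?M2 = "fixing (Suc 0) ?M1" and ?A2 = "?A1 - {Suc 0}"
  let ?M3 = "fixing 5 ?M2" and ?A3 = "?A2 - {5}"
  let ?M4 = "fixing 4 ?M3" and ?A4 = "?A3 - {4}"
  let ?M5 = "fixing 2 ?M4"
  have P0: "perm_group ?A ?F" by (rule perm_group_folded)
  have P1: "perm_group ?A1 ?M1" by (rule perm_group_fixing[OF P0])
  have P2: "perm_group ?A2 ?M2" by (rule perm_group_fixing[OF P1])
  have P3: "perm_group ?A3 ?M3" by (rule perm_group_fixing[OF P2])
  have P4: "perm_group ?A4 ?M4" by (rule perm_group_fixing[OF P3])
  interpret P4: perm_group ?A4 ?M4 by (rule P4)
  define i where "i = perm_of [0, 1, 6, 7, 4, 5, 9, 8, 11, 10, 2, 3]"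
  define j where "j = perm_of [0, 1, 11, 6, 4, 5, 8, 2, 10, 7, 3, 9]"
  have ij: "i \<in> ?M4" "j \<in> ?M4" using folded_12_chain(3,4) by (simp_all add: fixing_def i_def j_def perm_of_def)
  have iv: "i 2 = 6" "i 6 = 9" "i 9 = 10" "i 11 = 3" and jv: "j 2 = 11" "j 6 = 8" "j 9 = 7"
    by (simp_all add: i_def j_def perm_of_def)
  have t4: "transitive_on ?A4 ?M4"
  proof (rule P4.transitive_from[of 2])
    fix y :: nat assume "y \<in> ?A4"
    then have "y = 2 \<or> y = 6 \<or> y = 11 \<or> y = 9 \<or> y = 8 \<or> y = 3 \<or> y = 10 \<or> y = 7" using less_12_cases[of y] by auto
    then show "\<exists>g\<in>?M4. g 2 = y"
    proof (elim disjE)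
      assume "y = 2" then show ?thesis by (intro bexI[of _ id] P4.id_mem) simp
    next
      assume "y = 6" then show ?thesis using iv by (intro bexI[of _ i] ij) simp
    next
      assume "y = 11" then show ?thesis using jv by (intro bexI[of _ j] ij) simp
    next
      assume "y = 9" then show ?thesis using iv by (intro bexI[of _ "i \<circ> i"] P4.comp_mem ij) simp
    next
      assume "y = 8" then show ?thesis using iv jv by (intro bexI[of _ "j \<circ> i"] P4.comp_mem ij) simp
    next
      assume "y = 3" then show ?thesis using iv jv by (intro bexI[of _ "i \<circ> j"] P4.comp_mem ij) simp
    next
      assume "y = 10" then show ?thesis using iv by (intro bexI[of _ "i \<circ> i \<circ> i"] P4.comp_mem ij) simp
    next
      assume "y = 7" then show ?thesis using iv jv by (intro bexI[of _ "j \<circ> i \<circ> i"] P4.comp_mem ij) simp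
    qed
  qed
  have m3: "perm_of [0, 1, 2, 11, 6, 5, 9, 4, 3, 7, 8, 10] \<in> ?M3" using folded_12_chain(2) by (simp add: fixing_def perm_of_def)
  have t3: "transitive_on ?A3 ?M3" by (rule transitive_extend[OF P3 _ m3 _ t4]) (simp_all add: perm_of_def)
  have m2: "perm_of [0, 1, 10, 8, 7, 2, 11, 6, 3, 4, 9, 5] \<in> ?M2" using folded_12_chain(1) by (simp add: fixing_def perm_of_def)
  have t2: "transitive_on ?A2 ?M2" by (rule transitive_extend[OF P2 _ m2 _ t3]) (simp_all add: perm_of_def)
  have m1: "monge 12 \<in> ?M1" using monge_in_folded[of 12] by (simp add: fixing_def monge_12 perm_of_def)
  have t1: "transitive_on ?A1 ?M1" by (rule transitive_extend[OF P1 _ m1 _ t2]) (simp_all add: monge_12 perm_of_def)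
  have t0: "transitive_on ?A ?F"
    by (rule transitive_extend[OF P0 _ rev_two_in_folded _ t1]) (simp_all add: rev_two_12 perm_of_def)
  have M5: "?M5 = {id}"
    using fixing_five_trivial P4.id_mem unfolding fixing_def by auto
  have "card ?F = 12 * card ?M1" using card_transitive[OF P0 _ t0, of 0] by simp
  moreover have "card ?M1 = 11 * card ?M2" using card_transitive[OF P1 _ t1, of "Suc 0"] by simp
  moreover have "card ?M2 = 10 * card ?M3" using card_transitive[OF P2 _ t2, of 5] by simp
  moreover have "card ?M3 = 9 * card ?M4" using card_transitive[OF P3 _ t3, of 4] by simp
  moreover have "card ?M4 = 8 * card ?M5" using card_transitive[OF P4 _ t4, of 2] by simp
  ultimately show ?thesis unfolding M5 by simp
qed

lemma gen_by_image:
  assumes "C id = id" and C: "\<And>f g. C (f \<circ> g) = C f \<circ> C g"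
  shows "C ` gen_by S = gen_by (C ` S)"
proof
  show "C ` gen_by S \<subseteq> gen_by (C ` S)"
  proof
    fix y assume "y \<in> C ` gen_by S"
    then obtain x where x: "x \<in> gen_by S" "y = C x" by blast
    from x(1) have "C x \<in> gen_by (C ` S)"
    proof (induction rule: gen_by.induct)
      case gen_id show ?case unfolding assms(1) by (rule gen_by.gen_id)
    next
      case (gen_step f g) then show ?case unfolding C by (intro gen_by.gen_step) auto
    qed
    then show "y \<in> gen_by (C ` S)" using x by simp
  qed
  show "gen_by (C ` S) \<subseteq> C ` gen_by S"
  proof
    fix y assume "y \<in> gen_by (C ` S)"
    then show "y \<in> C ` gen_by S"
    proof (induction rule: gen_by.induct)
      case gen_id show ?case using gen_by.gen_id assms(1) by (metis imageI)
    next
      case (gen_step f g)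
      then obtain p q where "p \<in> S" "f = C p" "q \<in> gen_by S" "g = C q" by blast
      then show ?case using gen_by.gen_step[of p S q] C by (metis imageI)
    qed
  qed
qed

text \<open>Takes the points \<open>1\<close> to \<open>12\<close> of the Mathieu group to the
  mirror pairs. The value at \<open>0\<close> completes it to a permutation.\<close>

definition relabel :: "nat \<Rightarrow> nat" where
  "relabel = perm_of [12, 10, 6, 8, 5, 2, 9, 1, 4, 3, 0, 7, 11]"

lemma relabel_permutes: "relabel permutes {..<13}"
  unfolding relabel_def by (rule perm_of_permutes_length) auto

definition relabelled :: "(nat \<Rightarrow> nat) \<Rightarrow> nat \<Rightarrow> nat" where
  "relabelled p = relabel \<circ> p \<circ> inv' relabel"

lemma points_12: "x \<in> {1..12::nat} \<Longrightarrow> x = Suc 0 \<or> x = 2 \<or> x = 3 \<or> x = 4 \<or> x = 5 \<or> x = 6 \<or> x = 7 \<or> x = 8 \<or> x = 9 \<or> x = 10 \<or> x = 11 \<or> x = 12"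
  by (simp, presburger)

lemma relabelled_eqI:
  assumes m: "m permutes {1..12}" and h: "length h = 12"
    and eq: "\<And>x. x \<in> {1..12} \<Longrightarrow> relabel (m x) = h ! relabel x"
  shows "relabelled m = perm_of h"
proof -
  have b: "bij relabel" by (rule permutes_bij[OF relabel_permutes])
  have "relabel (m x) = perm_of h (relabel x)" for x
  proof (cases "x \<in> {1..12}")
    case True
    from points_12[OF this] have "relabel x < 12" by (elim disjE) (simp_all add: relabel_def perm_of_def)
    then show ?thesis using eq[OF True] h by (simp add: perm_of_def)
  next
    case False
    then have "m x = x" using m by (simp add: permutes_not_in)
    moreover have "x = 0 \<or> 13 \<le> x" using False by auto
    then have "12 \<le> relabel x" by (auto simp: relabel_def perm_of_def)
    ultimately show ?thesis using h by (simp add: perm_of_def)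
  qed
  then show ?thesis unfolding relabelled_def using b by (simp add: fun_eq_iff bij_is_surj surj_f_inv_f)
qed

abbreviation "mathieu_list_1 \<equiv> [7, 4, 9, 0, 3, 2, 8, 10, 5, 1, 6, 11]"
abbreviation "mathieu_list_2 \<equiv> [2, 7, 9, 3, 8, 0, 6, 4, 1, 5, 10, 11]"
abbreviation "mathieu_list_3 \<equiv> [1, 0, 3, 2, 5, 4, 7, 6, 9, 8, 11, 10]"

lemma relabelled_generators:
  "relabelled (cycle_of_list [1, 2, 3, 4, 5, 6, 7, 8, 9, 10, 11]) = perm_of mathieu_list_1"
  "relabelled (cycle_of_list [3, 7, 11, 8] \<circ> cycle_of_list [4, 10, 5, 6]) = perm_of mathieu_list_2"
  "relabelled (cycle_of_list [1, 12] \<circ> cycle_of_list [2, 11] \<circ> cycle_of_list [3, 6] \<circ>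
      cycle_of_list [4, 8] \<circ> cycle_of_list [5, 9] \<circ> cycle_of_list [7, 10]) = perm_of mathieu_list_3"
proof -
  note perm = mathieu_12_gens_in_sym_group[unfolded sym_group_def insert_subset mem_Collect_eq partial_object.simps]
  show "relabelled (cycle_of_list [1, 2, 3, 4, 5, 6, 7, 8, 9, 10, 11]) = perm_of mathieu_list_1"
    by (rule relabelled_eqI[OF perm[THEN conjunct1]], simp, drule points_12, elim disjE)
      (simp_all add: relabel_def perm_of_def transpose_def)
  show "relabelled (cycle_of_list [3, 7, 11, 8] \<circ> cycle_of_list [4, 10, 5, 6]) = perm_of mathieu_list_2"
    by (rule relabelled_eqI[OF perm[THEN conjunct2, THEN conjunct1]], simp, drule points_12, elim disjE)
      (simp_all add: relabel_def perm_of_def transpose_def)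
  show "relabelled (cycle_of_list [1, 12] \<circ> cycle_of_list [2, 11] \<circ> cycle_of_list [3, 6] \<circ>
      cycle_of_list [4, 8] \<circ> cycle_of_list [5, 9] \<circ> cycle_of_list [7, 10]) = perm_of mathieu_list_3"
    by (rule relabelled_eqI[OF perm[THEN conjunct2, THEN conjunct2, THEN conjunct1]], simp, drule points_12, elim disjE)
      (simp_all add: relabel_def perm_of_def transpose_def)
qed

text \<open>The generators of either group are products of the generators of the other.\<close>

lemma folded_12_eq_mathieu: "gen_by {perm_of mathieu_list_1, perm_of mathieu_list_2, perm_of mathieu_list_3} = folded_group 12"
    (is "gen_by ?S = _")
proof
  have S: "perm_of mathieu_list_1 \<in> folded_group 12"
    by (rule folded_12_wordI[of "[monge_list, monge_list, swap_list, monge_list, swap_list, monge_list, monge_list, monge_list, swap_list, monge_list]"]) (code_simp, simp)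
  have S2: "perm_of mathieu_list_2 \<in> folded_group 12"
    by (rule folded_12_wordI[of "[monge_list, monge_list, monge_list, monge_list, monge_list, monge_list, swap_list, monge_list, monge_list, monge_list, monge_list, monge_list, swap_list, monge_list, swap_list, monge_list, monge_list]"]) (code_simp, simp)
  have "?S \<subseteq> folded_group 12" using S S2 rev_two_in_folded[of 12] rev_two_12 by simp
  then show "gen_by ?S \<subseteq> folded_group 12" by (rule perm_group.gen_by_subset[OF perm_group_folded])
  have P: "perm_group {..<12} (gen_by ?S)"
    by (rule perm_group_gen_by) (auto intro!: perm_of_permutes_length)
  have "word 12 [mathieu_list_3, mathieu_list_2, mathieu_list_2, mathieu_list_3, mathieu_list_1, mathieu_list_2, mathieu_list_1, mathieu_list_1, mathieu_list_3, mathieu_list_2, mathieu_list_1, mathieu_list_3] = monge_list" by code_simp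
  moreover have "perm_of (word 12 [mathieu_list_3, mathieu_list_2, mathieu_list_2, mathieu_list_3, mathieu_list_1, mathieu_list_2, mathieu_list_1, mathieu_list_1, mathieu_list_3, mathieu_list_2, mathieu_list_1, mathieu_list_3]) \<in> gen_by ?S"
    by (rule perm_of_word_mem[OF P]) (auto intro: gen_by_incl)
  ultimately have "monge 12 \<in> gen_by ?S" unfolding monge_12 by (simp only:)
  moreover have "rev_blocks 12 2 \<in> gen_by ?S" unfolding rev_two_12 by (rule gen_by_incl) simp
  ultimately show "folded_group 12 \<subseteq> gen_by ?S" unfolding folded_group_def by (intro perm_group.gen_by_subset[OF P]) simp
qed

lemma mathieu_12_iso:
  "bij_betw relabelled (carrier mathieu_12) (folded_group 12)"
  "relabelled (h \<otimes>\<^bsub>mathieu_12\<^esub> k) = relabelled h \<circ> relabelled k"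
proof -
  have b: "bij relabel" by (rule permutes_bij[OF relabel_permutes])
  have hom: "relabelled (f \<circ> g) = relabelled f \<circ> relabelled g" for f g
    using b by (simp add: relabelled_def fun_eq_iff bij_is_inj)
  have id: "relabelled id = id" using b by (simp add: relabelled_def fun_eq_iff bij_is_surj surj_f_inv_f)
  have sym: "p \<in> carrier (sym_group 12) \<longleftrightarrow> p permutes {1..12}" "p \<otimes>\<^bsub>sym_group 12\<^esub> q = p \<circ> q" "\<one>\<^bsub>sym_group 12\<^esub> = id" for p q
    unfolding sym_group_def by simp_all
  let ?S = "{cycle_of_list [1, 2, 3, 4, 5, 6, 7, 8, 9, 10, 11],
      cycle_of_list [3, 7, 11, 8] \<circ> cycle_of_list [4, 10, 5, 6],
      cycle_of_list [1, 12] \<circ> cycle_of_list [2, 11] \<circ> cycle_of_list [3, 6] \<circ>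
        cycle_of_list [4, 8] \<circ> cycle_of_list [5, 9] \<circ> cycle_of_list [7, 10]} :: (nat \<Rightarrow> nat) set"
  have "carrier (sym_group 12) \<inter> ?S = ?S" using mathieu_12_gens_in_sym_group by (rule Int_absorb1)
  then have "carrier mathieu_12 = generate (sym_group 12) ?S"
    unfolding mathieu_12_def carrier_subgroup_generated by (rule arg_cong)
  also have "\<dots> = gen_by ?S"
    using mathieu_12_gens_in_sym_group sym(1)
    by (intro generate_eq_gen_by[OF sym_group_is_group sym finite_atLeastAtMost]) blast
  finally have "relabelled ` carrier mathieu_12 = gen_by (relabelled ` ?S)" using gen_by_image[of relabelled ?S, OF id hom] by simp
  then have "relabelled ` carrier mathieu_12 = folded_group 12"
    unfolding image_insert image_empty relabelled_generators folded_12_eq_mathieu .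
  moreover have "inj relabelled"
  proof (rule injI)
    fix p q assume "relabelled p = relabelled q"
    then have "relabelled p (relabel x) = relabelled q (relabel x)" for x by simp
    then have "p x = q x" for x using b by (simp add: relabelled_def bij_is_inj inj_eq)
    then show "p = q" by auto
  qed
  ultimately show "bij_betw relabelled (carrier mathieu_12) (folded_group 12)"
    unfolding bij_betw_def using inj_on_subset by blast
  have "monoid.mult mathieu_12 = (\<circ>)" unfolding mathieu_12_def by (simp add: subgroup_generated_def sym_group_def)
  then show "relabelled (h \<otimes>\<^bsub>mathieu_12\<^esub> k) = relabelled h \<circ> relabelled k" using hom by simp
qed

section \<open>Twenty-four cards\<close>

lemma order_semidirect:
  assumes "iso_to_semidirect_product G N H"
  shows "order G = order N * order H"
proof -
  obtain \<theta> where "G \<cong> semidirect_product N H \<theta>" using assms by (auto simp: iso_to_semidirect_product_def)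
  then have "card (carrier G) = card (carrier (semidirect_product N H \<theta>))" by (rule iso_same_card)
  then show ?thesis by (simp add: order_def semidirect_product_def card_cartesian_product)
qed

lemma order_Z2_power: "order (Z2_power k) = 2 ^ k"
  by (simp add: order_def Z2_power_simps card_PiE numeral_2_eq_2)

text \<open>A vector of length \<open>k\<close> extends in exactly one way to a set of even
  cardinality below \<open>k + 1\<close>. This identifies the flips of an even number of twelve
  pairs with vectors of length eleven.\<close>

definition even_positions :: "nat \<Rightarrow> (nat \<Rightarrow> int) \<Rightarrow> nat set" where
  "even_positions k x = (if even (card (one_positions k x)) then one_positions k x else insert k (one_positions k x))"

lemma one_positions_subset: "one_positions k x \<subseteq> {..<k}"
  by (auto simp: one_positions_def)

lemma even_positions:
  "even_positions k x \<subseteq> {..<Suc k}" "even (card (even_positions k x))" "even_positions k x \<inter> {..<k} = one_positions k x"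
proof -
  have "finite (one_positions k x)" "k \<notin> one_positions k x" using one_positions_subset finite_subset by (auto simp: one_positions_def)
  then show "even (card (even_positions k x))" by (simp add: even_positions_def)
  show "even_positions k x \<subseteq> {..<Suc k}" "even_positions k x \<inter> {..<k} = one_positions k x"
    using one_positions_subset[of k x] by (auto simp: even_positions_def)
qed

lemma even_subset_determined:
  assumes U: "U \<subseteq> {..<Suc k}" "even (card U)" and V: "V \<subseteq> {..<Suc k}" "even (card V)" and eq: "U \<inter> {..<k} = V \<inter> {..<k}"
  shows "U = V"
proof -
  have parity: "k \<in> S \<longleftrightarrow> odd (card (S \<inter> {..<k}))" if S: "S \<subseteq> {..<Suc k}" "even (card S)" for S
  proof (cases "k \<in> S")
    case True
    then have "S = insert k (S \<inter> {..<k})" using S(1) by (auto simp: less_Suc_eq)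
    then have "card S = Suc (card (S \<inter> {..<k}))" by (metis Int_iff card_insert_disjoint finite_Int finite_lessThan lessThan_iff less_irrefl)
    then show ?thesis using S(2) True by simp
  next
    case False
    then have "S \<inter> {..<k} = S" using S(1) by (auto simp: less_Suc_eq)
    then show ?thesis using S(2) False by simp
  qed
  have "k \<in> U \<longleftrightarrow> k \<in> V" using parity[OF U] parity[OF V] eq by simp
  moreover have "x \<in> U \<longleftrightarrow> x \<in> V" if "x < k" for x using eq that by blast
  ultimately have "x \<in> U \<longleftrightarrow> x \<in> V" if "x < Suc k" for x using that less_Suc_eq by metis
  then show ?thesis using U(1) V(1) by blast
qed

lemma even_card_sym_diff:
  assumes "finite A" "finite B" "even (card A)" "even (card B)"
  shows "even (card ((A - B) \<union> (B - A)))"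
proof -
  have "card A = card (A - B) + card (A \<inter> B)" "card B = card (B - A) + card (A \<inter> B)"
    using assms by (metis card_Diff_subset_Int card_mono finite_Int inf_le1 le_add_diff_inverse2)
      (metis assms(1,2) card_Diff_subset_Int card_mono finite_Int inf_commute inf_le1 le_add_diff_inverse2)
  moreover have "card ((A - B) \<union> (B - A)) = card (A - B) + card (B - A)"
    by (rule card_Un_disjoint) (use assms in auto)
  ultimately show ?thesis using assms by presburger
qed

lemma even_positions_mult:
  assumes "x \<in> carrier (Z2_power k)" "y \<in> carrier (Z2_power k)"
  shows "even_positions k (x \<otimes>\<^bsub>Z2_power k\<^esub> y) = (even_positions k x - even_positions k y) \<union> (even_positions k y - even_positions k x)"
proof (rule even_subset_determined[OF even_positions(1,2)])
  have fin: "finite (even_positions k z)" for z using even_positions(1) finite_subset by blast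
  show "even (card ((even_positions k x - even_positions k y) \<union> (even_positions k y - even_positions k x)))"
    by (rule even_card_sym_diff[OF fin fin even_positions(2) even_positions(2)])
  show "(even_positions k x - even_positions k y) \<union> (even_positions k y - even_positions k x) \<subseteq> {..<Suc k}"
    using even_positions(1) by blast
  have "((U - V) \<union> (V - U)) \<inter> {..<k} = (U \<inter> {..<k} - V \<inter> {..<k}) \<union> (V \<inter> {..<k} - U \<inter> {..<k})" for U V :: "nat set" by blast
  then show "even_positions k (x \<otimes>\<^bsub>Z2_power k\<^esub> y) \<inter> {..<k} = ((even_positions k x - even_positions k y) \<union> (even_positions k y - even_positions k x)) \<inter> {..<k}"
    unfolding even_positions(3) by (simp only: even_positions(3) one_positions_mult[OF assms])
qed

lemma even_positions_inj: "inj_on (even_positions k) (carrier (Z2_power k))"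
  using one_positions_inj[of k] even_positions(3)[of k] unfolding inj_on_def by metis

lemma even_positions_surj:
  assumes S: "S \<subseteq> {..<Suc k}" "even (card S)"
  obtains x where "x \<in> carrier (Z2_power k)" "even_positions k x = S"
proof -
  obtain x where x: "x \<in> carrier (Z2_power k)" "one_positions k x = S \<inter> {..<k}" using one_positions_surj[of "S \<inter> {..<k}" k] by blast
  have "even_positions k x = S" by (rule even_subset_determined[OF even_positions(1,2) S]) (simp add: even_positions(3) x(2))
  then show ?thesis using that x(1) by blast
qed

abbreviation "in_list \<equiv> [1, 3, 5, 7, 9, 11, 13, 15, 17, 19, 21, 23, 0, 2, 4, 6, 8, 10, 12, 14, 16, 18, 20, 22]"
abbreviation "out_list \<equiv> [0, 2, 4, 6, 8, 10, 12, 14, 16, 18, 20, 22, 1, 3, 5, 7, 9, 11, 13, 15, 17, 19, 21, 23]"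

text \<open>The product that is repeated here acts on the mirror pairs with order five.\<close>

lemma flip_0_8_in_IO: "flip 12 {0, 8} \<in> carrier (IO_group 12)"
proof -
  have P: "perm_group {..<24} (carrier (IO_group 12))" using perm_group_IO[of 12] by (simp add: lessThan_atLeast0)
  have "map (in_shuffle 12) [0..<24] = in_list" "map (out_shuffle 12) [0..<24] = out_list"
    "map (flip 12 {0, 8}) [0..<24] = [23, 1, 2, 3, 4, 5, 6, 7, 15, 9, 10, 11, 12, 13, 14, 8, 16, 17, 18, 19, 20, 21, 22, 0]" by code_simp+
  then have lists: "perm_of in_list = in_shuffle 12" "perm_of out_list = out_shuffle 12" "perm_of [23, 1, 2, 3, 4, 5, 6, 7, 15, 9, 10, 11, 12, 13, 14, 8, 16, 17, 18, 19, 20, 21, 22, 0] = flip 12 {0, 8}"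
    using perm_of_map[of "in_shuffle 12" 24] perm_of_map[of "out_shuffle 12" 24] perm_of_map[of "flip 12 {0, 8}" 24]
      in_shuffle_permutes[of 12] out_shuffle_permutes[of 12] central_permutes[OF flip_central, of 12 "{0, 8}"]
    by (simp_all add: lessThan_atLeast0)
  have "word 24 (concat (replicate 5 [in_list, in_list, in_list, out_list, in_list, out_list, out_list, out_list])) = [23, 1, 2, 3, 4, 5, 6, 7, 15, 9, 10, 11, 12, 13, 14, 8, 16, 17, 18, 19, 20, 21, 22, 0]"
    by code_simp
  moreover have "perm_of (word 24 (concat (replicate 5 [in_list, in_list, in_list, out_list, in_list, out_list, out_list, out_list]))) \<in> carrier (IO_group 12)"
    by (rule perm_of_word_mem[OF P]) (use lists(1,2) shuffle_mem(3,4)[of 12] in auto)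
  ultimately show ?thesis using lists(3) by metis
qed

text \<open>As \<open>monge 12\<close> fixes \<open>0\<close> and takes \<open>8\<close> to
  \<open>7\<close>, the flip of the pairs \<open>0\<close> and \<open>8\<close> links
  \<open>8\<close> with \<open>7\<close>. Moving this link by \<open>monge 12\<close> and by the
  exchange of neighbours links \<open>0\<close> with \<open>1\<close>, so that all flips of an
  even number of pairs occur. No others do, because all generators are even permutations and the
  flip of an odd number of pairs is odd.\<close>

theorem shuffle_group_12:
  "LR_group 12 = IO_group 12 \<and> iso_to_semidirect_product (LR_group 12) (Z2_power 11) mathieu_12 \<and>
    order (LR_group 12) = 2 ^ 11 * 95040"
proof -
  have f: "flip 12 {0, 8} \<in> shuffle_hull 12" using flip_0_8_in_IO IO_subset_hull by blast
  have ev: "flip 12 T \<in> M"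
    if M: "covers 12 M" "\<And>g. g \<in> shuffle_hull 12 \<Longrightarrow> g \<in> M \<or> mirror 12 \<circ> g \<in> M" and T: "T \<subseteq> {..<12}" "even (card T)" for M T
  proof -
    have "flip 12 (({0, 8} - monge 12 ` {0, 8}) \<union> (monge 12 ` {0, 8} - {0, 8})) \<in> M"
      by (rule flip_difference_mem[OF M f _ monge_in_folded]) auto
    moreover have "({0, 8} - monge 12 ` {0, 8}) \<union> (monge 12 ` {0, 8} - {0, 8}) = {8, 7}" by (auto simp: monge_12 perm_of_def)
    ultimately have l0: "flip_linked 12 M 8 7" by (simp add: flip_linked_def)
    have l1: "flip_linked 12 M 7 9" using flip_linked_act[OF M(1) monge_in_folded l0] by (simp add: monge_12 perm_of_def)
    have l2: "flip_linked 12 M 9 5" using flip_linked_act[OF M(1) monge_in_folded l1] by (simp add: monge_12 perm_of_def)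
    have l3: "flip_linked 12 M 5 10" using flip_linked_act[OF M(1) monge_in_folded l2] by (simp add: monge_12 perm_of_def)
    have l4: "flip_linked 12 M 10 3" using flip_linked_act[OF M(1) monge_in_folded l3] by (simp add: monge_12 perm_of_def)
    have l5: "flip_linked 12 M 3 6" using flip_linked_act[OF M(1) monge_in_folded l4] by (simp add: monge_12 perm_of_def)
    have l6: "flip_linked 12 M 6 11" using flip_linked_act[OF M(1) monge_in_folded l5] by (simp add: monge_12 perm_of_def)
    have l7: "flip_linked 12 M 11 (Suc 0)" using flip_linked_act[OF M(1) monge_in_folded l6] by (simp add: monge_12 perm_of_def)
    have l8: "flip_linked 12 M (Suc 0) 2" using flip_linked_act[OF M(1) monge_in_folded l7] by (simp add: monge_12 perm_of_def)
    have r: "flip_linked 12 M 0 3" using flip_linked_act[OF M(1) rev_two_in_folded l8] by (simp add: rev_two_12 perm_of_def)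
    have "flip_linked 12 M 3 (Suc 0)" using flip_linked_trans[OF M(1)] l5 l6 l7 by blast
    then have "flip_linked 12 M 0 1" using flip_linked_trans[OF M(1) r] by simp
    then show ?thesis using even_flips_from_zero_one[OF M(1) _ T] by blast
  qed
  note evIO = ev[OF covers_IO hull_IO] and evLR = ev[OF covers_LR hull_LR]
  have IO: "carrier (IO_group 12) = shuffle_hull 12"
    by (rule mirror_mem_eq_hull[OF IO_subset_hull perm_group_IO mirror_even_flip hull_IO]) (use evIO in auto)
  have LR: "carrier (LR_group 12) = shuffle_hull 12"
    by (rule mirror_mem_eq_hull[OF LR_subset_hull perm_group_LR mirror_even_flip hull_LR]) (use evLR in auto)
  have s: "sign (out_shuffle 12) = 1" using signs_mod_4(1)[of 3] by simp
  have pos: "sign g = 1" if "g \<in> carrier (LR_group 12)" for g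
  proof -
    have P: "perm_group {0..<2 * 12} {g \<in> central 12. sign g = 1}"
    proof
      show "id \<in> {g \<in> central 12. sign g = 1}" using perm_group.id_mem[OF perm_group_central] sign_id by blast
      fix p q assume "p \<in> {g \<in> central 12. sign g = 1}" "q \<in> {g \<in> central 12. sign g = 1}"
      then show "p \<circ> q \<in> {g \<in> central 12. sign g = 1}"
        using perm_group.comp_mem[OF perm_group_central, of p 12 q] sign_in_central(1)[of p 12 q] by simp
    qed (use central_permutes[of _ 12] in auto)
    have "carrier (LR_group 12) \<subseteq> {g \<in> central 12. sign g = 1}"
      unfolding carrier_LR
      by (rule perm_group.gen_by_subset[OF P]) (use s shuffle_central[of 12] in \<open>auto simp: sign_left_right sign_in\<close>)
    then show ?thesis using that by blast
  qed
  have flips: "flip 12 S \<in> carrier (LR_group 12) \<longleftrightarrow> even (card S)" if S: "S \<subseteq> {..<12}" for S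
    using evLR[OF _ S] pos[of "flip 12 S"] sign_flip[OF S] by (cases "even (card S)") auto
  have iso: "iso_to_semidirect_product (LR_group 12) (Z2_power 11) mathieu_12"
  proof (rule shuffle_group_splits[where T = "even_positions 11" and C = relabelled])
    show "group (Z2_power 11)" by (rule group_Z2_power)
    show "group mathieu_12" unfolding mathieu_12_def by (rule group.group_subgroup_generated[OF sym_group_is_group])
    show "even_positions 11 x \<subseteq> {..<12} \<and> flip 12 (even_positions 11 x) \<in> carrier (LR_group 12)" for x
      using even_positions[of 11 x] flips[of "even_positions 11 x"] by simp
    show "\<exists>x\<in>carrier (Z2_power 11). even_positions 11 x = S" if "S \<subseteq> {..<12}" "flip 12 S \<in> carrier (LR_group 12)" for S
      using even_positions_surj[of S 11] flips[OF that(1)] that by auto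
    show "unfold_perm 12 p \<in> carrier (LR_group 12)" if p: "p \<in> folded_group 12" for p
    proof (rule unfold_perm_mem[OF covers_LR p])
      fix S g assume S: "S \<subseteq> {..<12}" and g: "g \<in> carrier (LR_group 12)" "g = flip 12 S \<circ> unfold_perm 12 p"
      have pp: "p permutes {..<12}" using perm_group.permutes[OF perm_group_folded p] .
      have "sign g = sign (flip 12 S) * sign (unfold_perm 12 p)"
        unfolding g(2) by (rule sign_in_central(1)[OF flip_central unfold_perm_central[OF pp]])
      then have "sign (flip 12 S) = 1" using pos[OF g(1)] sign_unfold_perm[OF pp] by simp
      then show "flip 12 S \<in> carrier (LR_group 12)" using flips[OF S] sign_flip[OF S] by (cases "even (card S)") auto
    qed
  qed (rule even_positions_inj even_positions_mult mathieu_12_iso; assumption)+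
  have "order mathieu_12 = 95040" unfolding order_def using bij_betw_same_card[OF mathieu_12_iso(1)] card_folded_12 by simp
  then have "order (LR_group 12) = 2 ^ 11 * 95040" using order_semidirect[OF iso] order_Z2_power by simp
  then show ?thesis using group_eqI(1) IO LR iso by simp
qed

section \<open>The shuffle groups of all deck sizes\<close>

theorem theorem1p1:
  fixes n :: nat
  assumes "n \<ge> 1"
  shows
    "(2 * n = 12 \<longrightarrow>
        LR_group n = IO_group n \<and>
        iso_to_semidirect_product (LR_group n) (Z2_power 6) (sym_group 5)) \<and>
     (2 * n = 24 \<longrightarrow>
        LR_group n = IO_group n \<and>
        iso_to_semidirect_product (LR_group n) (Z2_power 11) mathieu_12 \<and>
        order (LR_group n) = 2 ^ 11 * 95040) \<and>
     (\<forall>k>0. 2 * n = 2 ^ k \<longrightarrow>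
        LR_group n = IO_group n \<and>
        iso_to_semidirect_product (LR_group n) (Z2_power k) (integer_mod_group k)) \<and>
     (n mod 4 = 0 \<and> n > 12 \<and> \<not> (\<exists>k. n = 2 ^ k) \<longrightarrow>
        LR_group n = IO_group n \<and>
        carrier (LR_group n) =
          kernel (B_group n) sign_img sign \<inter> kernel (B_group n) sign_img (sgn_bar n) \<and>
        order (LR_group n) = fact n * 2 ^ (n - 2)) \<and>
     (n mod 4 = 1 \<and> n > 1 \<longrightarrow>
        LR_group n = IO_group n \<and>
        carrier (LR_group n) = kernel (B_group n) sign_img (sgn_bar n) \<and>
        order (LR_group n) = fact n * 2 ^ (n - 1)) \<and>
     (n mod 4 = 2 \<and> n > 6 \<longrightarrow>
        LR_group n = IO_group n \<and>
        IO_group n = B_group n \<and>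
        order (LR_group n) = fact n * 2 ^ n) \<and>
     (n mod 4 = 3 \<longrightarrow>
        LR_group n = B_group n \<and>
        order (LR_group n) = fact n * 2 ^ n)"
proof (intro conjI impI allI)
  assume "2 * n = 12"
  then have "n = 6" by simp
  then show "LR_group n = IO_group n" "iso_to_semidirect_product (LR_group n) (Z2_power 6) (sym_group 5)"
    using shuffle_group_6 by metis+
next
  assume "2 * n = 24"
  then have "n = 12" by simp
  then show "LR_group n = IO_group n" "iso_to_semidirect_product (LR_group n) (Z2_power 11) mathieu_12"
    "order (LR_group n) = 2 ^ 11 * 95040"
    using shuffle_group_12 by metis+
next
  fix k :: nat assume "0 < k" "2 * n = 2 ^ k"
  then have "binary_deck k n" by unfold_locales
  then show "LR_group n = IO_group n" "iso_to_semidirect_product (LR_group n) (Z2_power k) (integer_mod_group k)"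
    using binary_deck.binary_shuffle_group by blast+
next
  assume "n mod 4 = 0 \<and> n > 12 \<and> \<not> (\<exists>k. n = 2 ^ k)"
  then show "LR_group n = IO_group n"
    "carrier (LR_group n) = kernel (B_group n) sign_img sign \<inter> kernel (B_group n) sign_img (sgn_bar n)"
    "order (LR_group n) = fact n * 2 ^ (n - 2)"
    unfolding kernels_eq(2) using shuffle_group_0_mod_4[of n] by metis+
next
  assume "n mod 4 = 1 \<and> n > 1"
  then show "LR_group n = IO_group n" "carrier (LR_group n) = kernel (B_group n) sign_img (sgn_bar n)"
    "order (LR_group n) = fact n * 2 ^ (n - 1)"
    unfolding kernels_eq(1) using shuffle_group_1_mod_4[of n] by metis+
next
  assume "n mod 4 = 2 \<and> n > 6"
  then show "LR_group n = IO_group n" "IO_group n = B_group n" "order (LR_group n) = fact n * 2 ^ n"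
    using shuffle_group_2_mod_4[of n] by metis+
next
  assume "n mod 4 = 3"
  then show "LR_group n = B_group n" "order (LR_group n) = fact n * 2 ^ n"
    using shuffle_group_3_mod_4[of n] by metis+
qed

end
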